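(* Let $d\ge 2$ and let $N=\binom{d+2}{2}-1$. If $\mathbb{X}\subseteq V_{2,d}\subseteq\mathbb{P}^N$ is a reduced complete intersection of type $(a_1,\dots,a_r)$ with $a_1\le\dots\le a_r$, then one of the following holds: 1. $d=2$, $r=4$ and $(a_1,\dots,a_4)=(1,1,1,2)$, that is, $\mathbb{X}$ is a conic lying on $V_{2,2}$; 2. $d=2$, $r=5$ and $(a_1,\dots,a_5)=(1,1,1,2,a_5)$ for some positive integer $a_5$, that is, $\mathbb{X}$ is a set of $2a_5$ points which is the complete intersection of a conic lying on $V_{2,2}$ and a hypersurface of degree $a_5$; 3. $r=N$ and $(a_1,\dots,a_N)=(1,1,\dots,1)$ ($d\ge 2$ arbitrary), that is, $\mathbb{X}$ is a reduced point; 4. $r=N$ and $(a_1,\dots,a_N)=(1,\dots,1,2)$ ($d\ge2$ arbitrary), that is, $\mathbb{X}$ is a set of two reduced points.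
   Context: $\mathbb{K}$ is an algebraically closed field of characteristic $0$, and projective spaces are over $\mathbb{K}$. For positive integers $n,d$ and $N=\binom{n+d}{d}-1$, the Veronese embedding $\nu_{n,d}:\mathbb{P}^n\to\mathbb{P}^N$ sends $[x_0,\dots,x_n]$ to the point whose coordinates are all monomials of degree $d$ in $x_0,\dots,x_n$ (in lexicographic order), and $V_{n,d}=\nu_{n,d}(\mathbb{P}^n)$. Varieties are non-empty reduced closed subschemes (not necessarily irreducible), and $\mathcal{I}(\mathbb{X})\subseteq\mathbb{K}[y_0,\dots,y_N]$ denotes the homogeneous (radical) ideal of $\mathbb{X}$. A variety $\mathbb{X}\subseteq\mathbb{P}^N$ is a complete intersection of type $(a_1,\dots,a_r)$ if $\mathcal{I}(\mathbb{X})=(f_1,\dots,f_r)$ with $f_i$ homogeneous of degree $a_i\geq 1$ and $\operatorname{codim}\mathbb{X}=r$ in $\mathbb{P}^N$. *)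

theory Defs
  imports
    "HOL-Library.Poly_Mapping"
    "HOL-Library.List_Lexorder"
    "HOL-Library.Extended_Nat"
    "HOL-Computational_Algebra.Polynomial"
begin

section \<open>Projective space\<close>

text \<open>
  A vector with coordinates \<open>x\<^sub>0, \<dots>, x\<^sub>n\<close> is a function on \<open>nat\<close> that is zero beyond \<open>n\<close>, so
  that equality of functions is equality of vectors. A point of projective space is a class of
  proportional nonzero vectors, and a subset of \<open>\<P>\<^sup>n\<close> has type \<open>(nat \<Rightarrow> 'k) set set\<close>.
\<close>

definition nonzero_vecs :: "nat \<Rightarrow> (nat \<Rightarrow> 'k::field) set" where
  "nonzero_vecs n = {x. (\<forall>i>n. x i = 0) \<and> (\<exists>i\<le>n. x i \<noteq> 0)}"

definition proj_rel :: "nat \<Rightarrow> ((nat \<Rightarrow> 'k::field) \<times> (nat \<Rightarrow> 'k)) set" where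
  "proj_rel n = {(x, y). x \<in> nonzero_vecs n \<and> y \<in> nonzero_vecs n \<and> (\<exists>c. c \<noteq> 0 \<and> y = (\<lambda>i. c * x i))}"

definition proj_space :: "nat \<Rightarrow> (nat \<Rightarrow> 'k::field) set set" where
  "proj_space n = nonzero_vecs n // proj_rel n"


section \<open>Polynomials and homogeneous ideals\<close>

text \<open>
  The library's \<^type>\<open>poly_mapping\<close> carries the ring structure of polynomials in the indeterminates
  \<open>y\<^sub>0, y\<^sub>1, \<dots>\<close>: the monoid of exponents is \<open>nat \<Rightarrow>\<^sub>0 nat\<close>. The ring
  \<open>\<bbbk>[y\<^sub>0, \<dots>, y\<^sub>N]\<close> is the subset \<open>poly_ring N\<close>.
\<close>

type_synonym 'k mpoly = "(nat \<Rightarrow>\<^sub>0 nat) \<Rightarrow>\<^sub>0 'k"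

definition poly_ring :: "nat \<Rightarrow> 'k::comm_ring_1 mpoly set" where
  "poly_ring N = {f. \<forall>m \<in> Poly_Mapping.keys f. Poly_Mapping.keys m \<subseteq> {..N}}"

definition peval :: "'k::comm_ring_1 mpoly \<Rightarrow> (nat \<Rightarrow> 'k) \<Rightarrow> 'k" where
  "peval f x = (\<Sum>m \<in> Poly_Mapping.keys f. Poly_Mapping.lookup f m *
                  (\<Prod>i \<in> Poly_Mapping.keys m. x i ^ Poly_Mapping.lookup m i))"

definition monom_degree :: "(nat \<Rightarrow>\<^sub>0 nat) \<Rightarrow> nat" where
  "monom_degree m = (\<Sum>i \<in> Poly_Mapping.keys m. Poly_Mapping.lookup m i)"

text \<open>As usual, the zero polynomial is a form of every degree.\<close>

definition forms :: "nat \<Rightarrow> nat \<Rightarrow> 'k::comm_ring_1 mpoly set" where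
  "forms N a = {f \<in> poly_ring N. \<forall>m \<in> Poly_Mapping.keys f. monom_degree m = a}"

definition ideal_gen :: "nat \<Rightarrow> 'k::comm_ring_1 mpoly set \<Rightarrow> 'k mpoly set" where
  "ideal_gen N F = {\<Sum>f\<in>A. g f * f | A g. finite A \<and> A \<subseteq> F \<and> (\<forall>f\<in>A. g f \<in> poly_ring N)}"


section \<open>Projective varieties\<close>

definition zero_locus :: "nat \<Rightarrow> 'k::field mpoly set \<Rightarrow> (nat \<Rightarrow> 'k) set set" where
  "zero_locus N F = {p \<in> proj_space N. \<forall>f\<in>F. \<forall>x\<in>p. peval f x = 0}"

definition zariski_closed :: "nat \<Rightarrow> (nat \<Rightarrow> 'k::field) set set \<Rightarrow> bool" where
  "zariski_closed N X \<longleftrightarrow> (\<exists>F. F \<subseteq> (\<Union>a. forms N a) \<and> X = zero_locus N F)"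

text \<open>
  Over an algebraically closed field a reduced closed subscheme is determined by its set of closed
  points; this is how a (possibly reducible) variety is represented here.
\<close>

definition proj_variety :: "nat \<Rightarrow> (nat \<Rightarrow> 'k::field) set set \<Rightarrow> bool" where
  "proj_variety N X \<longleftrightarrow> zariski_closed N X \<and> X \<noteq> {}"

text \<open>
  Vanishing is required on every representative of every point. Over an infinite field this makes
  \<open>vanishing_ideal N X\<close> the homogeneous radical ideal of \<open>X\<close>.
\<close>

definition vanishing_ideal :: "nat \<Rightarrow> (nat \<Rightarrow> 'k::field) set set \<Rightarrow> 'k mpoly set" where
  "vanishing_ideal N X = {f \<in> poly_ring N. \<forall>p\<in>X. \<forall>x\<in>p. peval f x = 0}"

definition irreducible_closed :: "nat \<Rightarrow> (nat \<Rightarrow> 'k::field) set set \<Rightarrow> bool" where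
  "irreducible_closed N Z \<longleftrightarrow> zariski_closed N Z \<and> Z \<noteq> {} \<and>
     (\<forall>A B. zariski_closed N A \<and> zariski_closed N B \<and> Z = A \<union> B \<longrightarrow> Z = A \<or> Z = B)"

text \<open>
  Krull dimension of the topological space \<open>X\<close> (intended for nonempty closed \<open>X\<close>): the supremum
  of the lengths \<open>n\<close> of chains \<open>Z\<^sub>0 \<subset> \<dots> \<subset> Z\<^sub>n\<close> of irreducible closed subsets of \<open>X\<close>.
\<close>

definition proj_dim :: "nat \<Rightarrow> (nat \<Rightarrow> 'k::field) set set \<Rightarrow> enat" where
  "proj_dim N X = Sup {enat n | n. \<exists>Z. (\<forall>i\<le>n. irreducible_closed N (Z i) \<and> Z i \<subseteq> X) \<and>
                                       (\<forall>i<n. Z i \<subset> Z (Suc i))}"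

text \<open>
  The last conjunct says that the codimension of \<open>X\<close> in \<open>\<P>\<^sup>N\<close> is the number of generators.
\<close>

definition complete_intersection ::
  "nat \<Rightarrow> nat list \<Rightarrow> (nat \<Rightarrow> 'k::field) set set \<Rightarrow> bool" where
  "complete_intersection N a X \<longleftrightarrow> proj_variety N X \<and>
     (\<exists>fs. length fs = length a \<and> (\<forall>i<length a. 1 \<le> a ! i \<and> fs ! i \<in> forms N (a ! i)) \<and>
           vanishing_ideal N X = ideal_gen N (set fs)) \<and>
     proj_dim N X + enat (length a) = enat N"

definition plane :: "nat \<Rightarrow> (nat \<Rightarrow> 'k::field) set set \<Rightarrow> bool" where
  "plane N P \<longleftrightarrow> (\<exists>u v w. {u, v, w} \<subseteq> nonzero_vecs N \<and>
     (\<forall>a b c. (\<lambda>i. a * u i + b * v i + c * w i) = (\<lambda>i. 0) \<longrightarrow> a = 0 \<and> b = 0 \<and> c = 0) \<and>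
     P = {proj_rel N `` {\<lambda>i. a * u i + b * v i + c * w i} | a b c. (a, b, c) \<noteq> (0, 0, 0)})"

text \<open>
  A conic is a reduced plane curve of degree two. The equality of ideals says that the scheme cut
  out by the quadratic form \<open>q\<close> on the plane \<open>P\<close> is reduced, which excludes double lines.
\<close>

definition conic :: "nat \<Rightarrow> (nat \<Rightarrow> 'k::field) set set \<Rightarrow> bool" where
  "conic N C \<longleftrightarrow> (\<exists>P q. plane N P \<and> q \<in> forms N 2 \<and> q \<notin> vanishing_ideal N P \<and>
     C = P \<inter> zero_locus N {q} \<and>
     vanishing_ideal N C = ideal_gen N (vanishing_ideal N P \<union> {q}))"

text \<open>
  \<open>X\<close> is, as a reduced scheme, the intersection of \<open>C\<close> with a hypersurface of degree \<open>b\<close>.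
\<close>

definition hypersurface_section ::
  "nat \<Rightarrow> nat \<Rightarrow> (nat \<Rightarrow> 'k::field) set set \<Rightarrow> (nat \<Rightarrow> 'k) set set \<Rightarrow> bool" where
  "hypersurface_section N b C X \<longleftrightarrow> (\<exists>h. h \<in> forms N b \<and> h \<noteq> 0 \<and>
     X = C \<inter> zero_locus N {h} \<and>
     vanishing_ideal N X = ideal_gen N (vanishing_ideal N C \<union> {h}))"


section \<open>Veronese varieties\<close>

text \<open>
  Exponent vectors of the monomials of degree \<open>d\<close> in \<open>x\<^sub>0, \<dots>, x\<^sub>n\<close>, in lexicographic order with
  \<open>x\<^sub>0\<^sup>d\<close> first.
\<close>

definition veronese_exponents :: "nat \<Rightarrow> nat \<Rightarrow> nat list list" where
  "veronese_exponents n d = rev (sorted_list_of_set {e. length e = Suc n \<and> sum_list e = d})"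

definition veronese_vec :: "nat \<Rightarrow> nat \<Rightarrow> (nat \<Rightarrow> 'k::field) \<Rightarrow> (nat \<Rightarrow> 'k)" where
  "veronese_vec n d x = (\<lambda>j. if j < length (veronese_exponents n d)
                              then \<Prod>i\<le>n. x i ^ (veronese_exponents n d ! j ! i) else 0)"

text \<open>
  The union over the representatives \<open>x\<close> of \<open>p\<close> is the usual lifting to classes: the class of
  \<open>veronese_vec n d x\<close> does not depend on \<open>x\<close>.
\<close>

definition veronese :: "nat \<Rightarrow> nat \<Rightarrow> (nat \<Rightarrow> 'k::field) set \<Rightarrow> (nat \<Rightarrow> 'k) set" where
  "veronese n d p = (\<Union>x\<in>p. proj_rel ((n + d choose d) - 1) `` {veronese_vec n d x})"

definition veronese_variety :: "nat \<Rightarrow> nat \<Rightarrow> (nat \<Rightarrow> 'k::field) set set" where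
  "veronese_variety n d = veronese n d ` proj_space n"

end

theory Submission
  imports Defs "HOL-Library.Function_Algebras"
begin

text \<open>
  Let \<open>b\<close> and \<open>H\<close> be the values at \<open>1\<close> and \<open>2\<close> of the Hilbert function of \<open>X\<close>, and let \<open>Y\<close> be the
  preimage of \<open>X\<close> in the plane, so that \<open>b\<close> and \<open>H\<close> are the values of the Hilbert function of
  \<open>Y\<close> at \<open>d\<close> and \<open>2 d\<close>. Among the \<open>r \<le> N\<close> generators at least \<open>N + 1 - b\<close> are linear, hence at
  most \<open>b - 1\<close> are quadrics, and \<open>X\<close> spans a space of dimension \<open>b - 1\<close>; therefore
  \<open>H \<ge> b (b + 1) / 2 - (b - 1)\<close>. On the other hand \<open>H\<close> is small: the first difference of the
  Hilbert function of a finite set of points in the plane does not increase any more once it fails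
  to be maximal. Comparing both bounds leaves \<open>b \<le> 2\<close>, where \<open>X\<close> is one or two points, and
  \<open>b = d + 1\<close> with \<open>d \<le> 3\<close>, where \<open>Y\<close> lies on a line. In the latter case \<open>X\<close> lies on the rational
  normal curve \<open>C\<close> that is the image of the line. If all generators vanish on \<open>C\<close> then \<open>X = C\<close> is
  infinite, so that \<open>r < N\<close>; this excludes \<open>d = 3\<close>. For \<open>d = 2\<close> at most one more generator is
  needed, and the points of \<open>X\<close> are the zeros of the binary form that it induces on the line.
\<close>

section \<open>Finite-dimensional spaces of functions\<close>

text \<open>The obstacle is that \<open>X\<close> is not known to be finite, and a linear form
  without zeros on an infinite set of points need not exist. Hilbert functions are therefore
  dimensions of spaces of functions restricted to an arbitrary cone, and finitely many points with
  dual functions carry the values needed. The bound \<open>d <= 3\<close> on the line: the first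
  difference is then constantly 1 up to \<open>d\<close>, so \<open>b = d + 1\<close> and
  \<open>H <= 2 * d + 1\<close>, and the lower bound for \<open>H\<close> becomes
  \<open>d * d <= 3 * d\<close>. On the curve \<open>C\<close> a form of degree \<open>k\<close> is
  a binary form of degree \<open>d * k\<close>, from a space of dimension \<open>d * k + 1\<close>.
  If the Hilbert function of \<open>X\<close> reaches this value at \<open>k\<close>, every form of
  degree \<open>k\<close> vanishing on \<open>X\<close> vanishes on \<open>C\<close>; if it is one
  less, such forms are proportional on \<open>C\<close>. Reducedness gives exactly \<open>d\<close>
  times the degree of the last form as number of points: with fewer points, forms of that degree not
  proportional to it on \<open>C\<close> would lie in the ideal.\<close>

interpretation funs: vector_space "\<lambda>(c::'k::field) (f::'a \<Rightarrow> 'k) x. c * f x"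
  by standard (auto simp: fun_eq_iff algebra_simps)

text \<open>Extension by zero keeps restrictions in the same function space, so that restriction to
  \<open>E\<close> is a linear endomorphism and \<open>span\<close> and \<open>dim\<close> apply to
  its image.\<close>

definition rs :: "'a set \<Rightarrow> ('a \<Rightarrow> 'k::field) \<Rightarrow> 'a \<Rightarrow> 'k" where
  "rs E f = (\<lambda>x. if x \<in> E then f x else 0)"

text \<open>For \<open>E\<close> a cone over a projective set and \<open>W\<close> the forms of
  degree \<open>t\<close>, this is the value at \<open>t\<close> of the Hilbert function.\<close>

definition fdim :: "'a set \<Rightarrow> ('a \<Rightarrow> 'k::field) set \<Rightarrow> nat" where
  "fdim E W = funs.dim (rs E ` W)"

lemma span_add_fun: "f \<in> funs.span B \<Longrightarrow> g \<in> funs.span B \<Longrightarrow> (\<lambda>x. f x + g x) \<in> funs.span B"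
  using funs.span_add[of f B g] by (simp add: plus_fun_def)

lemma span_zero_fun: "(\<lambda>x. 0) \<in> funs.span B"
  using funs.span_zero[of B] by (simp add: zero_fun_def)

lemma sum_fun_apply: "(\<Sum>i\<in>I. f i) x = (\<Sum>i\<in>I. f i x)"
  by (induction I rule: infinite_finite_induct) auto

lemma span_sum_fun:
  assumes "\<And>i. i \<in> I \<Longrightarrow> f i \<in> funs.span B"
  shows "(\<lambda>x. \<Sum>i\<in>I. c i * f i x) \<in> funs.span B"
proof -
  have "(\<Sum>i\<in>I. (\<lambda>x. c i * f i x)) \<in> funs.span B"
    by (intro funs.span_sum funs.span_scale assms)
  moreover have "(\<Sum>i\<in>I. (\<lambda>x. c i * f i x)) = (\<lambda>x. \<Sum>i\<in>I. c i * f i x)"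
    by (auto simp: fun_eq_iff sum_fun_apply)
  ultimately show ?thesis by simp
qed

lemma span_fun_induct [consumes 1, case_names zero add base]:
  assumes "f \<in> funs.span B" "P (\<lambda>x. 0)"
    and "\<And>f g. P f \<Longrightarrow> P g \<Longrightarrow> P (\<lambda>x. f x + g x)"
    and "\<And>c b. b \<in> B \<Longrightarrow> P (\<lambda>x. c * b x)"
  shows "P f"
  using assms(1)
proof (induction rule: funs.span_induct_alt)
  case base
  then show ?case using assms(2) by (simp add: zero_fun_def)
next
  case (step c x y)
  then show ?case using assms(3)[OF assms(4)[OF step(1)] step(2)] by (simp add: plus_fun_def)
qed

lemma span_mult_fun:
  assumes "f \<in> funs.span T" "\<And>b. b \<in> T \<Longrightarrow> (\<lambda>x. w x * b x) \<in> funs.span T'"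
  shows "(\<lambda>x. w x * f x) \<in> funs.span T'"
  using assms(1)
proof (induction rule: span_fun_induct)
  case zero
  show ?case by (simp only: mult_zero_right span_zero_fun)
next
  case (add f g)
  from span_add_fun[OF add] show ?case by (simp add: algebra_simps)
next
  case (base c b)
  from funs.span_scale[OF assms(2)[OF base], of c] show ?case by (simp add: algebra_simps)
qed

lemma subspace_fun:
  assumes "funs.subspace W"
  shows "(\<lambda>x. 0) \<in> W" "f \<in> W \<Longrightarrow> g \<in> W \<Longrightarrow> (\<lambda>x. f x + g x) \<in> W"
    "f \<in> W \<Longrightarrow> (\<lambda>x. c * f x) \<in> W" "f \<in> W \<Longrightarrow> g \<in> W \<Longrightarrow> (\<lambda>x. f x - g x) \<in> W"
    "(\<And>i. i \<in> I \<Longrightarrow> h i \<in> W) \<Longrightarrow> (\<lambda>x. \<Sum>i\<in>I. a i * h i x) \<in> W"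
proof -
  have W: "funs.span W = W" using assms by simp
  show "(\<lambda>x. 0) \<in> W" using funs.subspace_0[OF assms] by (simp add: zero_fun_def)
  show "f \<in> W \<Longrightarrow> g \<in> W \<Longrightarrow> (\<lambda>x. f x + g x) \<in> W" using span_add_fun[of f W g] W by simp
  show "f \<in> W \<Longrightarrow> (\<lambda>x. c * f x) \<in> W" using funs.subspace_scale[OF assms] by simp
  show "f \<in> W \<Longrightarrow> g \<in> W \<Longrightarrow> (\<lambda>x. f x - g x) \<in> W"
    using funs.subspace_diff[OF assms, of f g] by (simp add: fun_diff_def)
  show "(\<And>i. i \<in> I \<Longrightarrow> h i \<in> W) \<Longrightarrow> (\<lambda>x. \<Sum>i\<in>I. a i * h i x) \<in> W"
    using span_sum_fun[of I h W a] W by simp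
qed

lemma rs_span: "rs E ` funs.span B = funs.span (rs E ` B)"
proof -
  have "module_hom (\<lambda>(c::'b) f x. c * f x) (\<lambda>c f x. c * f x) (rs E :: ('a \<Rightarrow> 'b) \<Rightarrow> _)"
    by unfold_locales (auto simp: rs_def fun_eq_iff algebra_simps)
  then show ?thesis using module_hom.span_image by metis
qed

text \<open>Relations are indexed by \<open>I\<close> and not by a set of functions, so that a
  repetition counts as a dependence: equal restrictions satisfy the relation with coefficients 1 and
  -1.\<close>

lemma indep_on:
  assumes fin: "finite I"
    and ind: "\<And>c. (\<forall>x\<in>E. (\<Sum>i\<in>I. c i * f i x) = 0) \<Longrightarrow> \<forall>i\<in>I. c i = 0"
  shows "funs.independent ((\<lambda>i. rs E (f i)) ` I) \<and> card ((\<lambda>i. rs E (f i)) ` I) = card I"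
proof -
  have inj: "inj_on (\<lambda>i. rs E (f i)) I"
  proof (rule inj_onI, rule ccontr)
    fix i j assume ij: "i \<in> I" "j \<in> I" "rs E (f i) = rs E (f j)" "i \<noteq> j"
    define c :: "_ \<Rightarrow> 'b" where "c = (\<lambda>k. if k = i then 1 else if k = j then -1 else 0)"
    have "\<forall>x\<in>E. (\<Sum>k\<in>I. c k * f k x) = 0"
    proof
      fix x assume x: "x \<in> E"
      have "f i x = f j x" using fun_cong[OF ij(3), of x] x by (simp add: rs_def)
      have "(\<Sum>k\<in>I. c k * f k x) = (\<Sum>k\<in>{i,j}. c k * f k x)"
        by (rule sum.mono_neutral_right) (use fin ij in \<open>auto simp: c_def\<close>)
      also have "\<dots> = 0" using ij \<open>f i x = f j x\<close> by (simp add: c_def)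
      finally show "(\<Sum>k\<in>I. c k * f k x) = 0" .
    qed
    from ind[OF this] ij show False by (auto simp: c_def)
  qed
  have "funs.independent ((\<lambda>i. rs E (f i)) ` I)"
  proof
    assume "funs.dependent ((\<lambda>i. rs E (f i)) ` I)"
    then obtain u where u: "\<exists>v\<in>(\<lambda>i. rs E (f i)) ` I. u v \<noteq> 0"
      "(\<Sum>v\<in>(\<lambda>i. rs E (f i)) ` I. (\<lambda>x. u v * v x)) = 0"
      using funs.dependent_finite[of "(\<lambda>i. rs E (f i)) ` I"] fin by auto
    from u(2) have e: "(\<Sum>i\<in>I. (\<lambda>x. u (rs E (f i)) * rs E (f i) x)) = 0"
      by (subst (asm) sum.reindex[OF inj]) (simp add: o_def)
    have "\<forall>x\<in>E. (\<Sum>i\<in>I. u (rs E (f i)) * f i x) = 0"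
    proof
      fix x assume x: "x \<in> E"
      have "(\<Sum>i\<in>I. (\<lambda>x. u (rs E (f i)) * rs E (f i) x)) x = 0" using e by simp
      then show "(\<Sum>i\<in>I. u (rs E (f i)) * f i x) = 0"
        using x by (simp add: sum_fun_apply rs_def)
    qed
    from ind[OF this] u(1) show False by auto
  qed
  with inj show ?thesis by (simp add: card_image)
qed

lemma indep_on_card_le:
  assumes fin: "finite I"
    and ind: "\<And>c. (\<forall>x\<in>E. (\<Sum>i\<in>I. c i * f i x) = 0) \<Longrightarrow> \<forall>i\<in>I. c i = 0"
    and B: "finite B" "\<And>i. i \<in> I \<Longrightarrow> \<exists>h\<in>funs.span B. \<forall>x\<in>E. f i x = h x"
  shows "card I \<le> card B"
proof -
  have ii: "funs.independent ((\<lambda>i. rs E (f i)) ` I) \<and> card ((\<lambda>i. rs E (f i)) ` I) = card I"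
    by (rule indep_on[OF fin ind])
  have "(\<lambda>i. rs E (f i)) ` I \<subseteq> funs.span (rs E ` B)"
  proof
    fix g assume "g \<in> (\<lambda>i. rs E (f i)) ` I"
    then obtain i where i: "i \<in> I" "g = rs E (f i)" by auto
    from B(2)[OF i(1)] obtain h where h: "h \<in> funs.span B" "\<forall>x\<in>E. f i x = h x" by auto
    then have "g = rs E h" using i by (auto simp: rs_def fun_eq_iff)
    then show "g \<in> funs.span (rs E ` B)" using h(1) rs_span[of E B] by auto
  qed
  then have "card ((\<lambda>i. rs E (f i)) ` I) \<le> card (rs E ` B)"
    using funs.independent_span_bound[of "rs E ` B" "(\<lambda>i. rs E (f i)) ` I"] ii B(1) by auto
  then show ?thesis using ii card_image_le[OF B(1), of "rs E"] by simp
qed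

lemma fdim_le:
  assumes B: "finite B" "\<And>f. f \<in> W \<Longrightarrow> \<exists>h\<in>funs.span B. \<forall>x\<in>E. f x = h x"
  shows "fdim E W \<le> card B"
proof -
  have "rs E ` W \<subseteq> funs.span (rs E ` B)"
  proof
    fix g assume "g \<in> rs E ` W"
    then obtain f where f: "f \<in> W" "g = rs E f" by auto
    from B(2)[OF f(1)] obtain h where h: "h \<in> funs.span B" "\<forall>x\<in>E. f x = h x" by auto
    then have "g = rs E h" using f by (auto simp: rs_def fun_eq_iff)
    then show "g \<in> funs.span (rs E ` B)" using h(1) rs_span[of E B] by auto
  qed
  then have "fdim E W \<le> card (rs E ` B)"
    unfolding fdim_def using B(1) funs.dim_le_card by blast
  then show ?thesis using card_image_le[OF B(1), of "rs E"] by simp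
qed

text \<open>\<open>dim\<close> is the cardinality of a basis and therefore 0 on an
  infinite-dimensional space; this condition excludes that default value wherever
  \<open>fdim\<close> is bounded below.\<close>

definition fin_gen :: "('a \<Rightarrow> 'k::field) set \<Rightarrow> bool" where
  "fin_gen W \<longleftrightarrow> (\<exists>B. finite B \<and> W \<subseteq> funs.span B)"

lemma indep_on_le_fdim:
  assumes W: "fin_gen W" "\<And>i. i \<in> I \<Longrightarrow> f i \<in> W" and fin: "finite I"
    and ind: "\<And>c. (\<forall>x\<in>E. (\<Sum>i\<in>I. c i * f i x) = 0) \<Longrightarrow> \<forall>i\<in>I. c i = 0"
  shows "card I \<le> fdim E W"
proof -
  obtain B where B: "B \<subseteq> rs E ` W" "funs.independent B" "rs E ` W \<subseteq> funs.span B" "card B = funs.dim (rs E ` W)"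
    by (rule funs.basis_exists[of "rs E ` W"])
  from W(1) obtain B0 where B0: "finite B0" "W \<subseteq> funs.span B0" by (auto simp: fin_gen_def)
  have "B \<subseteq> funs.span (rs E ` B0)" using B(1) B0(2) unfolding rs_span[symmetric] by (meson image_mono order_trans)
  then have finB: "finite B" using funs.independent_span_bound[of "rs E ` B0" B] B(2) B0(1) by simp
  have ii: "funs.independent ((\<lambda>i. rs E (f i)) ` I) \<and> card ((\<lambda>i. rs E (f i)) ` I) = card I"
    by (rule indep_on[OF fin ind])
  moreover have "(\<lambda>i. rs E (f i)) ` I \<subseteq> funs.span B" using W(2) B(3) by blast
  ultimately have "card I \<le> card B"
    using funs.independent_span_bound[OF finB, of "(\<lambda>i. rs E (f i)) ` I"] by auto
  then show ?thesis using B(4) by (simp add: fdim_def)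
qed

text \<open>The points are a finite witness for the dimension of \<open>W\<close> on a possibly
  infinite \<open>E\<close>, and the functions form an interpolation basis for them.\<close>

definition dual_sys :: "'a set \<Rightarrow> ('a \<Rightarrow> 'k::field) set \<Rightarrow> nat \<Rightarrow> (nat \<Rightarrow> 'a) \<Rightarrow> (nat \<Rightarrow> 'a \<Rightarrow> 'k) \<Rightarrow> bool" where
  "dual_sys E W n p g \<longleftrightarrow> (\<forall>i<n. p i \<in> E \<and> g i \<in> W) \<and>
     (\<forall>i<n. \<forall>j<n. g i (p j) = (if i = j then 1 else 0))"

lemma dual_sys_indep:
  assumes "dual_sys E W n p g" "E \<subseteq> E'" "\<forall>x\<in>E'. (\<Sum>i<n. c i * g i x) = 0" "i < n"
  shows "c i = 0"
proof -
  have "p i \<in> E'" using assms by (auto simp: dual_sys_def)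
  then have "(\<Sum>k<n. c k * g k (p i)) = 0" using assms(3) by blast
  moreover have "(\<Sum>k<n. c k * g k (p i)) = (\<Sum>k<n. if k = i then c k else 0)"
    by (rule sum.cong) (use assms in \<open>auto simp: dual_sys_def\<close>)
  ultimately show ?thesis using assms(4) by simp
qed

lemma dual_sys_le_fdim:
  assumes "dual_sys E W n p g" "fin_gen W"
  shows "n \<le> fdim E W"
proof -
  have "card {..<n} \<le> fdim E W"
    by (rule indep_on_le_fdim[where f = g])
      (use assms dual_sys_indep[OF assms(1) order_refl] in \<open>auto simp: dual_sys_def\<close>)
  then show ?thesis by simp
qed

text \<open>A dual system of maximal length works: if a function of \<open>W\<close> differs at some
  \<open>x\<close> from its interpolation at the chosen points, the difference vanishes at these
  points but not at \<open>x\<close> and extends the system.\<close>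

lemma dual_sys_exists:
  assumes W: "funs.subspace W" "fin_gen W"
  shows "\<exists>p g. dual_sys E W (fdim E W) p g \<and>
    (\<forall>f\<in>W. \<forall>x\<in>E. f x = (\<Sum>i<fdim E W. f (p i) * g i x))"
proof -
  let ?P = "\<lambda>n. \<exists>p g. dual_sys E W n p g"
  have P0: "?P 0" by (simp add: dual_sys_def)
  have bd: "\<And>n. ?P n \<Longrightarrow> n \<le> fdim E W" using dual_sys_le_fdim W(2) by metis
  define n where "n = Greatest ?P"
  have Pn: "?P n" unfolding n_def by (rule GreatestI_nat[of ?P 0 "fdim E W"]) (fact P0, fact bd)
  have max: "\<And>m. ?P m \<Longrightarrow> m \<le> n" unfolding n_def by (rule Greatest_le_nat[of ?P _ "fdim E W"]) (assumption, erule bd)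
  from Pn obtain p g where pg: "dual_sys E W n p g" by blast
  note sub = subspace_fun[OF W(1)]
  have ex: "f x = (\<Sum>i<n. f (p i) * g i x)" if f: "f \<in> W" and x: "x \<in> E" for f x
  proof (rule ccontr)
    assume ne: "f x \<noteq> (\<Sum>i<n. f (p i) * g i x)"
    define h where "h = (\<lambda>y. f y - (\<Sum>i<n. f (p i) * g i y))"
    have hW: "h \<in> W" unfolding h_def using pg by (intro sub f) (auto simp: dual_sys_def)
    have hx: "h x \<noteq> 0" using ne by (simp add: h_def)
    have hp: "h (p j) = 0" if "j < n" for j
    proof -
      have "(\<Sum>i<n. f (p i) * g i (p j)) = (\<Sum>i<n. if i = j then f (p i) else 0)"
        by (rule sum.cong) (use pg that in \<open>auto simp: dual_sys_def\<close>)
      then show ?thesis using that by (simp add: h_def)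
    qed
    define k where "k = (\<lambda>y. (1 / h x) * h y)"
    have kW: "k \<in> W" unfolding k_def by (intro sub hW)
    \<comment> \<open>\<open>k\<close> is 1 at \<open>x\<close> and 0 at the old points; subtracting
      multiples of it makes the old functions vanish at \<open>x\<close> and keeps their values at
      the old points.\<close>
    define g' where "g' = (\<lambda>i. if i = n then k else (\<lambda>y. g i y - g i x * k y))"
    define p' where "p' = p(n := x)"
    have "dual_sys E W (Suc n) p' g'"
      unfolding dual_sys_def
    proof (intro conjI allI impI)
      fix i assume i: "i < Suc n"
      show "p' i \<in> E" using i pg x by (auto simp: p'_def dual_sys_def)
      show "g' i \<in> W"
        using i pg kW by (auto simp: g'_def dual_sys_def less_Suc_eq intro!: sub)
      fix j assume j: "j < Suc n"
      show "g' i (p' j) = (if i = j then 1 else 0)"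
      proof (cases "i = n"; cases "j = n")
        assume "i = n" "j = n"
        then show ?thesis using hx by (simp add: g'_def p'_def k_def)
      next
        assume "i = n" "j \<noteq> n"
        then show ?thesis using hp[of j] j by (simp add: g'_def p'_def k_def)
      next
        assume "i \<noteq> n" "j = n"
        then show ?thesis using hx by (simp add: g'_def p'_def k_def)
      next
        assume "i \<noteq> n" "j \<noteq> n"
        then have "i < n" "j < n" using i j by auto
        then show ?thesis using hp[of j] pg \<open>i \<noteq> n\<close> by (simp add: g'_def p'_def k_def dual_sys_def)
      qed
    qed
    then have "?P (Suc n)" by iprover
    then show False using max[of "Suc n"] by simp
  qed
  have "fdim E W \<le> card (g ` {..<n})"
  proof (rule fdim_le)
    fix f assume "f \<in> W"
    then show "\<exists>h\<in>funs.span (g ` {..<n}). \<forall>x\<in>E. f x = h x"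
      by (intro bexI[of _ "\<lambda>x. \<Sum>i<n. f (p i) * g i x"] span_sum_fun[OF funs.span_base])
         (simp_all add: ex)
  qed simp
  also have "\<dots> \<le> n" using card_image_le[of "{..<n}" g] by simp
  finally have "n = fdim E W" using bd[OF Pn] by simp
  with pg ex show ?thesis by blast
qed

lemma fdim_mono_set:
  assumes "funs.subspace W" "fin_gen W" "E \<subseteq> E'"
  shows "fdim E W \<le> fdim E' W"
proof -
  from dual_sys_exists[OF assms(1,2), of E] obtain p g where "dual_sys E W (fdim E W) p g" by blast
  then have "dual_sys E' W (fdim E W) p g" using assms(3) unfolding dual_sys_def by auto
  then show ?thesis using dual_sys_le_fdim assms(2) by metis
qed

section \<open>Homogeneous and polynomial functions\<close>

text \<open>Forms of degree \<open>t\<close> in the elements of \<open>U\<close>, taken as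
  functions. One notion serves for forms on projective space (\<open>U\<close> the coordinates),
  binary forms (\<open>U\<close> the two projections) and the Veronese subring (\<open>U\<close>
  itself a space of forms).\<close>

primrec homfun :: "('a \<Rightarrow> 'k::field) set \<Rightarrow> nat \<Rightarrow> ('a \<Rightarrow> 'k) set" where
  "homfun U 0 = funs.span {\<lambda>x. 1}"
| "homfun U (Suc t) = funs.span {\<lambda>x. u x * g x | u g. u \<in> U \<and> g \<in> homfun U t}"

lemma homfun_subspace [simp]: "funs.subspace (homfun U t)"
  by (cases t) auto

lemmas homfun_closed = subspace_fun[OF homfun_subspace]

lemma homfun_const: "(\<lambda>x. c) \<in> homfun U 0"
  using funs.span_scale[OF funs.span_base, of "\<lambda>x. 1" "{\<lambda>x. 1}" c] by simp

lemma homfun_0E: "f \<in> homfun U 0 \<Longrightarrow> \<exists>c. f = (\<lambda>x. c)"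
  by (auto simp: funs.span_singleton)

lemma homfun_SucI: "u \<in> U \<Longrightarrow> g \<in> homfun U t \<Longrightarrow> (\<lambda>x. u x * g x) \<in> homfun U (Suc t)"
  by (auto intro!: funs.span_base)

lemma homfun_Suc_induct [consumes 1, case_names zero add base]:
  assumes "f \<in> homfun U (Suc t)" "P (\<lambda>x. 0)"
    and "\<And>f g. P f \<Longrightarrow> P g \<Longrightarrow> P (\<lambda>x. f x + g x)"
    and "\<And>u g. u \<in> U \<Longrightarrow> g \<in> homfun U t \<Longrightarrow> P (\<lambda>x. u x * g x)"
  shows "P f"
proof -
  have "f \<in> funs.span {\<lambda>x. u x * g x | u g. u \<in> U \<and> g \<in> homfun U t}" using assms(1) by simp
  then show ?thesis
  proof (induction rule: span_fun_induct)
    case (base c b)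
    then obtain u g where ug: "b = (\<lambda>x. u x * g x)" "u \<in> U" "g \<in> homfun U t" by blast
    have "(\<lambda>x. c * g x) \<in> homfun U t" by (rule homfun_closed(3)[OF ug(3)])
    from assms(4)[OF ug(2) this] show ?case by (simp add: ug(1) mult.left_commute)
  qed (use assms(2,3) in auto)
qed

lemma homfun_base: "u \<in> U \<Longrightarrow> u \<in> homfun U 1"
  using homfun_SucI[OF _ homfun_const[of 1], of u U] by simp

text \<open>Substitution principle: linear expressions for the generators carry over to every
  degree. Two maps out of a common parameter set let restriction to a subset, pullback along a
  parametrization and its reversal be treated alike.\<close>

lemma homfun_transfer:
  assumes "f \<in> homfun U t"
    and "\<And>u. u \<in> U \<Longrightarrow> \<exists>v\<in>funs.span V. \<forall>x\<in>E. u (\<phi> x) = v (\<psi> x)"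
  shows "\<exists>g\<in>homfun V t. \<forall>x\<in>E. f (\<phi> x) = g (\<psi> x)"
  using assms(1)
proof (induction t arbitrary: f)
  case 0
  then obtain c where "f = (\<lambda>x. c)" using homfun_0E by blast
  then show ?case using homfun_const[of c V] by auto
next
  case (Suc t)
  from Suc.prems show ?case
  proof (induction rule: homfun_Suc_induct)
    case zero
    show ?case by (rule bexI[of _ "\<lambda>x. 0"]) (auto intro: homfun_closed simp del: homfun.simps)
  next
    case (add f g)
    then obtain f' g' where "f' \<in> homfun V (Suc t)" "g' \<in> homfun V (Suc t)"
      "\<forall>x\<in>E. f (\<phi> x) = f' (\<psi> x)" "\<forall>x\<in>E. g (\<phi> x) = g' (\<psi> x)" by blast
    then show ?case
      by (intro bexI[of _ "\<lambda>x. f' x + g' x"]) (auto intro: homfun_closed simp del: homfun.simps)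
  next
    case (base u g)
    from assms(2)[OF base(1)] obtain v where v: "v \<in> funs.span V" "\<forall>x\<in>E. u (\<phi> x) = v (\<psi> x)" by blast
    from Suc.IH[OF base(2)] obtain g' where g': "g' \<in> homfun V t" "\<forall>x\<in>E. g (\<phi> x) = g' (\<psi> x)" by blast
    have "(\<lambda>x. v x * g' x) \<in> homfun V (Suc t)"
      using v(1)
    proof (induction rule: span_fun_induct)
      case zero
      show ?case using homfun_closed(1) by (simp del: homfun.simps)
    next
      case (add f g)
      then show ?case using homfun_closed(2)[of "\<lambda>x. f x * g' x" V "Suc t" "\<lambda>x. g x * g' x"]
        by (simp add: algebra_simps del: homfun.simps)
    next
      case (base c b)
      then show ?case using homfun_closed(3)[OF homfun_SucI[OF base g'(1)], of c]
        by (simp add: algebra_simps del: homfun.simps)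
    qed
    then show ?case using v(2) g'(2) by (intro bexI[of _ "\<lambda>x. v x * g' x"]) auto
  qed
qed

lemma homfun_span_mono:
  assumes "U \<subseteq> funs.span V" shows "homfun U t \<subseteq> homfun V t"
proof
  fix f assume "f \<in> homfun U t"
  from homfun_transfer[OF this, where V = V and E = UNIV and \<phi> = "\<lambda>x. x" and \<psi> = "\<lambda>x. x"] assms
  obtain g where "g \<in> homfun V t" "\<forall>x. f x = g x" by blast
  then show "f \<in> homfun V t" by (metis ext)
qed

lemma homfun_1: "homfun U 1 = funs.span U"
proof
  show "homfun U 1 \<subseteq> funs.span U"
  proof
    fix f assume "f \<in> homfun U 1"
    then have "f \<in> homfun U (Suc 0)" by simp
    then show "f \<in> funs.span U"
    proof (induction rule: homfun_Suc_induct)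
      case zero
      show ?case by (simp only: mult_zero_right span_zero_fun)
    next
      case (base u g)
      then obtain c where "g = (\<lambda>x. c)" using homfun_0E by blast
      then show ?case using funs.span_scale[OF funs.span_base[OF base(1)], of c] by (simp add: mult.commute)
    qed (rule span_add_fun)
  qed
  show "funs.span U \<subseteq> homfun U 1"
    by (rule funs.span_minimal) (use homfun_base in auto)
qed

lemma homfun_mult:
  assumes "f \<in> homfun U a" "g \<in> homfun U b"
  shows "(\<lambda>x. f x * g x) \<in> homfun U (a + b)"
  using assms(1)
proof (induction a arbitrary: f)
  case 0
  then obtain c where "f = (\<lambda>x. c)" using homfun_0E by blast
  then show ?case using homfun_closed(3)[OF assms(2), of c] by simp
next
  case (Suc a)
  from Suc.prems show ?case
  proof (induction rule: homfun_Suc_induct)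
    case zero
    show ?case using homfun_closed(1) by (simp del: homfun.simps)
  next
    case (add f h)
    then show ?case using homfun_closed(2)[of "\<lambda>x. f x * g x" U "Suc a + b" "\<lambda>x. h x * g x"]
      by (simp add: algebra_simps del: homfun.simps)
  next
    case (base u h)
    from homfun_SucI[OF base(1) Suc.IH[OF base(2)]] show ?case by (simp add: mult.assoc del: homfun.simps)
  qed
qed

lemma homfun_power:
  assumes "f \<in> homfun U a" shows "(\<lambda>x. f x ^ n) \<in> homfun U (a * n)"
proof (induction n)
  case 0
  then show ?case using homfun_const[of 1 U] by simp
next
  case (Suc n)
  from homfun_mult[OF assms Suc] show ?case by simp
qed

lemma homfun_prod:
  assumes "finite A" "\<And>i. i \<in> A \<Longrightarrow> f i \<in> homfun U (a i)"
  shows "(\<lambda>x. \<Prod>i\<in>A. f i x) \<in> homfun U (\<Sum>i\<in>A. a i)"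
  using assms
proof (induction A rule: finite_induct)
  case empty
  then show ?case using homfun_const[of 1 U] by simp
next
  case (insert i A)
  then show ?case using homfun_mult[of "f i" U "a i" "\<lambda>x. \<Prod>i\<in>A. f i x"] by simp
qed

lemma homfun_split:
  assumes "f \<in> homfun U (a + b)"
  shows "f \<in> funs.span {\<lambda>x. g x * h x | g h. g \<in> homfun U a \<and> h \<in> homfun U b}"
  using assms
proof (induction a arbitrary: f)
  case 0
  have "f = (\<lambda>x. (\<lambda>x. 1) x * f x)" by simp
  with 0 show ?case using homfun_const[of 1 U] by (intro funs.span_base) force
next
  case (Suc a)
  let ?S = "\<lambda>a. {\<lambda>x. g x * h x | g h. g \<in> homfun U a \<and> h \<in> homfun U b}"
  from Suc.prems have "f \<in> homfun U (Suc (a + b))" by (simp del: homfun.simps)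
  then show ?case
  proof (induction rule: homfun_Suc_induct)
    case zero
    show ?case by (simp only: mult_zero_right span_zero_fun)
  next
    case (add f g)
    then show ?case by (rule span_add_fun)
  next
    case (base u g)
    show ?case
    proof (rule span_mult_fun[OF Suc.IH[OF base(2)]])
      fix k assume "k \<in> ?S a"
      then obtain g' h' where k: "k = (\<lambda>x. g' x * h' x)" "g' \<in> homfun U a" "h' \<in> homfun U b" by blast
      have "(\<lambda>x. u x * g' x) \<in> homfun U (Suc a)" by (rule homfun_SucI[OF base(1) k(2)])
      then have "(\<lambda>x. (u x * g' x) * h' x) \<in> ?S (Suc a)"
        using k(3) by (intro CollectI exI[of _ "\<lambda>x. u x * g' x"] exI[of _ h']) (simp del: homfun.simps)
      then show "(\<lambda>x. u x * k x) \<in> funs.span (?S (Suc a))"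
        by (intro funs.span_base) (simp only: k(1) mult.assoc)
    qed
  qed
qed

text \<open>This is why the Hilbert function of \<open>X\<close> at \<open>t\<close> is that of its
  preimage in the plane at \<open>d * t\<close>.\<close>

lemma homfun_homfun: "homfun (homfun U d) t = homfun U (d * t)"
proof (induction t)
  case 0
  then show ?case by simp
next
  case (Suc t)
  show ?case
  proof
    show "homfun (homfun U d) (Suc t) \<subseteq> homfun U (d * Suc t)"
    proof
      fix f assume "f \<in> homfun (homfun U d) (Suc t)"
      then show "f \<in> homfun U (d * Suc t)"
      proof (induction rule: homfun_Suc_induct)
        case (base u g)
        then show ?case using homfun_mult[of u U d g "d * t"] Suc by simp
      qed (auto intro: homfun_closed simp del: homfun.simps)
    qed
    show "homfun U (d * Suc t) \<subseteq> homfun (homfun U d) (Suc t)"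
    proof
      fix f assume "f \<in> homfun U (d * Suc t)"
      then have "f \<in> homfun U (d + d * t)" by simp
      from homfun_split[OF this] show "f \<in> homfun (homfun U d) (Suc t)"
        using Suc by simp
    qed
  qed
qed

lemma fin_gen_homfun:
  assumes "finite U" shows "fin_gen (homfun U t)"
proof (induction t)
  case 0
  show ?case by (auto simp: fin_gen_def intro: exI[of _ "{\<lambda>x. 1}"])
next
  case (Suc t)
  then obtain B where B: "finite B" "homfun U t \<subseteq> funs.span B" by (auto simp: fin_gen_def)
  let ?B = "(\<lambda>(u, b) x. u x * b x) ` (U \<times> B)"
  have "f \<in> funs.span ?B" if "f \<in> homfun U (Suc t)" for f
    using that
  proof (induction rule: homfun_Suc_induct)
    case zero
    show ?case by (simp only: mult_zero_right span_zero_fun)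
  next
    case (base u g)
    have "g \<in> funs.span B" using base B by auto
    then show ?case
      by (rule span_mult_fun) (use base in \<open>force intro: funs.span_base\<close>)
  qed (rule span_add_fun)
  moreover have "finite ?B" using assms B by simp
  ultimately show ?case unfolding fin_gen_def by blast
qed

lemma homfun_scale:
  assumes "f \<in> homfun U t" "\<And>u. u \<in> U \<Longrightarrow> u y = c * u x"
  shows "f y = c ^ t * f x"
  using assms(1)
proof (induction t arbitrary: f)
  case 0
  then show ?case using homfun_0E by fastforce
next
  case (Suc t)
  from Suc.prems show ?case
  proof (induction rule: homfun_Suc_induct)
    case (base u g)
    then show ?case using Suc.IH[of g] assms(2)[of u] by simp
  qed (simp_all add: algebra_simps)
qed

text \<open>The exponent of \<open>w\<close> is written as a complement so that the constant
  function 1 in place of \<open>w\<close> gives the monomials of degree at most \<open>t\<close> in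
  two affine coordinates.\<close>

lemma homfun3_monomials:
  assumes "f \<in> homfun {w, u, v} t"
  shows "f \<in> funs.span {\<lambda>x. w x ^ (t - (i + j)) * u x ^ i * v x ^ j | i j. i + j \<le> t}"
  using assms
proof (induction t arbitrary: f)
  case 0
  then show ?case by simp
next
  case (Suc t)
  let ?M = "\<lambda>t. {\<lambda>x. w x ^ (t - (i + j)) * u x ^ i * v x ^ j | i j. i + j \<le> t}"
  from Suc.prems show ?case
  proof (induction rule: homfun_Suc_induct)
    case zero
    show ?case by (simp only: mult_zero_right span_zero_fun)
  next
    case (base a g)
    show ?case
    proof (rule span_mult_fun[OF Suc.IH[OF base(2)]])
      fix k assume k: "k \<in> ?M t"
      then obtain i j where k: "k = (\<lambda>x. w x ^ (t - (i + j)) * u x ^ i * v x ^ j)" "i + j \<le> t" by blast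
      consider "a = w" | "a = u" | "a = v" using base by blast
      then have "(\<lambda>x. a x * k x) \<in> ?M (Suc t)"
      proof cases
        case 1
        then have "(\<lambda>x. a x * k x) = (\<lambda>x. w x ^ (Suc t - (i + j)) * u x ^ i * v x ^ j)"
          using k by (simp add: Suc_diff_le algebra_simps)
        then show ?thesis using k(2) by (intro CollectI exI[of _ i] exI[of _ j]) auto
      next
        case 2
        then have "(\<lambda>x. a x * k x) = (\<lambda>x. w x ^ (Suc t - (Suc i + j)) * u x ^ Suc i * v x ^ j)"
          using k by (simp add: algebra_simps)
        then show ?thesis using k(2) by (intro CollectI exI[of _ "Suc i"] exI[of _ j]) auto
      next
        case 3
        then have "(\<lambda>x. a x * k x) = (\<lambda>x. w x ^ (Suc t - (i + Suc j)) * u x ^ i * v x ^ Suc j)"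
          using k by (simp add: algebra_simps)
        then show ?thesis using k(2) by (intro CollectI exI[of _ i] exI[of _ "Suc j"]) auto
      qed
      then show "(\<lambda>x. a x * k x) \<in> funs.span (?M (Suc t))" by (rule funs.span_base)
    qed
  qed (rule span_add_fun)
qed

lemma homfun2_monomials:
  assumes "f \<in> homfun {u, v} t"
  shows "f \<in> funs.span ((\<lambda>i x. u x ^ i * v x ^ (t - i)) ` {..t})"
  using assms
proof (induction t arbitrary: f)
  case 0
  then show ?case by simp
next
  case (Suc t)
  let ?M = "\<lambda>t. (\<lambda>i x. u x ^ i * v x ^ (t - i)) ` {..t}"
  from Suc.prems show ?case
  proof (induction rule: homfun_Suc_induct)
    case zero
    show ?case by (simp only: mult_zero_right span_zero_fun)
  next
    case (base a g)
    show ?case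
    proof (rule span_mult_fun[OF Suc.IH[OF base(2)]])
      fix k assume k: "k \<in> ?M t"
      then obtain i where k: "k = (\<lambda>x. u x ^ i * v x ^ (t - i))" "i \<le> t" by blast
      consider "a = u" | "a = v" using base by blast
      then have "(\<lambda>x. a x * k x) \<in> ?M (Suc t)"
      proof cases
        case 1
        then have "(\<lambda>x. a x * k x) = (\<lambda>x. u x ^ Suc i * v x ^ (Suc t - Suc i))"
          using k by (simp add: algebra_simps)
        then show ?thesis using k(2) by (intro image_eqI[of _ _ "Suc i"]) auto
      next
        case 2
        then have "(\<lambda>x. a x * k x) = (\<lambda>x. u x ^ i * v x ^ (Suc t - i))"
          using k by (simp add: Suc_diff_le algebra_simps)
        then show ?thesis using k(2) by (intro image_eqI[of _ _ i]) auto
      qed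
      then show "(\<lambda>x. a x * k x) \<in> funs.span (?M (Suc t))" by (rule funs.span_base)
    qed
  qed (rule span_add_fun)
qed

section \<open>Polynomial functions that need not be homogeneous\<close>

inductive_set polyfun :: "('a \<Rightarrow> 'k::field) set \<Rightarrow> ('a \<Rightarrow> 'k) set" for U where
  const: "(\<lambda>x. c) \<in> polyfun U"
| base: "u \<in> U \<Longrightarrow> u \<in> polyfun U"
| add: "f \<in> polyfun U \<Longrightarrow> g \<in> polyfun U \<Longrightarrow> (\<lambda>x. f x + g x) \<in> polyfun U"
| mult: "f \<in> polyfun U \<Longrightarrow> g \<in> polyfun U \<Longrightarrow> (\<lambda>x. f x * g x) \<in> polyfun U"

lemma polyfun_sum:
  "(\<And>i. i \<in> I \<Longrightarrow> f i \<in> polyfun U) \<Longrightarrow> (\<lambda>x. \<Sum>i\<in>I. f i x) \<in> polyfun U"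
  by (induction I rule: infinite_finite_induct) (auto intro: polyfun.intros)

lemma polyfun_comp:
  assumes "f \<in> polyfun U" "\<And>u. u \<in> U \<Longrightarrow> (\<lambda>x. u (\<phi> x)) \<in> polyfun V"
  shows "(\<lambda>x. f (\<phi> x)) \<in> polyfun V"
  using assms(1) by induction (auto intro: polyfun.intros assms(2))

lemma homfun_polyfun: "homfun U t \<subseteq> polyfun U"
proof (induction t)
  case 0
  show ?case using homfun_0E by (blast intro: polyfun.const)
next
  case (Suc t)
  show ?case
  proof
    fix f assume "f \<in> homfun U (Suc t)"
    then show "f \<in> polyfun U"
      by (induction rule: homfun_Suc_induct) (use Suc in \<open>auto intro: polyfun.intros simp del: homfun.simps\<close>)
  qed
qed

text \<open>Restriction to a polynomially parametrized curve reduces vanishing and comparison of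
  coefficients to one variable.\<close>

lemma polyfun_poly:
  assumes "f \<in> polyfun U" "\<And>u. u \<in> U \<Longrightarrow> \<exists>p. \<forall>c. u (\<phi> c) = poly p c"
  shows "\<exists>p. \<forall>c. f (\<phi> c) = poly p c"
  using assms(1)
proof induction
  case (const c)
  show ?case by (intro exI[of _ "[:c:]"]) simp
next
  case (add f g)
  then obtain p q where "\<forall>c. f (\<phi> c) = poly p c" "\<forall>c. g (\<phi> c) = poly q c" by blast
  then show ?case by (intro exI[of _ "p + q"]) simp
next
  case (mult f g)
  then obtain p q where "\<forall>c. f (\<phi> c) = poly p c" "\<forall>c. g (\<phi> c) = poly q c" by blast
  then show ?case by (intro exI[of _ "p * q"]) simp
qed (use assms(2) in blast)

section \<open>Binary forms\<close>

abbreviation binary_forms :: "nat \<Rightarrow> ('k::field \<times> 'k \<Rightarrow> 'k) set" where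
  "binary_forms \<equiv> homfun {fst, snd}"

text \<open>The determinant of \<open>z\<close> and the argument. For nonzero pairs it vanishes
  exactly when they are proportional, so it is both the linear factor belonging to the zero
  \<open>z\<close> and a test for equality of points of the projective line.\<close>

definition lin_at :: "'k::field \<times> 'k \<Rightarrow> 'k \<times> 'k \<Rightarrow> 'k" where
  "lin_at z = (\<lambda>x. snd z * fst x - fst z * snd x)"

lemma homfun2_reduce:
  assumes "f \<in> homfun {u, v} (Suc t)"
  shows "\<exists>c. \<exists>g\<in>homfun {u, v} t. f = (\<lambda>x. c * v x ^ Suc t + u x * g x)"
  using homfun2_monomials[OF assms]
proof (induction rule: span_fun_induct)
  case zero
  show ?case by (intro exI[of _ 0] bexI[of _ "\<lambda>x. 0"]) (auto intro: homfun_closed)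
next
  case (add f g)
  then obtain c f' e g' where "f = (\<lambda>x. c * v x ^ Suc t + u x * f' x)" "f' \<in> homfun {u, v} t"
    "g = (\<lambda>x. e * v x ^ Suc t + u x * g' x)" "g' \<in> homfun {u, v} t" by blast
  then show ?case
    by (intro exI[of _ "c + e"] bexI[of _ "\<lambda>x. f' x + g' x"]) (auto intro: homfun_closed simp: algebra_simps)
next
  case (base c b)
  then obtain i where i: "i \<le> Suc t" "b = (\<lambda>x. u x ^ i * v x ^ (Suc t - i))" by auto
  show ?case
  proof (cases i)
    case 0
    then show ?thesis
      using i by (intro exI[of _ c] bexI[of _ "\<lambda>x. 0"]) (auto intro: homfun_closed)
  next
    case (Suc k)
    have "(\<lambda>x. u x ^ k * v x ^ (t - k)) \<in> homfun {u, v} (1 * k + 1 * (t - k))"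
      by (intro homfun_mult homfun_power homfun_base insertI1 insertI2)
    then have "(\<lambda>x. c * (u x ^ k * v x ^ (t - k))) \<in> homfun {u, v} t"
      using i(1) Suc by (intro homfun_closed(3)) simp
    then show ?thesis
      using i Suc by (intro exI[of _ 0] bexI[of _ "\<lambda>x. c * (u x ^ k * v x ^ (t - k))"]) (auto simp: algebra_simps)
  qed
qed

lemma binary_factor:
  fixes f :: "'k::field \<times> 'k \<Rightarrow> 'k"
  assumes f: "f \<in> binary_forms (Suc t)" and z: "z \<noteq> (0, 0)" "f z = 0"
  shows "\<exists>g\<in>binary_forms t. f = (\<lambda>x. lin_at z x * g x)"
proof -
  obtain a b where ab: "z = (a, b)" by (cases z)
  \<comment> \<open>A coordinate that does not vanish at \<open>z\<close> completes
    \<open>lin_at z\<close> to a basis of the linear forms. In this basis the pure power of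
    \<open>m\<close> is the only obstruction to divisibility by \<open>lin_at z\<close>, and
    evaluation at \<open>z\<close> removes it.\<close>
  obtain m where m: "m \<in> funs.span {fst, snd}" "m z \<noteq> 0" "{fst, snd} \<subseteq> funs.span {lin_at z, m}"
  proof (cases "a = 0")
    case False
    have m: "(\<lambda>x. p * lin_at z x + q * fst x) \<in> funs.span {lin_at z, fst}" for p q
      by (intro span_add_fun funs.span_scale funs.span_base) auto
    have "(\<lambda>x. (- inverse a) * lin_at z x + (b * inverse a) * fst x) = snd"
      using False by (auto simp: fun_eq_iff lin_at_def ab field_simps)
    with m[of "- inverse a" "b * inverse a"] have "snd \<in> funs.span {lin_at z, fst}" by simp
    then show ?thesis using False ab by (intro that[of fst]) (auto intro: funs.span_base)
  next
    case True
    then have b: "b \<noteq> 0" using z ab by auto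
    have m: "(\<lambda>x. p * lin_at z x + q * snd x) \<in> funs.span {lin_at z, snd}" for p q
      by (intro span_add_fun funs.span_scale funs.span_base) auto
    have "(\<lambda>x. inverse b * lin_at z x + (a * inverse b) * snd x) = fst"
      using b by (auto simp: fun_eq_iff lin_at_def ab field_simps)
    with m[of "inverse b" "a * inverse b"] have "fst \<in> funs.span {lin_at z, snd}" by simp
    then show ?thesis using b ab by (intro that[of snd]) (auto intro: funs.span_base)
  qed
  have "lin_at z = (\<lambda>x. snd z * fst x + (- fst z) * snd x)" by (simp add: lin_at_def fun_eq_iff)
  moreover have "(\<lambda>x. snd z * fst x + (- fst z) * snd x) \<in> funs.span {fst, snd}"
    by (intro span_add_fun funs.span_scale funs.span_base) auto
  ultimately have lz: "lin_at z \<in> funs.span {fst, snd}" by simp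
  have "f \<in> homfun {lin_at z, m} (Suc t)" using homfun_span_mono[OF m(3)] f by blast
  from homfun2_reduce[OF this] obtain c g where g: "g \<in> homfun {lin_at z, m} t"
    "f = (\<lambda>x. c * m x ^ Suc t + lin_at z x * g x)" by blast
  have "lin_at z z = 0" by (simp add: lin_at_def)
  then have "c = 0" using z(2) m(2) by (simp add: g(2))
  moreover have "g \<in> binary_forms t"
    using homfun_span_mono[of "{lin_at z, m}" "{fst, snd}" t] lz m(1) g(1) by blast
  ultimately show ?thesis using g(2) by (intro bexI[of _ g]) auto
qed

text \<open>Each zero splits off a linear factor that is nonzero at the remaining zeros, so degree
  and number of zeros drop together.\<close>

lemma binary_vanish:
  fixes f :: "'k::field \<times> 'k \<Rightarrow> 'k"
  assumes "f \<in> binary_forms t" "finite Z" "t < card Z" "\<And>z. z \<in> Z \<Longrightarrow> f z = 0"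
    "(0, 0) \<notin> Z" "\<And>z w. z \<in> Z \<Longrightarrow> w \<in> Z \<Longrightarrow> z \<noteq> w \<Longrightarrow> lin_at z w \<noteq> 0"
  shows "f x = 0"
  using assms
proof (induction t arbitrary: f Z x)
  case 0
  from 0(3) have "Z \<noteq> {}" by auto
  then obtain z where "z \<in> Z" by blast
  then show ?case using 0(4) homfun_0E[OF 0(1)] by metis
next
  case (Suc t)
  from Suc(4) have "Z \<noteq> {}" by auto
  then obtain z where z: "z \<in> Z" by blast
  then have z0: "z \<noteq> (0, 0)" using Suc by auto
  from binary_factor[OF Suc(2) z0 Suc(5)[OF z]]
  obtain g where g: "g \<in> binary_forms t" "f = (\<lambda>x. lin_at z x * g x)" by blast
  have "g x = 0" for x
  proof (rule Suc.IH[OF g(1), of "Z - {z}"])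
    show "t < card (Z - {z})" using Suc z by simp
    fix w assume "w \<in> Z - {z}"
    then show "g w = 0" using Suc.prems(4)[of w] Suc.prems(6)[of z w] z g(2) by auto
  qed (use Suc in auto)
  then show ?case using g by simp
qed

section \<open>Hilbert functions of sets of points in the plane\<close>

lemma dim_insert_finite:
  fixes S :: "('a \<Rightarrow> 'k::field) set"
  assumes "finite S"
  shows "funs.dim (insert x S) = (if x \<in> funs.span S then funs.dim S else Suc (funs.dim S))"
proof (cases "x \<in> funs.span S")
  case True
  then have "funs.span (insert x S) = funs.span S" by (rule funs.span_redundant)
  then show ?thesis using True funs.span_eq_dim by metis
next
  case False
  obtain B where B: "B \<subseteq> S" "funs.independent B" "S \<subseteq> funs.span B" "card B = funs.dim S"
    by (rule funs.basis_exists[of S])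
  have sp: "funs.span B = funs.span S" using B(1,3) by (simp add: funs.span_eq funs.span_mono subset_trans[OF _ funs.span_superset])
  have "x \<notin> funs.span B" using False sp by simp
  then have ind: "funs.independent (insert x B)" using B(2) by (rule funs.independent_insertI)
  have "x \<notin> B" using \<open>x \<notin> funs.span B\<close> funs.span_base by blast
  have "funs.span (insert x B) = funs.span (insert x S)"
    using sp by (auto simp: funs.span_insert)
  then have "funs.dim (insert x S) = funs.dim (insert x B)" using funs.span_eq_dim by metis
  also have "\<dots> = card (insert x B)" using ind by (rule funs.dim_eq_card_independent)
  also have "\<dots> = Suc (funs.dim S)" using \<open>x \<notin> B\<close> B(1,4) assms finite_subset by fastforce
  finally show ?thesis using False by simp
qed

text \<open>When the sequence lists monomials in increasing order, the members counted here are the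
  standard monomials in the sense of Groebner bases.\<close>

lemma dim_filtration:
  fixes S :: "('a \<Rightarrow> 'k::field) set" and n :: nat
  assumes "finite S"
  shows "funs.dim (S \<union> A ` {..<n}) = funs.dim S + card {k. k < n \<and> A k \<notin> funs.span (S \<union> A ` {..<k})}"
proof (induction n)
  case 0
  then show ?case by simp
next
  case (Suc n)
  have e: "S \<union> A ` {..<Suc n} = insert (A n) (S \<union> A ` {..<n})" by (auto simp: lessThan_Suc)
  have c: "{k. k < Suc n \<and> A k \<notin> funs.span (S \<union> A ` {..<k})} =
     (if A n \<in> funs.span (S \<union> A ` {..<n}) then {} else {n}) \<union> {k. k < n \<and> A k \<notin> funs.span (S \<union> A ` {..<k})}"
    by (auto simp: less_Suc_eq)
  show ?case unfolding e c using Suc assms by (subst dim_insert_finite) auto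
qed

text \<open>\<open>B\<close> and \<open>C\<close> stand for the exponents of the standard monomials
  of degrees \<open>s\<close> and \<open>s + 1\<close>, and \<open>up\<close> says that both
  products of a non-standard monomial with a variable are non-standard. A gap \<open>m\<close> of
  \<open>B\<close> gives the neighbouring gaps \<open>m\<close> and \<open>m + 1\<close> of
  \<open>C\<close>; closing up one of them injects \<open>C\<close> into \<open>B\<close>.\<close>

lemma card_shift_le:
  fixes B C :: "nat set"
  assumes B: "B \<subseteq> {..s}" "card B \<le> s" and C: "C \<subseteq> {..Suc s}"
    and up: "\<And>i. i \<le> s \<Longrightarrow> i \<notin> B \<Longrightarrow> i \<notin> C \<and> Suc i \<notin> C"
  shows "card C \<le> card B"
proof -
  have "B \<noteq> {..s}" using B(2) by auto
  then obtain m where m: "m \<le> s" "m \<notin> B" using B(1) by auto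
  define \<phi> where "\<phi> = (\<lambda>i. if i \<le> m then i else i - 1)"
  have ne: "i \<noteq> m" "i \<noteq> Suc m" if "i \<in> C" for i using up[OF m] that by auto
  have "\<phi> i \<in> B" if i: "i \<in> C" for i
  proof (cases "i \<le> m")
    case True
    then show ?thesis using up[of i] i m by (auto simp: \<phi>_def)
  next
    case False
    then have "i - 1 \<le> s" "Suc (i - 1) = i" using C i by auto
    then show ?thesis using up[of "i - 1"] i False by (auto simp: \<phi>_def)
  qed
  then have "\<phi> ` C \<subseteq> B" by auto
  moreover have "inj_on \<phi> C"
  proof (rule inj_onI)
    fix i j assume ij: "i \<in> C" "j \<in> C" "\<phi> i = \<phi> j"
    then show "i = j" using ne[OF ij(1)] ne[OF ij(2)] by (auto simp: \<phi>_def split: if_splits)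
  qed
  ultimately show ?thesis using card_inj_on_le finite_subset[OF B(1)] by blast
qed

definition coords :: "nat \<Rightarrow> ((nat \<Rightarrow> 'k::field) \<Rightarrow> 'k) set" where
  "coords N = (\<lambda>j x. x j) ` {..N}"

lemma finite_coords [simp]: "finite (coords N)"
  by (simp add: coords_def)

lemma coordsI: "j \<le> N \<Longrightarrow> (\<lambda>x. x j) \<in> coords N"
  by (auto simp: coords_def)

lemma coords_2: "coords 2 = {\<lambda>x. x 0, \<lambda>x. x 1, \<lambda>x. x 2}"
proof -
  have "{..2::nat} = {0,1,2}" by auto
  then show ?thesis by (simp add: coords_def)
qed

lemma coords_scale:
  assumes "f \<in> homfun (coords N) t" shows "f (\<lambda>i. c * x i) = c ^ t * f x"
  using assms by (rule homfun_scale) (auto simp: coords_def)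

text \<open>On the affine chart where a linear form equals 1, forms of degree \<open>t\<close>
  become polynomials of degree at most \<open>t\<close> in \<open>x 1\<close> and
  \<open>x 2\<close>. The witness \<open>h\<close> counts standard monomials of exact degree
  \<open>s\<close>, which makes it the first difference of the Hilbert function.\<close>

lemma affine_hilbert:
  fixes Y :: "(nat \<Rightarrow> 'k::field) set"
  assumes l: "\<And>y. y \<in> Y \<Longrightarrow> y 0 + a * y 1 + b * y 2 = 1"
  shows "\<exists>h. (\<forall>t. fdim Y (homfun (coords 2) t) = (\<Sum>s\<le>t. h s)) \<and>
    (\<forall>s. h s \<le> Suc s) \<and> (\<forall>s. h s \<le> s \<longrightarrow> h (Suc s) \<le> h s)"
proof -
  define M where "M = (\<lambda>i j. rs Y (\<lambda>x. x 1 ^ i * x 2 ^ j))"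
  define S where "S = (\<lambda>s. {M i j | i j. i + j < s})"
  define A where "A = (\<lambda>s i. M i (s - i))"
  \<comment> \<open>\<open>S s\<close> consists of the monomials of degree less than \<open>s\<close> restricted to \<open>Y\<close>, and \<open>B s\<close> indexes the
    standard monomials of degree \<open>s\<close>; non-standard monomials form an ideal.\<close>
  define B where "B = (\<lambda>s. {i. i < Suc s \<and> A s i \<notin> funs.span (S s \<union> A s ` {..<i})})"
  have S_Suc: "S (Suc s) = S s \<union> A s ` {..<Suc s}" for s
  proof
    show "S (Suc s) \<subseteq> S s \<union> A s ` {..<Suc s}"
    proof
      fix g assume "g \<in> S (Suc s)"
      then obtain i j where ij: "g = M i j" "i + j < Suc s" by (auto simp: S_def)
      show "g \<in> S s \<union> A s ` {..<Suc s}"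
      proof (cases "i + j < s")
        case True
        then show ?thesis using ij by (auto simp: S_def)
      next
        case False
        then have "s = i + j" using ij by simp
        then have "g = A s i" by (simp add: A_def ij)
        then show ?thesis using ij by auto
      qed
    qed
    show "S s \<union> A s ` {..<Suc s} \<subseteq> S (Suc s)"
      unfolding S_def A_def by fastforce
  qed
  have finS: "finite (S s)" for s
    by (induction s) (auto simp: S_Suc, simp add: S_def)
  have dimS: "funs.dim (S (Suc t)) = (\<Sum>s\<le>t. card (B s))" for t
  proof (induction t)
    case 0
    have "funs.dim (S (Suc 0)) = funs.dim (S 0) + card (B 0)"
      unfolding S_Suc[of 0] B_def by (rule dim_filtration[OF finS])
    then show ?case using funs.dim_eq_card_independent[OF funs.independent_empty] by (simp add: S_def)
  next
    case (Suc t)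
    have "funs.dim (S (Suc (Suc t))) = funs.dim (S (Suc t)) + card (B (Suc t))"
      unfolding S_Suc[of "Suc t"] B_def by (rule dim_filtration[OF finS])
    then show ?case using Suc by simp
  qed
  have sp: "funs.span (rs Y ` homfun (coords 2) t) = funs.span (S (Suc t))" for t
  proof -
    have "rs Y ` homfun (coords 2) t \<subseteq> funs.span (S (Suc t))"
    proof
      fix g assume "g \<in> rs Y ` homfun (coords 2) t"
      then obtain f where f: "f \<in> homfun (coords 2) t" "g = rs Y f" by blast
      have tr: "\<exists>v\<in>funs.span {\<lambda>x. 1, \<lambda>x. x 1, \<lambda>x. x 2}. \<forall>x\<in>Y. u x = v x" if u: "u \<in> coords 2" for u
      proof -
        have b: "(\<lambda>x. 1 + ((- a) * x 1 + (- b) * x 2)) \<in> funs.span {\<lambda>x. 1, \<lambda>x::nat\<Rightarrow>'k. x 1, \<lambda>x. x 2}"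
          by (intro span_add_fun funs.span_scale funs.span_base) auto
        consider "u = (\<lambda>x. x 0)" | "u = (\<lambda>x. x 1)" | "u = (\<lambda>x. x 2)" using u by (auto simp: coords_2)
        then show ?thesis
        proof cases
          case 1
          have "x 0 = 1 + ((- a) * x 1 + (- b) * x 2)" if "x \<in> Y" for x
            using l[OF that] by (simp add: algebra_simps)
          then show ?thesis using 1 by (intro bexI[OF _ b]) auto
        next
          case 2
          then show ?thesis by (intro bexI[of _ u]) (auto intro: funs.span_base)
        next
          case 3
          then show ?thesis by (intro bexI[of _ u]) (auto intro: funs.span_base)
        qed
      qed
      from homfun_transfer[OF f(1), of "{\<lambda>x. 1, \<lambda>x. x 1, \<lambda>x. x 2}" Y "\<lambda>x. x" "\<lambda>x. x"] tr
      obtain k where k: "k \<in> homfun {\<lambda>x. 1, \<lambda>x. x 1, \<lambda>x. x 2} t" "\<forall>x\<in>Y. f x = k x" by blast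
      have "g = rs Y k" using k(2) f(2) by (auto simp: rs_def)
      moreover have "rs Y k \<in> funs.span (S (Suc t))"
      proof -
        have "rs Y k \<in> funs.span (rs Y ` {\<lambda>x. 1 ^ (t - (i + j)) * x 1 ^ i * x 2 ^ j | i j. i + j \<le> t})"
          using homfun3_monomials[OF k(1)] rs_span[of Y] by blast
        moreover have "rs Y ` {\<lambda>x. 1 ^ (t - (i + j)) * x 1 ^ i * x 2 ^ j | i j. i + j \<le> t} = S (Suc t)"
          by (auto simp: S_def M_def less_Suc_eq_le)
        ultimately show ?thesis by metis
      qed
      ultimately show "g \<in> funs.span (S (Suc t))" by simp
    qed
    moreover have "S (Suc t) \<subseteq> rs Y ` homfun (coords 2) t"
    proof
      fix g assume "g \<in> S (Suc t)"
      then obtain i j where ij: "g = M i j" "i + j \<le> t" by (auto simp: S_def)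
      \<comment> \<open>Being 1 on \<open>Y\<close>, this form homogenizes monomials of lower degree
        without changing their values there.\<close>
      let ?l = "\<lambda>x::nat\<Rightarrow>'k. 1 * x 0 + (a * x 1 + b * x 2)"
      have "?l \<in> funs.span (coords 2)"
        by (intro span_add_fun funs.span_scale funs.span_base coordsI) auto
      then have "?l \<in> homfun (coords 2) 1" using homfun_1 by blast
      from homfun_power[OF this, of "t - (i + j)"]
      have 1: "(\<lambda>x. ?l x ^ (t - (i + j))) \<in> homfun (coords 2) (t - (i + j))" by (simp only: mult_1)
      have 2: "(\<lambda>x. x 1 ^ i) \<in> homfun (coords 2) i"
        using homfun_power[OF homfun_base[OF coordsI[of 1 2]], of i] by (simp only: mult_1) simp
      have 3: "(\<lambda>x. x 2 ^ j) \<in> homfun (coords 2) j"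
        using homfun_power[OF homfun_base[OF coordsI[of 2 2]], of j] by (simp only: mult_1) simp
      have "(\<lambda>x. ?l x ^ (t - (i + j)) * (x 1 ^ i * x 2 ^ j)) \<in> homfun (coords 2) (t - (i + j) + (i + j))"
        by (rule homfun_mult[OF 1 homfun_mult[OF 2 3]])
      moreover have "g = rs Y (\<lambda>x. ?l x ^ (t - (i + j)) * (x 1 ^ i * x 2 ^ j))"
        using l by (auto simp: ij M_def rs_def fun_eq_iff add.assoc)
      ultimately show "g \<in> rs Y ` homfun (coords 2) t" using ij(2) by simp
    qed
    ultimately show ?thesis unfolding funs.span_eq using funs.span_superset by blast
  qed
  have "fdim Y (homfun (coords 2) t) = (\<Sum>s\<le>t. card (B s))" for t
    unfolding fdim_def funs.span_eq_dim[OF sp] dimS ..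
  moreover have "card (B s) \<le> Suc s" for s
    using card_mono[of "{..<Suc s}" "B s"] by (auto simp: B_def)
  moreover have "card (B (Suc s)) \<le> card (B s)" if "card (B s) \<le> s" for s
  proof (rule card_shift_le[OF _ that])
    fix i assume i: "i \<le> s" "i \<notin> B s"
    then have mem: "A s i \<in> funs.span (S s \<union> A s ` {..<i})" by (auto simp: B_def)
    \<comment> \<open>\<open>w\<close> is one of the two variables and adds \<open>e\<close> and
      \<open>e'\<close> to the exponents. Multiplication by it preserves the order of the monomials,
      so a combination of smaller monomials stays one.\<close>
    have shift: "A (Suc s) (i + e) \<in> funs.span (S (Suc s) \<union> A (Suc s) ` {..<i + e})"
      if w: "\<And>p q. (\<lambda>x. w x * M p q x) = M (p + e) (q + e')" and e: "e + e' = 1" for w e e'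
    proof -
      have A: "(\<lambda>x. w x * A s k x) = A (Suc s) (k + e)" if "k \<le> s" for k
      proof -
        have "s - k + e' = Suc s - (k + e)" using that e by linarith
        then show ?thesis using w by (simp add: A_def)
      qed
      have "(\<lambda>x. w x * A s i x) \<in> funs.span (S (Suc s) \<union> A (Suc s) ` {..<i + e})"
      proof (rule span_mult_fun[OF mem])
        fix f assume "f \<in> S s \<union> A s ` {..<i}"
        then have "(\<lambda>x. w x * f x) \<in> S (Suc s) \<union> A (Suc s) ` {..<i + e}"
        proof
          assume "f \<in> S s"
          then obtain p q where "f = M p q" "p + q < s" by (auto simp: S_def)
          then have "(\<lambda>x. w x * f x) = M (p + e) (q + e')" "(p + e) + (q + e') < Suc s" using w e by auto
          then show ?thesis unfolding S_def by blast
        next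
          assume "f \<in> A s ` {..<i}"
          then show ?thesis using A i(1) by auto
        qed
        then show "(\<lambda>x. w x * f x) \<in> funs.span (S (Suc s) \<union> A (Suc s) ` {..<i + e})"
          by (rule funs.span_base)
      qed
      then show ?thesis using A[OF i(1)] by simp
    qed
    have "A (Suc s) (i + 1) \<in> funs.span (S (Suc s) \<union> A (Suc s) ` {..<i + 1})"
      by (rule shift[of "\<lambda>x. x 1" 1 0]) (auto simp: M_def rs_def fun_eq_iff algebra_simps)
    moreover have "A (Suc s) (i + 0) \<in> funs.span (S (Suc s) \<union> A (Suc s) ` {..<i + 0})"
      by (rule shift[of "\<lambda>x. x 2" 0 1]) (auto simp: M_def rs_def fun_eq_iff algebra_simps)
    ultimately show "i \<notin> B (Suc s) \<and> Suc i \<notin> B (Suc s)" by (simp add: B_def)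
  qed (auto simp: B_def)
  ultimately show ?thesis by (intro exI[of _ "\<lambda>s. card (B s)"]) blast
qed

text \<open>Once \<open>h s <= s\<close>, the values never increase again, so
  \<open>h d <= d\<close> bounds \<open>H - b\<close> by \<open>d * h d\<close>. Small values of
  \<open>h d\<close> survive, larger ones make \<open>b\<close> so big that \<open>b * b\<close>
  exceeds what \<open>H\<close> allows; the maximal value \<open>d + 1\<close> is refuted by the
  trivial bound on \<open>H\<close>.\<close>

lemma hilbert_numeric:
  fixes h :: "nat \<Rightarrow> nat"
  assumes h1: "\<And>s. h s \<le> Suc s" and h2: "\<And>s. h s \<le> s \<Longrightarrow> h (Suc s) \<le> h s"
    and d: "d \<ge> 2" and b: "b = (\<Sum>s\<le>d. h s)" and H: "H = (\<Sum>s\<le>2*d. h s)"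
    and ineq: "b * b + 2 \<le> 2 * H + b"
  shows "(b \<le> 2 \<and> H \<le> b) \<or> (d \<le> 3 \<and> b = d + 1 \<and> H \<le> 2 * d + 1 \<and> h 0 + h 1 = 2)"
proof -
  have mono: "h t \<le> h s" if "h s \<le> s" "s \<le> t" for s t
    using that(2)
  proof (induction t rule: dec_induct)
    case (step n)
    then show ?case using h2[of n] that(1) by linarith
  qed simp
  have Hs: "H = b + (\<Sum>s\<in>{d<..2*d}. h s)"
  proof -
    have "{..2*d} = {..d} \<union> {d<..2*d}" using d by auto
    then show ?thesis unfolding H b by (simp add: sum.union_disjoint[symmetric] ivl_disj_int)
  qed
  have gauss: "2 * (\<Sum>s\<le>t. Suc s) = (t + 1) * (t + 2)" for t by (induction t) auto
  consider "h d = Suc d" | "h d = 0" | "h d = 1" | "h d \<ge> 2" "h d \<le> d" using h1[of d] by linarith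
  then show ?thesis
  proof cases
    case 1
    have "h s = Suc s" if "s \<le> d" for s
    proof (rule ccontr)
      assume "h s \<noteq> Suc s"
      then have "h s \<le> s" using h1[of s] by simp
      from mono[OF this that] show False using 1 \<open>h s \<le> s\<close> that by simp
    qed
    then have "2 * b = (d + 1) * (d + 2)" unfolding b gauss[symmetric] by simp
    moreover have "2 * H \<le> (2 * d + 1) * (2 * d + 2)" unfolding H gauss[symmetric]
      by (intro mult_left_mono sum_mono) (auto simp: h1)
    \<comment> \<open>Writing \<open>d = k + 2\<close> gives an inequality of polynomials in
      \<open>k\<close> with natural coefficients, and it fails coefficient by coefficient.\<close>
    moreover obtain k where k: "d = k + 2" using d by (metis le_add_diff_inverse2)
    moreover have "4 * (b * b) + 8 \<le> 4 * (2 * H) + 2 * (2 * b)" using ineq by linarith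
    moreover have "4 * (b * b) = (2 * b) * (2 * b)" by simp
    ultimately have "((k + 3) * (k + 4)) * ((k + 3) * (k + 4)) + 8 \<le> 4 * ((2 * k + 5) * (2 * k + 6)) + 2 * ((k + 3) * (k + 4))"
      by (simp add: add.commute add.left_commute) 
    then have False by (simp add: algebra_simps)
    then show ?thesis ..
  next
    case 2
    have "(\<Sum>s\<in>{d<..2*d}. h s) = 0" using mono[of d] 2 by fastforce
    then have "H = b" using Hs by simp
    then have i: "b * b + 2 \<le> 3 * b" using ineq by simp
    have "b < 3"
    proof (rule ccontr)
      assume "\<not> b < 3"
      then have "3 * b \<le> b * b" by (intro mult_right_mono) auto
      then show False using i by linarith
    qed
    then show ?thesis using \<open>H = b\<close> by simp
  next
    case 3
    have "(\<Sum>s\<in>{d<..2*d}. h s) \<le> (\<Sum>s\<in>{d<..2*d}. 1)" by (intro sum_mono) (use mono[of d] 3 d in fastforce)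
    then have H1: "H \<le> b + d" using Hs by simp
    have ge: "h s \<ge> 1" if "s \<le> d" for s
    proof (rule ccontr)
      assume "\<not> h s \<ge> 1"
      then have "h s = 0" by simp
      then show False using mono[of s d] that 3 by simp
    qed
    have bd: "b \<ge> d + 1" unfolding b using sum_mono[of "{..d}" "\<lambda>_. 1" h] ge by simp
    have "b \<le> 4"
    proof (rule ccontr)
      assume "\<not> b \<le> 4"
      then have "5 * b \<le> b * b" by (intro mult_right_mono) auto
      then show False using ineq H1 bd by linarith
    qed
    then have "b = 3 \<or> b = 4" using bd d by linarith
    then have b': "d \<le> 3" "b = d + 1" using ineq H1 bd d by auto
    have "h 1 \<le> 1"
    proof (rule ccontr)
      assume "\<not> h 1 \<le> 1"
      have "(\<Sum>s\<le>d. 1 + (if s = 1 then 1 else 0)) \<le> b"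
        unfolding b by (intro sum_mono) (use ge \<open>\<not> h 1 \<le> 1\<close> in auto)
      moreover have "(\<Sum>s\<le>d. 1 + (if s = 1 then 1 else (0::nat))) = d + 2"
        unfolding sum.distrib using d by simp
      ultimately show False using b' by simp
    qed
    then have "h 0 + h 1 = 2" using ge[of 0] ge[of 1] h1[of 0] d by simp
    then show ?thesis using b' H1 by simp
  next
    case 4
    let ?e = "h d"
    have ge: "h s \<ge> min (Suc s) ?e" if "s \<le> d" for s
    proof (cases "h s \<le> s")
      case True
      then show ?thesis using mono[OF True that] by simp
    next
      case False
      then show ?thesis using h1[of s] by simp
    qed
    have "(\<Sum>s\<in>{d<..2*d}. h s) \<le> (\<Sum>s\<in>{d<..2*d}. ?e)" by (intro sum_mono) (use mono[of d] 4 in auto)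
    then have H1: "H \<le> b + d * ?e" using Hs by simp
    \<comment> \<open>The sum is a triangle followed by a constant, namely
      \<open>e * (t + 1) - e * (e - 1) / 2\<close>; for \<open>e <= t + 1\<close> this is at least
      \<open>e * (t + 2) / 2\<close>.\<close>
    have pyr: "e * (t + 2) \<le> 2 * (\<Sum>s\<le>t. min (Suc s) e)" if "e \<le> Suc t" for e t
      using that
    proof (induction t)
      case 0
      then show ?case by (cases e) auto
    next
      case (Suc t)
      show ?case
      proof (cases "e \<le> Suc t")
        case True
        then show ?thesis using Suc.IH by simp
      next
        case False
        then have e: "e = Suc (Suc t)" using Suc.prems by simp
        have "(\<Sum>s\<le>Suc t. min (Suc s) e) = (\<Sum>s\<le>Suc t. Suc s)"
          by (rule sum.cong) (auto simp: e)
        then show ?thesis using gauss[of "Suc t"] e by simp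
      qed
    qed
    have "(\<Sum>s\<le>d. min (Suc s) ?e) \<le> b" unfolding b by (intro sum_mono) (use ge in auto)
    then have b2: "?e * (d + 2) \<le> 2 * b" using pyr[of ?e d] 4 by linarith
    have "(\<Sum>s\<le>d. if s = 0 then 1 else 2) \<le> b"
      unfolding b
    proof (rule sum_mono)
      fix s assume "s \<in> {..d}"
      then show "(if s = 0 then 1 else 2) \<le> h s" using ge[of s] 4 by auto
    qed
    moreover have "(\<Sum>s\<le>t. if s = 0 then 1 else (2::nat)) = 2 * t + 1" for t by (induction t) auto
    ultimately have b5: "2 * d + 1 \<le> b" by simp
    have "?e * d + 2 * ?e \<le> 2 * b" using b2 by (simp add: algebra_simps)
    then have de: "d * ?e + 4 \<le> 2 * b" using 4 by (simp add: algebra_simps)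
    \<comment> \<open>That is, \<open>(b - 2) * (b - 5) <= 0\<close>. With
      \<open>b >= 2 * d + 1 >= 5\<close> only \<open>b = 5\<close>, \<open>d = 2\<close> is left,
      and there \<open>H <= 9\<close> contradicts the hypothesis.\<close>
    have i: "b * b + 10 \<le> 7 * b" using ineq H1 de by linarith
    have "b < 6"
    proof (rule ccontr)
      assume "\<not> b < 6"
      then consider "b = 6" | "b \<ge> 7" by linarith
      then show False
      proof cases
        case 2
        then have "7 * b \<le> b * b" by (intro mult_right_mono) auto
        then show False using i by linarith
      qed (use i in auto)
    qed
    then have "b = 5" "d = 2" using b5 d by auto
    moreover have "d * ?e \<le> 4" using 4 \<open>d = 2\<close> by simp
    ultimately have False using ineq H1 by simp
    then show ?thesis ..
  qed
qed

section \<open>From a cone in the plane to finitely many affine points\<close>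

lemma nonvanishing_line:
  fixes Y :: "(nat \<Rightarrow> 'k::field_char_0) set"
  assumes "finite Y" "Y \<subseteq> nonzero_vecs 2"
  shows "\<exists>c. \<forall>y\<in>Y. y 0 + c * y 1 + c\<^sup>2 * y 2 \<noteq> 0"
proof -
  \<comment> \<open>As a polynomial in \<open>c\<close>, the value of the linear form at
    \<open>y\<close> has the coordinates of \<open>y\<close> as coefficients, so a one-parameter
    family of lines suffices to avoid finitely many points.\<close>
  let ?p = "\<lambda>y::nat\<Rightarrow>'k. [:y 0, y 1, y 2:]"
  have "?p y \<noteq> 0" if "y \<in> Y" for y
  proof -
    have "\<exists>i\<le>2. y i \<noteq> 0" using that assms(2) by (auto simp: nonzero_vecs_def)
    then show ?thesis by (auto simp: le_Suc_eq numeral_2_eq_2)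
  qed
  then have "finite (\<Union>y\<in>Y. {c. poly (?p y) c = 0})" using assms(1) poly_roots_finite by blast
  then obtain c where "c \<notin> (\<Union>y\<in>Y. {c. poly (?p y) c = 0})"
    using ex_new_if_finite[OF infinite_UNIV_char_0] by blast
  then show ?thesis by (intro exI[of _ c]) (auto simp: power2_eq_square algebra_simps)
qed

text \<open>Dual points for the degrees 1, \<open>d\<close> and \<open>2 * d\<close> form a finite
  subset of \<open>Y\<close> with the same Hilbert function at these degrees. Some linear form
  vanishes at none of them, so they can be rescaled into an affine chart.\<close>

lemma plane_growth:
  fixes Y :: "(nat \<Rightarrow> 'k::field_char_0) set"
  assumes Y: "Y \<subseteq> nonzero_vecs 2" "\<And>y c. y \<in> Y \<Longrightarrow> c \<noteq> 0 \<Longrightarrow> (\<lambda>i. c * y i) \<in> Y"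
    and d: "d \<ge> 2" and b: "b = fdim Y (homfun (coords 2) d)" and H: "H = fdim Y (homfun (coords 2) (2 * d))"
    and ineq: "b * b + 2 \<le> 2 * H + b"
  shows "(b \<le> 2 \<and> H \<le> b) \<or>
    (d \<le> 3 \<and> b = d + 1 \<and> H \<le> 2 * d + 1 \<and> fdim Y (homfun (coords 2) 1) = 2)"
proof -
  let ?R = "homfun (coords 2) :: nat \<Rightarrow> ((nat \<Rightarrow> 'k) \<Rightarrow> 'k) set"
  let ?n = "\<lambda>t. fdim Y (?R t)"
  have fg: "fin_gen (?R t)" for t by (rule fin_gen_homfun) simp
  have "\<forall>t. \<exists>p g. dual_sys Y (?R t) (?n t) p g"
    using dual_sys_exists[OF homfun_subspace fg] by blast
  then obtain p g where pg: "\<And>t. dual_sys Y (?R t) (?n t) (p t) (g t)" by metis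
  define Y0 where "Y0 = (\<Union>t\<in>{1, d, 2 * d}. p t ` {..<?n t})"
  have Y0: "finite Y0" "Y0 \<subseteq> Y" using pg by (auto simp: Y0_def dual_sys_def)
  from nonvanishing_line[OF Y0(1)] Y0(2) Y(1)
  obtain c where c: "\<And>y. y \<in> Y0 \<Longrightarrow> y 0 + c * y 1 + c\<^sup>2 * y 2 \<noteq> 0" by blast
  define l where "l = (\<lambda>y::nat\<Rightarrow>'k. y 0 + c * y 1 + c\<^sup>2 * y 2)"
  define N where "N = (\<lambda>y::nat\<Rightarrow>'k. (\<lambda>i. (1 / l y) * y i))"
  have lnz: "l y \<noteq> 0" if "y \<in> Y0" for y using c[OF that] by (simp add: l_def)
  have eq: "fdim (N ` Y0) (?R t) = ?n t" if t: "t \<in> {1, d, 2 * d}" for t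
  proof (rule antisym)
    have "N y \<in> Y" if "y \<in> Y0" for y
      unfolding N_def using that Y0(2) lnz[OF that] by (intro Y(2)) auto
    then show "fdim (N ` Y0) (?R t) \<le> ?n t" by (intro fdim_mono_set fg) auto
    have inY0: "p t i \<in> Y0" if "i < ?n t" for i using that t unfolding Y0_def by blast
    \<comment> \<open>Rescaling a point by \<open>1 / l\<close> divides the values of forms of
      degree \<open>t\<close> by \<open>l ^ t\<close>; the factor on the dual functions restores the
      value 1.\<close>
    have "dual_sys (N ` Y0) (?R t) (?n t) (\<lambda>i. N (p t i)) (\<lambda>i x. l (p t i) ^ t * g t i x)"
      unfolding dual_sys_def
    proof (intro conjI allI impI)
      fix i assume i: "i < ?n t"
      show "N (p t i) \<in> N ` Y0" using inY0[OF i] by blast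
      have gi: "g t i \<in> ?R t" using pg[of t] i by (auto simp: dual_sys_def)
      then show "(\<lambda>x. l (p t i) ^ t * g t i x) \<in> ?R t" by (rule homfun_closed)
      fix j assume j: "j < ?n t"
      have "g t i (N (p t j)) = (1 / l (p t j)) ^ t * g t i (p t j)"
        unfolding N_def by (rule coords_scale[OF gi])
      moreover have "g t i (p t j) = (if i = j then 1 else 0)" using pg[of t] i j by (auto simp: dual_sys_def)
      ultimately show "l (p t i) ^ t * g t i (N (p t j)) = (if i = j then 1 else 0)"
        using lnz[OF inY0[OF i]] by (cases "i = j") (simp_all add: power_divide)
    qed
    then show "?n t \<le> fdim (N ` Y0) (?R t)" by (rule dual_sys_le_fdim[OF _ fg])
  qed
  have "N y 0 + c * N y 1 + c\<^sup>2 * N y 2 = 1" if "y \<in> Y0" for y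
  proof -
    have "N y 0 + c * N y 1 + c\<^sup>2 * N y 2 = (1 / l y) * l y"
      by (simp add: N_def l_def algebra_simps add_divide_distrib)
    then show ?thesis using lnz[OF that] by simp
  qed
  then have "\<And>y. y \<in> N ` Y0 \<Longrightarrow> y 0 + c * y 1 + c\<^sup>2 * y 2 = 1" by blast
  from affine_hilbert[OF this] obtain h where
    h: "\<And>t. fdim (N ` Y0) (?R t) = (\<Sum>s\<le>t. h s)" "\<And>s. h s \<le> Suc s" "\<And>s. h s \<le> s \<Longrightarrow> h (Suc s) \<le> h s"
    by blast
  have "?n 1 = h 0 + h 1" using eq[of 1] h(1)[of 1] by simp
  moreover have "b = (\<Sum>s\<le>d. h s)" "H = (\<Sum>s\<le>2*d. h s)" using eq[of d] eq[of "2*d"] h(1) b H by auto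
  ultimately show ?thesis using hilbert_numeric[OF h(2,3) d _ _ ineq] by presburger
qed

section \<open>Evaluation of polynomials\<close>

definition monom_eval :: "(nat \<Rightarrow>\<^sub>0 nat) \<Rightarrow> (nat \<Rightarrow> 'k::comm_ring_1) \<Rightarrow> 'k" where
  "monom_eval m x = (\<Prod>i \<in> Poly_Mapping.keys m. x i ^ Poly_Mapping.lookup m i)"

lemma monom_eval_superset:
  assumes "finite A" "Poly_Mapping.keys m \<subseteq> A"
  shows "monom_eval m x = (\<Prod>i\<in>A. x i ^ Poly_Mapping.lookup m i)"
  unfolding monom_eval_def
  by (rule prod.mono_neutral_left) (use assms in \<open>auto simp: in_keys_iff\<close>)

lemma monom_degree_superset:
  assumes "finite A" "Poly_Mapping.keys m \<subseteq> A"
  shows "monom_degree m = (\<Sum>i\<in>A. Poly_Mapping.lookup m i)"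
  unfolding monom_degree_def
  by (rule sum.mono_neutral_left) (use assms in \<open>auto simp: in_keys_iff\<close>)

lemma monom_eval_add: "monom_eval (m + n) x = monom_eval m x * monom_eval n x"
proof -
  let ?A = "Poly_Mapping.keys m \<union> Poly_Mapping.keys n"
  have "monom_eval (m + n) x = (\<Prod>i\<in>?A. x i ^ Poly_Mapping.lookup (m + n) i)"
    by (rule monom_eval_superset) (auto dest: subsetD[OF Poly_Mapping.keys_add])
  also have "\<dots> = (\<Prod>i\<in>?A. x i ^ Poly_Mapping.lookup m i) * (\<Prod>i\<in>?A. x i ^ Poly_Mapping.lookup n i)"
    by (simp add: lookup_add power_add prod.distrib)
  also have "\<dots> = monom_eval m x * monom_eval n x"
    by (subst (1 2) monom_eval_superset[of ?A]) auto
  finally show ?thesis .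
qed

lemma monom_degree_add: "monom_degree (m + n) = monom_degree m + monom_degree n"
proof -
  let ?A = "Poly_Mapping.keys m \<union> Poly_Mapping.keys n"
  have "monom_degree (m + n) = (\<Sum>i\<in>?A. Poly_Mapping.lookup (m + n) i)"
    by (rule monom_degree_superset) (auto dest: subsetD[OF Poly_Mapping.keys_add])
  also have "\<dots> = (\<Sum>i\<in>?A. Poly_Mapping.lookup m i) + (\<Sum>i\<in>?A. Poly_Mapping.lookup n i)"
    by (simp add: lookup_add sum.distrib)
  also have "\<dots> = monom_degree m + monom_degree n"
    by (subst (1 2) monom_degree_superset[of ?A]) auto
  finally show ?thesis .
qed

lemma peval_superset:
  assumes "finite A" "Poly_Mapping.keys f \<subseteq> A"
  shows "peval f x = (\<Sum>m\<in>A. Poly_Mapping.lookup f m * monom_eval m x)"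
  unfolding peval_def monom_eval_def[symmetric]
  by (rule sum.mono_neutral_left) (use assms in \<open>auto simp: in_keys_iff\<close>)

lemma peval_0 [simp]: "peval 0 x = 0"
  by (simp add: peval_def)

lemma peval_add [simp]: "peval (f + g) x = peval f x + peval g x"
proof -
  let ?A = "Poly_Mapping.keys f \<union> Poly_Mapping.keys g"
  have "peval (f + g) x = (\<Sum>m\<in>?A. Poly_Mapping.lookup (f + g) m * monom_eval m x)"
    by (rule peval_superset) (auto dest: subsetD[OF Poly_Mapping.keys_add])
  also have "\<dots> = (\<Sum>m\<in>?A. Poly_Mapping.lookup f m * monom_eval m x) + (\<Sum>m\<in>?A. Poly_Mapping.lookup g m * monom_eval m x)"
    by (simp add: lookup_add sum.distrib algebra_simps)
  also have "\<dots> = peval f x + peval g x"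
    by (subst (1 2) peval_superset[of ?A]) auto
  finally show ?thesis .
qed

lemma peval_sum [simp]: "peval (\<Sum>i\<in>I. f i) x = (\<Sum>i\<in>I. peval (f i) x)"
  by (induction I rule: infinite_finite_induct) auto

lemma peval_single: "peval (Poly_Mapping.single m c) x = c * monom_eval m x"
  using peval_superset[of "{m}" "Poly_Mapping.single m c" x] by simp

lemma sum_singles: "f = (\<Sum>m\<in>Poly_Mapping.keys f. Poly_Mapping.single m (Poly_Mapping.lookup f m))"
proof (rule poly_mapping_eqI)
  fix k
  have "Poly_Mapping.lookup (\<Sum>m\<in>Poly_Mapping.keys f. Poly_Mapping.single m (Poly_Mapping.lookup f m)) k
    = (\<Sum>m\<in>Poly_Mapping.keys f. if m = k then Poly_Mapping.lookup f m else 0)"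
    by (simp add: lookup_sum lookup_single when_def)
  also have "\<dots> = Poly_Mapping.lookup f k" by (simp add: in_keys_iff)
  finally show "Poly_Mapping.lookup f k = Poly_Mapping.lookup (\<Sum>m\<in>Poly_Mapping.keys f. Poly_Mapping.single m (Poly_Mapping.lookup f m)) k"
    by simp
qed

lemma peval_mult [simp]:
  fixes f g :: "'k::comm_ring_1 mpoly"
  shows "peval (f * g) x = peval f x * peval g x"
proof -
  let ?l = "Poly_Mapping.lookup"
  have "f * g = (\<Sum>m\<in>Poly_Mapping.keys f. Poly_Mapping.single m (?l f m)) * (\<Sum>n\<in>Poly_Mapping.keys g. Poly_Mapping.single n (?l g n))"
    using sum_singles[of f] sum_singles[of g] by simp
  also have "\<dots> = (\<Sum>m\<in>Poly_Mapping.keys f. \<Sum>n\<in>Poly_Mapping.keys g. Poly_Mapping.single (m + n) (?l f m * ?l g n))"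
    by (simp add: sum_product Poly_Mapping.mult_single)
  finally have "peval (f * g) x = (\<Sum>m\<in>Poly_Mapping.keys f. \<Sum>n\<in>Poly_Mapping.keys g. (?l f m * ?l g n) * (monom_eval m x * monom_eval n x))"
    by (simp add: peval_single monom_eval_add)
  also have "\<dots> = peval f x * peval g x"
    unfolding peval_def monom_eval_def[symmetric] by (simp add: sum_product algebra_simps)
  finally show ?thesis .
qed

lemma poly_ring_0 [simp]: "0 \<in> poly_ring N"
  by (simp add: poly_ring_def)

lemma poly_ring_add: "f \<in> poly_ring N \<Longrightarrow> g \<in> poly_ring N \<Longrightarrow> f + g \<in> poly_ring N"
  unfolding poly_ring_def using Poly_Mapping.keys_add[of f g] by blast

lemma poly_ring_mult: 
  assumes "f \<in> poly_ring N" "g \<in> poly_ring N" shows "f * g \<in> poly_ring N"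
  unfolding poly_ring_def
proof (intro CollectI ballI)
  fix m assume "m \<in> Poly_Mapping.keys (f * g)"
  then obtain a b where ab: "m = a + b" "a \<in> Poly_Mapping.keys f" "b \<in> Poly_Mapping.keys g"
    using Poly_Mapping.keys_mult[of f g] by blast
  then show "Poly_Mapping.keys m \<subseteq> {..N}"
    using assms Poly_Mapping.keys_add[of a b] unfolding poly_ring_def by blast
qed

abbreviation pconst :: "'k::comm_ring_1 \<Rightarrow> 'k mpoly" where
  "pconst c \<equiv> Poly_Mapping.single 0 c"

lemma poly_ring_const: "pconst c \<in> poly_ring N"
  by (simp add: poly_ring_def)

lemma forms_poly_ring: "f \<in> forms N a \<Longrightarrow> f \<in> poly_ring N"
  by (simp add: forms_def)

lemma forms_0 [simp]: "0 \<in> forms N a"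
  by (simp add: forms_def)

lemma forms_add: "f \<in> forms N a \<Longrightarrow> g \<in> forms N a \<Longrightarrow> f + g \<in> forms N a"
  using Poly_Mapping.keys_add[of f g] poly_ring_add[of f N g] unfolding forms_def by blast

lemma forms_mult:
  assumes "f \<in> forms N a" "g \<in> forms N b" shows "f * g \<in> forms N (a + b)"
  unfolding forms_def
proof (intro CollectI conjI ballI)
  show "f * g \<in> poly_ring N" using assms by (intro poly_ring_mult) (auto simp: forms_def)
  fix m assume "m \<in> Poly_Mapping.keys (f * g)"
  then obtain p q where "m = p + q" "p \<in> Poly_Mapping.keys f" "q \<in> Poly_Mapping.keys g"
    using Poly_Mapping.keys_mult[of f g] by blast
  then show "monom_degree m = a + b" using assms by (simp add: forms_def monom_degree_add)
qed

lemma forms_const: "pconst c \<in> forms N 0"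
  by (simp add: forms_def poly_ring_const monom_degree_def)

definition pvar :: "nat \<Rightarrow> 'k::comm_ring_1 mpoly" where
  "pvar j = Poly_Mapping.single (Poly_Mapping.single j 1) 1"

lemma pvar_forms: "j \<le> N \<Longrightarrow> pvar j \<in> forms N 1"
  by (simp add: forms_def poly_ring_def pvar_def monom_degree_def)

lemma peval_pvar [simp]: "peval (pvar j) x = x j"
  by (simp add: pvar_def peval_single monom_eval_def)

lemma peval_const [simp]: "peval (pconst c) x = c"
  by (simp add: peval_single monom_eval_def)

lemma monom_eval_homfun:
  assumes "Poly_Mapping.keys m \<subseteq> {..N}"
  shows "monom_eval m \<in> homfun (coords N) (monom_degree m)"
proof -
  have "(\<lambda>x. \<Prod>i\<in>Poly_Mapping.keys m. x i ^ Poly_Mapping.lookup m i)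
      \<in> homfun (coords N) (\<Sum>i\<in>Poly_Mapping.keys m. Poly_Mapping.lookup m i)"
  proof (rule homfun_prod)
    fix i assume "i \<in> Poly_Mapping.keys m"
    then have "i \<le> N" using assms by auto
    from homfun_power[OF homfun_base[OF coordsI[OF this]], of "Poly_Mapping.lookup m i"]
    show "(\<lambda>x. x i ^ Poly_Mapping.lookup m i) \<in> homfun (coords N) (Poly_Mapping.lookup m i)"
      by (simp only: mult_1)
  qed simp
  then show ?thesis by (simp add: monom_eval_def[abs_def] monom_degree_def)
qed

lemma peval_homfun:
  fixes f :: "'k::field mpoly"
  assumes "f \<in> forms N t" shows "peval f \<in> homfun (coords N) t"
proof -
  have "(\<lambda>x. \<Sum>m\<in>Poly_Mapping.keys f. Poly_Mapping.lookup f m * monom_eval m x) \<in> homfun (coords N) t"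
  proof (rule homfun_closed(5))
    fix m assume "m \<in> Poly_Mapping.keys f"
    then show "monom_eval m \<in> homfun (coords N) t"
      using assms monom_eval_homfun[of m N] by (auto simp: forms_def poly_ring_def)
  qed
  then show ?thesis by (simp add: peval_def[abs_def] monom_eval_def)
qed

text \<open>Together with \<open>peval_homfun\<close> this matches forms with homogeneous functions:
  constructions are made among functions and return to polynomials here.\<close>

lemma homfun_form:
  fixes g :: "(nat \<Rightarrow> 'k::field) \<Rightarrow> 'k"
  assumes "g \<in> homfun (coords N) t" shows "\<exists>f\<in>forms N t. peval f = g"
  using assms
proof (induction t arbitrary: g)
  case 0
  then obtain c where "g = (\<lambda>x. c)" using homfun_0E by blast
  then show ?case by (intro bexI[of _ "pconst c"]) (auto simp: forms_const)
next
  case (Suc t)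
  from Suc.prems show ?case
  proof (induction rule: homfun_Suc_induct)
    case zero
    show ?case by (rule bexI[of _ 0]) auto
  next
    case (add f g)
    then obtain f' g' where "f' \<in> forms N (Suc t)" "peval f' = f" "g' \<in> forms N (Suc t)" "peval g' = g" by blast
    then show ?case by (intro bexI[of _ "f' + g'"]) (auto intro: forms_add)
  next
    case (base u g)
    then obtain j where j: "j \<le> N" "u = (\<lambda>x. x j)" by (auto simp: coords_def)
    from Suc.IH[OF base(2)] obtain g' where "g' \<in> forms N t" "peval g' = g" by blast
    then show ?case
      using forms_mult[OF pvar_forms[OF j(1)], of g' t] j(2)
      by (intro bexI[of _ "pvar j * g'"]) auto
  qed
qed

lemma peval_polyfun:
  fixes f :: "'k::field mpoly"
  assumes "f \<in> poly_ring N" shows "peval f \<in> polyfun (coords N)"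
proof -
  have "(\<lambda>x. \<Sum>m\<in>Poly_Mapping.keys f. Poly_Mapping.lookup f m * monom_eval m x) \<in> polyfun (coords N)"
  proof (intro polyfun_sum polyfun.mult polyfun.const)
    fix m assume "m \<in> Poly_Mapping.keys f"
    then show "monom_eval m \<in> polyfun (coords N)"
      using assms subsetD[OF homfun_polyfun monom_eval_homfun[of m N]] by (simp add: poly_ring_def)
  qed
  then show ?thesis by (simp add: peval_def[abs_def] monom_eval_def)
qed

lemma polyfun_poly_ring:
  fixes g :: "(nat \<Rightarrow> 'k::field) \<Rightarrow> 'k"
  assumes "g \<in> polyfun (coords N)" shows "\<exists>f\<in>poly_ring N. peval f = g"
  using assms
proof induction
  case (const c)
  show ?case by (intro bexI[of _ "pconst c"]) (auto simp: poly_ring_const)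
next
  case (base u)
  then obtain j where j: "j \<le> N" "u = (\<lambda>x. x j)" by (auto simp: coords_def)
  then show ?case using pvar_forms[of j N] by (intro bexI[of _ "pvar j"]) (auto simp: forms_def)
next
  case (add f g)
  then obtain f' g' where "f' \<in> poly_ring N" "peval f' = f" "g' \<in> poly_ring N" "peval g' = g" by blast
  then show ?case by (intro bexI[of _ "f' + g'"]) (auto intro: poly_ring_add)
next
  case (mult f g)
  then obtain f' g' where "f' \<in> poly_ring N" "peval f' = f" "g' \<in> poly_ring N" "peval g' = g" by blast
  then show ?case by (intro bexI[of _ "f' * g'"]) (auto intro: poly_ring_mult)
qed

lemma forms_scale: "f \<in> forms N t \<Longrightarrow> peval f (\<lambda>i. c * x i) = c ^ t * peval f (x :: nat \<Rightarrow> 'k::field)"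
  by (rule coords_scale[OF peval_homfun])

section \<open>Ideals\<close>

lemma ideal_gen_base:
  assumes "f \<in> F" shows "f \<in> ideal_gen N F"
proof -
  have "f = (\<Sum>g\<in>{f}. pconst 1 * g)" by simp
  then show ?thesis using assms poly_ring_const[of 1 N] unfolding ideal_gen_def
    by (intro CollectI exI[of _ "{f}"] exI[of _ "\<lambda>_. pconst 1"]) auto
qed

lemma ideal_gen_0: "0 \<in> ideal_gen N F"
  unfolding ideal_gen_def by (intro CollectI exI[of _ "{}"]) auto

lemma ideal_gen_add:
  assumes "f \<in> ideal_gen N F" "g \<in> ideal_gen N F" shows "f + g \<in> ideal_gen N F"
proof -
  from assms obtain A p B q where
    A: "finite A" "A \<subseteq> F" "\<forall>h\<in>A. p h \<in> poly_ring N" "f = (\<Sum>h\<in>A. p h * h)" and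
    B: "finite B" "B \<subseteq> F" "\<forall>h\<in>B. q h \<in> poly_ring N" "g = (\<Sum>h\<in>B. q h * h)"
    unfolding ideal_gen_def by blast
  define r where "r = (\<lambda>h. (if h \<in> A then p h else 0) + (if h \<in> B then q h else 0))"
  have "f = (\<Sum>h\<in>A \<union> B. (if h \<in> A then p h else 0) * h)"
    unfolding A(4) by (rule sum.mono_neutral_cong_left) (use A(1) B(1) in auto)
  moreover have "g = (\<Sum>h\<in>A \<union> B. (if h \<in> B then q h else 0) * h)"
    unfolding B(4) by (rule sum.mono_neutral_cong_left) (use A(1) B(1) in auto)
  ultimately have "f + g = (\<Sum>h\<in>A \<union> B. r h * h)" by (simp add: r_def sum.distrib algebra_simps)
  moreover have "\<forall>h\<in>A \<union> B. r h \<in> poly_ring N" using A(3) B(3) by (auto simp: r_def intro!: poly_ring_add)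
  ultimately show ?thesis unfolding ideal_gen_def
    using A(1,2) B(1,2) by (intro CollectI exI[of _ "A \<union> B"] exI[of _ r]) auto
qed

lemma ideal_gen_mult:
  assumes "f \<in> ideal_gen N F" "g \<in> poly_ring N" shows "g * f \<in> ideal_gen N F"
proof -
  from assms obtain A p where
    A: "finite A" "A \<subseteq> F" "\<forall>h\<in>A. p h \<in> poly_ring N" "f = (\<Sum>h\<in>A. p h * h)"
    unfolding ideal_gen_def by blast
  then have "g * f = (\<Sum>h\<in>A. (g * p h) * h)" by (simp add: sum_distrib_left mult.assoc)
  moreover have "\<forall>h\<in>A. g * p h \<in> poly_ring N" using A(3) assms(2) poly_ring_mult by blast
  ultimately show ?thesis unfolding ideal_gen_def
    using A(1,2) by (intro CollectI exI[of _ A] exI[of _ "\<lambda>h. g * p h"]) auto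
qed

lemma ideal_gen_induct [consumes 1, case_names zero add base]:
  assumes "f \<in> ideal_gen N F" "P 0" "\<And>f g. P f \<Longrightarrow> P g \<Longrightarrow> P (f + g)"
    "\<And>g h. h \<in> F \<Longrightarrow> g \<in> poly_ring N \<Longrightarrow> P (g * h)"
  shows "P f"
proof -
  from assms(1) obtain A p where
    A: "finite A" "A \<subseteq> F" "\<forall>h\<in>A. p h \<in> poly_ring N" "f = (\<Sum>h\<in>A. p h * h)"
    unfolding ideal_gen_def by blast
  from A(1-3) have "P (\<Sum>h\<in>A. p h * h)"
    by (induction A rule: finite_induct) (auto intro: assms)
  then show ?thesis using A(4) by simp
qed

lemma ideal_gen_minimal:
  assumes "F \<subseteq> ideal_gen N G" shows "ideal_gen N F \<subseteq> ideal_gen N G"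
proof
  fix f assume "f \<in> ideal_gen N F"
  then show "f \<in> ideal_gen N G"
    by (induction rule: ideal_gen_induct) (use assms in \<open>auto intro: ideal_gen_0 ideal_gen_add ideal_gen_mult\<close>)
qed

text \<open>The list may repeat a polynomial and generators are later counted by position, so the
  coefficients are indexed by positions.\<close>

lemma ideal_gen_list:
  assumes "f \<in> ideal_gen N (set fs)"
  shows "\<exists>g. (\<forall>i<length fs. g i \<in> poly_ring N) \<and> f = (\<Sum>i<length fs. g i * fs ! i)"
  using assms
proof (induction rule: ideal_gen_induct)
  case zero
  show ?case by (intro exI[of _ "\<lambda>_. 0"]) auto
next
  case (add f g)
  then obtain p q where "\<forall>i<length fs. p i \<in> poly_ring N" "f = (\<Sum>i<length fs. p i * fs ! i)"
    "\<forall>i<length fs. q i \<in> poly_ring N" "g = (\<Sum>i<length fs. q i * fs ! i)" by blast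
  then show ?case
    by (intro exI[of _ "\<lambda>i. p i + q i"]) (auto intro: poly_ring_add simp: sum.distrib algebra_simps)
next
  case (base g h)
  then obtain j where j: "j < length fs" "h = fs ! j" by (auto simp: in_set_conv_nth)
  have "(\<Sum>i<length fs. (if i = j then g else 0) * fs ! i) = (\<Sum>i<length fs. if i = j then g * fs ! i else 0)"
    by (rule sum.cong) auto
  then have "g * h = (\<Sum>i<length fs. (if i = j then g else 0) * fs ! i)" using j by simp
  then show ?case using base by (intro exI[of _ "\<lambda>i. if i = j then g else 0"]) auto
qed

text \<open>The degree \<open>k\<close> part of an identity \<open>f = \<Sum> g\<^sub>i f\<^sub>i\<close>, read off from the coefficient of
  \<open>c\<^sup>k\<close> after substituting \<open>c x\<close> for \<open>x\<close>.\<close>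

lemma form_in_ideal_eval:
  fixes fs :: "'k::field_char_0 mpoly list"
  assumes f: "f \<in> forms N k" "f = (\<Sum>i<length fs. g i * fs ! i)"
    and fs: "\<And>i. i < length fs \<Longrightarrow> fs ! i \<in> forms N (a i)"
    and g: "\<And>i. i < length fs \<Longrightarrow> g i \<in> poly_ring N"
    and x: "\<And>i. i < length fs \<Longrightarrow> a i < k \<Longrightarrow> peval (fs ! i) x = 0"
  shows "peval f x = (\<Sum>i\<in>{i. i < length fs \<and> a i = k}. peval (g i) (\<lambda>_. 0) * peval (fs ! i) x)"
proof -
  have "\<exists>p. \<forall>c. peval (g i) (\<lambda>j. c * x j) = poly p c" if "i < length fs" for i
  proof (rule polyfun_poly[OF peval_polyfun[OF g[OF that]]])
    fix u :: "(nat \<Rightarrow> 'k) \<Rightarrow> 'k" assume "u \<in> coords N"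
    then obtain j where "u = (\<lambda>x. x j)" by (auto simp: coords_def)
    then show "\<exists>p. \<forall>c. u (\<lambda>j. c * x j) = poly p c" by (intro exI[of _ "[:0, x j:]"]) simp
  qed
  then obtain p where p: "\<And>i c. i < length fs \<Longrightarrow> peval (g i) (\<lambda>j. c * x j) = poly (p i) c"
    by metis
  have "poly (monom (peval f x) k) c = poly (\<Sum>i<length fs. monom (peval (fs ! i) x) (a i) * p i) c" for c
  proof -
    have "c ^ k * peval f x = peval f (\<lambda>j. c * x j)" using forms_scale[OF f(1)] by simp
    also have "\<dots> = (\<Sum>i<length fs. peval (g i) (\<lambda>j. c * x j) * peval (fs ! i) (\<lambda>j. c * x j))"
      by (simp add: f(2))
    also have "\<dots> = (\<Sum>i<length fs. poly (p i) c * (c ^ a i * peval (fs ! i) x))"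
      by (intro sum.cong refl) (simp add: p forms_scale[OF fs])
    finally show ?thesis by (simp add: poly_monom poly_sum algebra_simps)
  qed
  then have "monom (peval f x) k = (\<Sum>i<length fs. monom (peval (fs ! i) x) (a i) * p i)"
    by (intro poly_eq_poly_eq_iff[THEN iffD1] ext)
  then have "coeff (monom (peval f x) k) k = coeff (\<Sum>i<length fs. monom (peval (fs ! i) x) (a i) * p i) k"
    by simp
  then have "peval f x = (\<Sum>i<length fs. coeff (monom (peval (fs ! i) x) (a i) * p i) k)"
    by (simp add: coeff_sum)
  \<comment> \<open>Generators of degree above \<open>k\<close> do not reach the coefficient, those
    of lower degree vanish at \<open>x\<close>, and in degree \<open>k\<close> only the constant
    term of \<open>g i\<close>, its value at the zero vector, is left.\<close>
  also have "\<dots> = (\<Sum>i<length fs. if a i = k then peval (g i) (\<lambda>_. 0) * peval (fs ! i) x else 0)"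
  proof (rule sum.cong)
    fix i assume i: "i \<in> {..<length fs}"
    have "coeff (p i) 0 = peval (g i) (\<lambda>_. 0)" using p[of i 0] i by (simp add: poly_0_coeff_0)
    then show "coeff (monom (peval (fs ! i) x) (a i) * p i) k =
        (if a i = k then peval (g i) (\<lambda>_. 0) * peval (fs ! i) x else 0)"
      using x[of i] i by (auto simp: coeff_monom_mult)
  qed simp
  also have "\<dots> = (\<Sum>i\<in>{i. i < length fs \<and> a i = k}. peval (g i) (\<lambda>_. 0) * peval (fs ! i) x)"
    by (rule sum.mono_neutral_cong_right) auto
  finally show ?thesis .
qed

section \<open>Points of projective space\<close>

abbreviation cls :: "nat \<Rightarrow> (nat \<Rightarrow> 'k::field) \<Rightarrow> (nat \<Rightarrow> 'k) set" where
  "cls N x \<equiv> proj_rel N `` {x}"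

lemma nonzero_vecs_scale:
  "x \<in> nonzero_vecs N \<Longrightarrow> c \<noteq> 0 \<Longrightarrow> (\<lambda>i. c * x i) \<in> nonzero_vecs N"
  by (auto simp: nonzero_vecs_def)

lemma in_cls: "x \<in> nonzero_vecs N \<Longrightarrow> y \<in> cls N x \<longleftrightarrow> (\<exists>c. c \<noteq> 0 \<and> y = (\<lambda>i. c * x i))"
  using nonzero_vecs_scale by (auto simp: proj_rel_def)

lemma proj_space_iff: "p \<in> proj_space N \<longleftrightarrow> (\<exists>x\<in>nonzero_vecs N. p = cls N x)"
  by (auto simp: proj_space_def quotient_def)

lemma cls_self: "x \<in> nonzero_vecs N \<Longrightarrow> x \<in> cls N x"
  by (subst in_cls) (auto intro: exI[of _ 1])

lemma cls_eqI:
  assumes "x \<in> nonzero_vecs N" "c \<noteq> 0" shows "cls N (\<lambda>i. c * x i) = cls N x"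
proof -
  have cx: "(\<lambda>i. c * x i) \<in> nonzero_vecs N" using nonzero_vecs_scale assms by blast
  show ?thesis
  proof (intro set_eqI iffI)
    fix y assume "y \<in> cls N (\<lambda>i. c * x i)"
    then obtain e where "e \<noteq> 0" "y = (\<lambda>i. e * (c * x i))" using in_cls[OF cx] by blast
    then show "y \<in> cls N x" using in_cls[OF assms(1)] assms(2)
      by (auto intro!: exI[of _ "e * c"])
  next
    fix y assume "y \<in> cls N x"
    then obtain e where "e \<noteq> 0" "y = (\<lambda>i. e * x i)" using in_cls[OF assms(1)] by blast
    then show "y \<in> cls N (\<lambda>i. c * x i)" using in_cls[OF cx] assms(2)
      by (auto intro!: exI[of _ "e / c"])
  qed
qed

lemma cls_eq_iff:
  assumes "x \<in> nonzero_vecs N" "y \<in> nonzero_vecs N"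
  shows "cls N x = cls N y \<longleftrightarrow> (\<exists>c. c \<noteq> 0 \<and> y = (\<lambda>i. c * x i))"
proof
  assume "cls N x = cls N y"
  then have "y \<in> cls N x" using cls_self[OF assms(2)] by simp
  then show "\<exists>c. c \<noteq> 0 \<and> y = (\<lambda>i. c * x i)" using in_cls[OF assms(1)] by blast
qed (use cls_eqI[OF assms(1)] in auto)

lemma cls_in_proj_space: "x \<in> nonzero_vecs N \<Longrightarrow> cls N x \<in> proj_space N"
  by (auto simp: proj_space_iff)

lemma form_cls_iff:
  assumes "f \<in> forms N t" "x \<in> nonzero_vecs N"
  shows "(\<forall>y\<in>cls N x. peval f y = 0) \<longleftrightarrow> peval f x = (0 :: 'k::field)"
proof
  assume "\<forall>y\<in>cls N x. peval f y = 0"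
  then show "peval f x = 0" using cls_self[OF assms(2)] by blast
next
  assume "peval f x = 0"
  then show "\<forall>y\<in>cls N x. peval f y = 0"
    using in_cls[OF assms(2)] forms_scale[OF assms(1)] by (metis mult_zero_right)
qed

lemma cls_in_zero_locus:
  assumes "F \<subseteq> (\<Union>a. forms N a)" "x \<in> nonzero_vecs N"
  shows "cls N x \<in> zero_locus N F \<longleftrightarrow> (\<forall>f\<in>F. peval f x = (0 :: 'k::field))"
proof -
  have "(\<forall>y\<in>cls N x. peval f y = 0) \<longleftrightarrow> peval f x = 0" if "f \<in> F" for f
    using form_cls_iff[OF _ assms(2)] that assms(1) by blast
  then show ?thesis using cls_in_proj_space[OF assms(2)] by (simp add: zero_locus_def)
qed

lemma zariski_closed_subset: "zariski_closed N X \<Longrightarrow> X \<subseteq> proj_space N"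
  by (auto simp: zariski_closed_def zero_locus_def)

text \<open>Vectors whose 2 x 2 minors all vanish are proportional. The minors later supply linear
  forms that separate two points.\<close>

lemma cls_neq_coords:
  fixes x y :: "nat \<Rightarrow> 'k::field"
  assumes "x \<in> nonzero_vecs N" "y \<in> nonzero_vecs N" "cls N x \<noteq> cls N y"
  shows "\<exists>k\<le>N. \<exists>l\<le>N. x k * y l \<noteq> x l * y k"
proof (rule ccontr)
  assume "\<not> ?thesis"
  then have eq: "x k * y l = x l * y k" if "k \<le> N" "l \<le> N" for k l using that by blast
  obtain k where k: "k \<le> N" "x k \<noteq> 0" using assms(1) by (auto simp: nonzero_vecs_def)
  have yx: "y = (\<lambda>i. (y k / x k) * x i)"
  proof
    fix i
    show "y i = (y k / x k) * x i"
    proof (cases "i \<le> N")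
      case True
      then show ?thesis using eq[OF k(1) True] k(2) by (simp add: field_simps)
    next
      case False
      then show ?thesis using assms(1,2) by (simp add: nonzero_vecs_def)
    qed
  qed
  moreover have "y k / x k \<noteq> 0"
  proof
    assume "y k / x k = 0"
    then have "y = (\<lambda>i. 0 * x i)" using yx by metis
    then show False using assms(2) by (simp add: nonzero_vecs_def)
  qed
  ultimately show False using cls_eq_iff[OF assms(1,2)] assms(3) by blast
qed

lemma zariski_closed_sing:
  assumes "p \<in> proj_space N" shows "zariski_closed N {p}"
proof -
  obtain x where x: "x \<in> nonzero_vecs N" "p = cls N x" using assms by (auto simp: proj_space_iff)
  \<comment> \<open>The 2 x 2 minors of \<open>x\<close> and the vector of variables: linear forms
    whose common zeros are the multiples of \<open>x\<close>.\<close>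
  define F where "F = {pconst (x i) * pvar j + pconst (- x j) * pvar i | i j. i \<le> N \<and> j \<le> N}"
  have F: "F \<subseteq> (\<Union>a. forms N a)"
  proof
    fix f assume "f \<in> F"
    then obtain i j where ij: "i \<le> N" "j \<le> N"
      "f = pconst (x i) * pvar j + pconst (- x j) * pvar i" by (auto simp: F_def)
    have "f \<in> forms N (0 + 1)" unfolding ij(3)
      by (intro forms_add forms_mult forms_const pvar_forms ij)
    then show "f \<in> (\<Union>a. forms N a)" by blast
  qed
  have "zero_locus N F = {p}"
  proof (intro set_eqI iffI)
    fix q assume q: "q \<in> zero_locus N F"
    then obtain y where y: "y \<in> nonzero_vecs N" "q = cls N y" by (auto simp: zero_locus_def proj_space_iff)
    have eq: "x i * y j = x j * y i" if "i \<le> N" "j \<le> N" for i j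
    proof -
      have "pconst (x i) * pvar j + pconst (- x j) * pvar i \<in> F"
        using that by (auto simp: F_def)
      with cls_in_zero_locus[OF F y(1)] q y(2)
      have "peval (pconst (x i) * pvar j + pconst (- x j) * pvar i) y = 0" by blast
      then show ?thesis by simp
    qed
    then have "cls N x = cls N y" using cls_neq_coords[OF x(1) y(1)] by metis
    then show "q \<in> {p}" using x(2) y(2) by simp
  next
    fix q assume "q \<in> {p}"
    then show "q \<in> zero_locus N F" using cls_in_zero_locus[OF F x(1)] x(2) by (auto simp: F_def)
  qed
  then show ?thesis unfolding zariski_closed_def using F by metis
qed

lemma irreducible_closed_sing:
  assumes "p \<in> proj_space N" shows "irreducible_closed N {p}"
  using zariski_closed_sing[OF assms] unfolding irreducible_closed_def
  by (metis Un_empty_left insert_not_empty subset_singletonD sup_ge1)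

section \<open>The Veronese map on the plane\<close>

lemma set_veronese_exponents: "set (veronese_exponents 2 d) = {e. length e = 3 \<and> sum_list e = d}"
proof -
  have "{e::nat list. length e = 3 \<and> sum_list e = d} \<subseteq> {e. set e \<subseteq> {..d} \<and> length e = 3}"
    using member_le_sum_list by fastforce
  then have "finite {e::nat list. length e = 3 \<and> sum_list e = d}"
    using finite_lists_length_eq[of "{..d}" 3] finite_subset by blast
  then show ?thesis by (simp add: veronese_exponents_def)
qed

lemma length_veronese_exponents: "length (veronese_exponents 2 d) = (d + 2 choose 2)"
proof -
  have "length (veronese_exponents 2 d) = card {e::nat list. length e = 3 \<and> sum_list e = d}"
    by (simp add: veronese_exponents_def)
  also have "\<dots> = (d + 3 - 1 choose d)" by (rule card_length_sum_list)
  also have "\<dots> = (d + 2 choose 2)" using binomial_symmetric[of d "d + 2"] by simp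
  finally show ?thesis .
qed

lemma prod_le_2: "(\<Prod>i\<le>(2::nat). f i) = f 0 * f 1 * (f 2 :: 'a::comm_monoid_mult)"
  by (simp add: numeral_2_eq_2 mult.assoc)

lemma veronese_vec_0: "(d + 2 choose 2) \<le> j \<Longrightarrow> veronese_vec 2 d x j = 0"
  by (simp add: veronese_vec_def length_veronese_exponents)

lemma veronese_coord:
  assumes "j < (d + 2 choose 2)"
  shows "(\<lambda>x. veronese_vec 2 d x j) \<in> homfun (coords 2) d"
proof -
  let ?e = "veronese_exponents 2 d ! j"
  have j: "j < length (veronese_exponents 2 d)" using assms by (simp add: length_veronese_exponents)
  then have "?e \<in> set (veronese_exponents 2 d)" by simp
  then have e: "length ?e = 3" "sum_list ?e = d" by (auto simp: set_veronese_exponents)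
  have s: "(\<Sum>i\<le>2. ?e ! i) = d"
  proof -
    have "{..2::nat} = {0..<3}" by auto
    then show ?thesis using e by (simp add: sum_list_sum_nth)
  qed
  have "(\<lambda>x. \<Prod>i\<le>2. x i ^ (?e ! i)) \<in> homfun (coords 2) (\<Sum>i\<le>2. ?e ! i)"
  proof (rule homfun_prod)
    fix i :: nat assume "i \<in> {..2}"
    then have "i \<le> 2" by simp
    from homfun_power[OF homfun_base[OF coordsI[OF this]], of "?e ! i"]
    show "(\<lambda>x. x i ^ (?e ! i)) \<in> homfun (coords 2) (?e ! i)" by (simp only: mult_1)
  qed simp
  then show ?thesis using j s by (simp add: veronese_vec_def)
qed

lemma veronese_monomial:
  assumes "i + j + k = d"
  shows "\<exists>l<(d + 2 choose 2). \<forall>x. veronese_vec 2 d x l = x 0 ^ i * x 1 ^ j * x 2 ^ k"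
proof -
  have "[i, j, k] \<in> set (veronese_exponents 2 d)" using assms by (simp add: set_veronese_exponents)
  then obtain l where l: "l < length (veronese_exponents 2 d)" "veronese_exponents 2 d ! l = [i, j, k]"
    by (auto simp: in_set_conv_nth)
  then show ?thesis
    by (intro exI[of _ l]) (simp add: length_veronese_exponents veronese_vec_def prod_le_2)
qed

lemma veronese_pull:
  assumes "N = (d + 2 choose 2) - 1" "f \<in> homfun (coords N) t"
  shows "(\<lambda>x. f (veronese_vec 2 d x)) \<in> homfun (coords 2) (d * t)"
proof -
  have pos: "0 < (d + 2 choose 2)" by simp
  have "\<exists>g\<in>homfun (homfun (coords 2) d) t. \<forall>x\<in>UNIV. f (veronese_vec 2 d x) = g x"
  proof (rule homfun_transfer[OF assms(2)])
    fix u :: "(nat \<Rightarrow> 'a) \<Rightarrow> 'a" assume "u \<in> coords N"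
    then obtain j where j: "j \<le> N" "u = (\<lambda>x. x j)" by (auto simp: coords_def)
    then have "j < (d + 2 choose 2)" using assms(1) pos by linarith
    from veronese_coord[OF this] show "\<exists>v\<in>funs.span (homfun (coords 2) d). \<forall>x\<in>UNIV. u (veronese_vec 2 d x) = v x"
      using j(2) by (intro bexI[of _ "\<lambda>x. veronese_vec 2 d x j"]) (auto intro: funs.span_base)
  qed
  then obtain g where "g \<in> homfun (homfun (coords 2) d) t" "\<forall>x. f (veronese_vec 2 d x) = g x" by blast
  then show ?thesis unfolding homfun_homfun by presburger
qed

text \<open>Every monomial of degree \<open>d\<close> is a coordinate of the Veronese map, so forms
  of degree \<open>d\<close> come from linear forms; \<open>homfun_homfun\<close> extends this to
  degree \<open>d * t\<close>. Pullback, as in \<open>veronese_pull\<close>, is therefore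
  onto.\<close>

lemma veronese_push:
  assumes "N = (d + 2 choose 2) - 1" "g \<in> homfun (coords 2) (d * t)"
  shows "\<exists>f\<in>homfun (coords N) t. \<forall>x. f (veronese_vec 2 d x) = g x"
proof -
  have "g \<in> homfun (homfun (coords 2) d) t" using assms(2) by (simp add: homfun_homfun)
  then have "\<exists>f\<in>homfun (coords N) t. \<forall>x\<in>UNIV. g x = f (veronese_vec 2 d x)"
  proof (rule homfun_transfer)
    fix u :: "(nat \<Rightarrow> 'a) \<Rightarrow> 'a" assume "u \<in> homfun (coords 2) d"
    then have "u \<in> homfun {\<lambda>x. x 0, \<lambda>x. x 1, \<lambda>x. x 2} d" by (simp only: coords_2)
    from homfun3_monomials[OF this]
    show "\<exists>v\<in>funs.span (coords N). \<forall>x\<in>UNIV. u x = v (veronese_vec 2 d x)"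
    proof (induction rule: span_fun_induct)
      case zero
      show ?case using funs.span_zero[of "coords N"] by (intro bexI[of _ "\<lambda>x. 0"]) (auto simp: zero_fun_def)
    next
      case (add f g)
      then obtain f' g' where "f' \<in> funs.span (coords N)" "\<forall>x. f x = f' (veronese_vec 2 d x)"
         "g' \<in> funs.span (coords N)" "\<forall>x. g x = g' (veronese_vec 2 d x)" by blast
      then show ?case by (intro bexI[of _ "\<lambda>x. f' x + g' x"]) (auto intro: span_add_fun)
    next
      case (base c b)
      then obtain i j where b: "b = (\<lambda>x. x 0 ^ (d - (i + j)) * x 1 ^ i * x 2 ^ j)" "i + j \<le> d" by blast
      from veronese_monomial[of "d - (i + j)" i j d] b(2) obtain l where
        l: "l < (d + 2 choose 2)" "\<forall>x::nat\<Rightarrow>'a. veronese_vec 2 d x l = b x" by (auto simp: b(1))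
      then have "(\<lambda>x. x l) \<in> coords N" using assms(1) by (intro coordsI) linarith
      then show ?case using l(2) by (intro bexI[of _ "\<lambda>x. c * x l"] funs.span_scale funs.span_base) auto
    qed
  qed
  then show ?thesis by (metis UNIV_I)
qed

lemma veronese_scale: "veronese_vec 2 d (\<lambda>i. c * x i) = (\<lambda>j. c ^ d * veronese_vec 2 d x j)"
proof
  fix j
  show "veronese_vec 2 d (\<lambda>i. c * x i) j = c ^ d * veronese_vec 2 d x j"
  proof (cases "j < (d + 2 choose 2)")
    case True
    from coords_scale[OF veronese_coord[OF this]] show ?thesis .
  next
    case False
    then show ?thesis by (simp add: veronese_vec_0)
  qed
qed

lemma veronese_nonzero:
  assumes "N = (d + 2 choose 2) - 1" "x \<in> nonzero_vecs 2"
  shows "veronese_vec 2 d x \<in> nonzero_vecs N"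
proof -
  have pos: "0 < (d + 2 choose 2)" by simp
  obtain i where i: "i \<le> 2" "x i \<noteq> 0" using assms(2) by (auto simp: nonzero_vecs_def)
  have "\<exists>l<(d + 2 choose 2). veronese_vec 2 d x l = x i ^ d"
  proof -
    consider "i = 0" | "i = 1" | "i = 2" using i by linarith
    then show ?thesis
      using veronese_monomial[of d 0 0 d] veronese_monomial[of 0 d 0 d] veronese_monomial[of 0 0 d d]
      by cases auto
  qed
  then obtain l where "l < (d + 2 choose 2)" "veronese_vec 2 d x l \<noteq> 0"
    using i(2) by (metis power_not_zero)
  moreover have "l \<le> N" if "l < (d + 2 choose 2)" for l using that assms(1) by linarith
  moreover have "veronese_vec 2 d x l = 0" if "l > N" for l using that assms(1) pos by (intro veronese_vec_0) linarith
  ultimately show ?thesis unfolding nonzero_vecs_def by blast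
qed

lemma veronese_variety_eq:
  assumes N: "N = (d + 2 choose 2) - 1"
  shows "veronese_variety 2 d = {cls N (veronese_vec 2 d y) | y :: nat \<Rightarrow> 'k::field. y \<in> nonzero_vecs 2}"
proof -
  have N': "(2 + d choose d) - 1 = N"
    using binomial_symmetric[of d "d + 2"] N by (simp add: add.commute)
  have v: "veronese 2 d (cls 2 y) = cls N (veronese_vec 2 d y)" if y: "y \<in> nonzero_vecs 2" for y :: "nat \<Rightarrow> 'k"
  proof -
    have "cls N (veronese_vec 2 d x) = cls N (veronese_vec 2 d y)" if "x \<in> cls 2 y" for x
    proof -
      from that obtain c where c: "c \<noteq> 0" "x = (\<lambda>i. c * y i)" using in_cls[OF y] by blast
      show ?thesis unfolding c(2) veronese_scale by (rule cls_eqI[OF veronese_nonzero[OF N y]]) (use c in simp)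
    qed
    then show ?thesis using cls_self[OF y] unfolding veronese_def N' by blast
  qed
  show ?thesis
  proof (intro set_eqI iffI)
    fix p :: "(nat \<Rightarrow> 'k) set" assume "p \<in> veronese_variety 2 d"
    then obtain q where "p = veronese 2 d q" "q \<in> proj_space 2" by (auto simp: veronese_variety_def)
    then obtain y where y: "y \<in> nonzero_vecs 2" "p = veronese 2 d (cls 2 y)"
      unfolding proj_space_iff by blast
    show "p \<in> {cls N (veronese_vec 2 d y) | y. y \<in> nonzero_vecs 2}"
      unfolding y(2) v[OF y(1)] using y(1) by blast
  next
    fix p :: "(nat \<Rightarrow> 'k) set" assume "p \<in> {cls N (veronese_vec 2 d y) | y. y \<in> nonzero_vecs 2}"
    then obtain y where y: "y \<in> nonzero_vecs 2" "p = cls N (veronese_vec 2 d y)" by blast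
    then have "p = veronese 2 d (cls 2 y)" using v[OF y(1)] by (simp only:)
    then show "p \<in> veronese_variety 2 d"
      unfolding veronese_variety_def using cls_in_proj_space[OF y(1)] by blast
  qed
qed

lemma linear_fun_add:
  assumes "f \<in> homfun (coords N) 1"
  shows "f (\<lambda>i. x i + y i) = f x + f y"
proof -
  have "f \<in> funs.span (coords N)" using assms by (simp only: homfun_1)
  then show ?thesis by (induction rule: span_fun_induct) (auto simp: coords_def algebra_simps)
qed

lemma linear_fun_scale:
  assumes "f \<in> homfun (coords N) 1"
  shows "f (\<lambda>i. c * x i) = c * f x"
  using coords_scale[OF assms, of c x] by simp

section \<open>Lines in the plane and their Veronese images\<close>

text \<open>The dual linear forms express that \<open>u\<close> and \<open>v\<close> are
  independent, invert the parametrization of the line through them, and extend binary forms to the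
  plane.\<close>

locale veronese_line =
  fixes d N :: nat and u v :: "nat \<Rightarrow> 'k::{alg_closed_field, field_char_0}" and g0 g1 :: "(nat \<Rightarrow> 'k) \<Rightarrow> 'k"
  assumes N: "N = (d + 2 choose 2) - 1" and d: "d > 0"
    and uv: "u \<in> nonzero_vecs 2" "v \<in> nonzero_vecs 2"
    and g: "g0 \<in> homfun (coords 2) 1" "g1 \<in> homfun (coords 2) 1"
    and dual: "g0 u = 1" "g0 v = 0" "g1 u = 0" "g1 v = 1"
begin

definition par :: "'k \<times> 'k \<Rightarrow> nat \<Rightarrow> 'k" where
  "par z = (\<lambda>i. fst z * u i + snd z * v i)"

abbreviation vpar :: "'k \<times> 'k \<Rightarrow> nat \<Rightarrow> 'k" where
  "vpar z \<equiv> veronese_vec 2 d (par z)"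

definition pt :: "'k \<times> 'k \<Rightarrow> (nat \<Rightarrow> 'k) set" where
  "pt z = cls N (vpar z)"

text \<open>The rational normal curve of degree \<open>d\<close>.\<close>

definition C :: "(nat \<Rightarrow> 'k) set set" where
  "C = {pt z | z. z \<noteq> (0, 0)}"

lemma C_iff: "p \<in> C \<longleftrightarrow> (\<exists>z. z \<noteq> (0, 0) \<and> p = pt z)"
  unfolding C_def by blast

lemma g_par: "g0 (par z) = fst z" "g1 (par z) = snd z"
proof -
  have "f (par z) = fst z * f u + snd z * f v" if "f \<in> homfun (coords 2) 1" for f
    unfolding par_def
    using linear_fun_add[OF that, of "\<lambda>i. fst z * u i" "\<lambda>i. snd z * v i"]
      linear_fun_scale[OF that, of "fst z" u] linear_fun_scale[OF that, of "snd z" v] by simp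
  from this[OF g(1)] this[OF g(2)] show "g0 (par z) = fst z" "g1 (par z) = snd z" using dual by simp_all
qed

lemma par_scale: "par (c * a, c * b) = (\<lambda>i. c * par (a, b) i)"
  by (simp add: par_def algebra_simps)

lemma par_nonzero:
  assumes "z \<noteq> (0, 0)" shows "par z \<in> nonzero_vecs 2"
proof (rule ccontr)
  assume n: "par z \<notin> nonzero_vecs 2"
  have "par z i = 0" if "i > 2" for i using uv that by (simp add: par_def nonzero_vecs_def)
  moreover have "par z i = 0" if "i \<le> 2" for i using n that calculation by (auto simp: nonzero_vecs_def)
  ultimately have "par z = (\<lambda>i. 0 * u i)" by (metis linorder_not_less mult_zero_left)
  then have "g0 (par z) = 0" "g1 (par z) = 0" using linear_fun_scale[OF g(1), of 0 u] linear_fun_scale[OF g(2), of 0 u] by simp_all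
  then show False using assms g_par by (simp add: prod_eq_iff)
qed

lemma veronese_par_nonzero: "z \<noteq> (0, 0) \<Longrightarrow> vpar z \<in> nonzero_vecs N"
  using veronese_nonzero[OF N par_nonzero] .

lemma pull_par:
  assumes "f \<in> homfun (coords 2) t" shows "(\<lambda>z. f (par z)) \<in> binary_forms t"
proof -
  have "\<exists>h\<in>binary_forms t. \<forall>z\<in>UNIV. f (par z) = h z"
  proof (rule homfun_transfer[OF assms])
    fix w :: "(nat \<Rightarrow> 'k) \<Rightarrow> 'k" assume "w \<in> coords 2"
    then obtain j where j: "w = (\<lambda>x. x j)" by (auto simp: coords_def)
    have "(\<lambda>z. u j * fst z + v j * snd z) \<in> funs.span {fst, snd}"
      by (intro span_add_fun funs.span_scale funs.span_base) auto
    then show "\<exists>h\<in>funs.span {fst, snd}. \<forall>z\<in>UNIV. w (par z) = h z"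
      by (intro bexI[of _ "\<lambda>z. u j * fst z + v j * snd z"]) (auto simp: j par_def)
  qed
  then obtain h where "h \<in> binary_forms t" "\<And>z. f (par z) = h z" by blast
  then show ?thesis by presburger
qed

lemma push_par:
  assumes "h \<in> binary_forms t" shows "\<exists>f\<in>homfun (coords 2) t. \<forall>z. f (par z) = h z"
proof -
  have "\<exists>f\<in>homfun (coords 2) t. \<forall>z\<in>UNIV. h z = f (par z)"
  proof (rule homfun_transfer[OF assms])
    fix w :: "'k \<times> 'k \<Rightarrow> 'k" assume "w \<in> {fst, snd}"
    then show "\<exists>f\<in>funs.span (coords 2). \<forall>z\<in>UNIV. w z = f (par z)"
      using g g_par homfun_1 by (metis insertE singletonD)
  qed
  then show ?thesis by (metis UNIV_I)
qed

lemma form_par: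
  assumes "f \<in> forms N t" shows "(\<lambda>z. peval f (vpar z)) \<in> binary_forms (d * t)"
  by (rule pull_par[OF veronese_pull[OF N peval_homfun[OF assms]]])

lemma par_form:
  assumes "h \<in> binary_forms (d * t)"
  shows "\<exists>f\<in>forms N t. \<forall>z. peval f (vpar z) = h z"
proof -
  obtain f1 where f1: "f1 \<in> homfun (coords 2) (d * t)" "\<forall>z. f1 (par z) = h z" using push_par[OF assms] by blast
  obtain f2 where f2: "f2 \<in> homfun (coords N) t" "\<forall>x. f2 (veronese_vec 2 d x) = f1 x" using veronese_push[OF N f1(1)] by blast
  obtain f where "f \<in> forms N t" "peval f = f2" using homfun_form[OF f2(1)] by blast
  then show ?thesis using f1 f2 by (intro bexI[of _ f]) auto
qed

text \<open>The Veronese map is injective on the line: \<open>lin_at z\<close> times a power of a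
  coordinate that is nonzero at \<open>w\<close> has degree \<open>d\<close> and so comes from a
  linear form of the ambient space; this form vanishes at \<open>pt z\<close>, and if
  \<open>pt w\<close> is the same point, \<open>lin_at z\<close> vanishes at
  \<open>w\<close>.\<close>

lemma pt_eq_iff:
  assumes "z \<noteq> (0, 0)" "w \<noteq> (0, 0)"
  shows "pt z = pt w \<longleftrightarrow> lin_at z w = 0"
proof
  assume "pt z = pt w"
  then obtain c where c: "c \<noteq> 0" "vpar w = (\<lambda>i. c * vpar z i)"
    using cls_eq_iff[OF veronese_par_nonzero[OF assms(1)] veronese_par_nonzero[OF assms(2)]] by (auto simp: pt_def)
  have "fst w \<noteq> 0 \<or> snd w \<noteq> 0" using assms(2) by (metis prod.collapse)
  then obtain m where m: "m \<in> {fst, snd}" "m w \<noteq> 0" by blast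
  have "(\<lambda>x. snd z * fst x + (- fst z) * snd x) \<in> funs.span {fst, snd}"
    by (intro span_add_fun funs.span_scale funs.span_base) auto
  then have lz: "lin_at z \<in> binary_forms 1" by (simp only: homfun_1) (simp add: lin_at_def)
  have "(\<lambda>x. lin_at z x * m x ^ (d - 1)) \<in> binary_forms (1 + 1 * (d - 1))"
    by (intro homfun_mult lz homfun_power homfun_base m)
  then have "(\<lambda>x. lin_at z x * m x ^ (d - 1)) \<in> binary_forms (d * 1)" using d by simp
  from par_form[OF this] obtain f where f: "f \<in> forms N 1"
    "\<And>x. peval f (vpar x) = lin_at z x * m x ^ (d - 1)" by blast
  have "lin_at z w * m w ^ (d - 1) = c ^ 1 * (lin_at z z * m z ^ (d - 1))"
    using forms_scale[OF f(1), of c "vpar z"] unfolding c(2)[symmetric] f(2) .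
  then show "lin_at z w = 0" using m(2) by (simp add: lin_at_def)
next
  assume l: "lin_at z w = 0"
  obtain z0 z1 w0 w1 where zw: "z = (z0, z1)" "w = (w0, w1)" by (cases z, cases w)
  have l': "z1 * w0 = z0 * w1" using l by (simp add: lin_at_def zw)
  obtain c where c: "w0 = c * z0" "w1 = c * z1"
  proof (cases "z0 = 0")
    case True
    then have "z1 \<noteq> 0" "w0 = 0" using assms(1) l' by (auto simp: zw)
    then show ?thesis using that[of "w1 / z1"] True by simp
  next
    case False
    then show ?thesis using that[of "w0 / z0"] l' by (simp add: field_simps)
  qed
  have "c \<noteq> 0" using assms(2) c by (auto simp: zw)
  have "vpar w = (\<lambda>j. c ^ d * vpar z j)"
    unfolding zw c par_scale veronese_scale ..
  then show "pt z = pt w"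
    using cls_eq_iff[OF veronese_par_nonzero[OF assms(1)] veronese_par_nonzero[OF assms(2)]] \<open>c \<noteq> 0\<close>
    unfolding pt_def by (metis power_not_zero)
qed

lemma pt_vanish_iff:
  assumes "f \<in> forms N t" "z \<noteq> (0, 0)"
  shows "(\<forall>y\<in>pt z. peval f y = 0) \<longleftrightarrow> peval f (vpar z) = 0"
  unfolding pt_def by (rule form_cls_iff[OF assms(1) veronese_par_nonzero[OF assms(2)]])

lemma reps_exist:
  assumes "A \<subseteq> C" "finite A"
  shows "\<exists>Z. finite Z \<and> card Z = card A \<and> (0, 0) \<notin> Z \<and> pt ` Z = A \<and>
    (\<forall>z\<in>Z. \<forall>w\<in>Z. z \<noteq> w \<longrightarrow> lin_at z w \<noteq> 0)"
proof -
  have "\<forall>p\<in>A. \<exists>z. z \<noteq> (0, 0) \<and> p = pt z" using assms(1) C_iff by blast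
  then obtain r where r: "\<And>p. p \<in> A \<Longrightarrow> r p \<noteq> (0, 0)" "\<And>p. p \<in> A \<Longrightarrow> pt (r p) = p" by metis
  have inj: "inj_on r A" using r(2) by (metis inj_on_def)
  show ?thesis
  proof (intro exI[of _ "r ` A"] conjI)
    show "card (r ` A) = card A" by (rule card_image[OF inj])
    show "(0, 0) \<notin> r ` A" using r(1) by force
    show "pt ` r ` A = A" using r(2) by (simp add: image_image)
    show "\<forall>z\<in>r ` A. \<forall>w\<in>r ` A. z \<noteq> w \<longrightarrow> lin_at z w \<noteq> 0"
      using pt_eq_iff r by (metis imageE)
  qed (use assms in simp)
qed

text \<open>The pullback to the line is a binary form of degree \<open>d * t\<close> with too many
  zeros.\<close>

lemma form_vanish_on_C:
  assumes f: "f \<in> forms N t" and A: "A \<subseteq> C" "finite A" "d * t < card A"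
    and van: "\<And>p y. p \<in> A \<Longrightarrow> y \<in> p \<Longrightarrow> peval f y = 0"
  shows "peval f (vpar z) = 0"
proof -
  obtain Z where Z: "finite Z" "card Z = card A" "(0, 0) \<notin> Z" "pt ` Z = A"
    "\<And>z w. z \<in> Z \<Longrightarrow> w \<in> Z \<Longrightarrow> z \<noteq> w \<Longrightarrow> lin_at z w \<noteq> 0" using reps_exist[OF A(1,2)] by blast
  show ?thesis
  proof (rule binary_vanish[OF form_par[OF f] Z(1)])
    fix w assume w: "w \<in> Z"
    then have "w \<noteq> (0, 0)" "pt w \<in> A" using Z by auto
    then show "peval f (vpar w) = 0" using pt_vanish_iff[OF f] van by blast
  qed (use Z A(3) in auto)
qed

lemma closed_infinite_eq_C:
  assumes A: "zariski_closed N A" "A \<subseteq> C" "infinite A"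
  shows "A = C"
proof
  show "C \<subseteq> A"
  proof
    fix p assume "p \<in> C"
    then obtain z where z: "z \<noteq> (0, 0)" "p = pt z" using C_iff by blast
    obtain F where F: "F \<subseteq> (\<Union>a. forms N a)" "A = zero_locus N F" using A(1) by (auto simp: zariski_closed_def)
    have "peval f (vpar z) = 0" if f: "f \<in> F" for f
    proof -
      obtain t where t: "f \<in> forms N t" using f F(1) by blast
      obtain A' where A': "A' \<subseteq> A" "finite A'" "card A' = Suc (d * t)"
        using infinite_arbitrarily_large[OF A(3)] by metis
      show ?thesis
      proof (rule form_vanish_on_C[OF t _ A'(2)])
        fix p y assume "p \<in> A'" "y \<in> p"
        then show "peval f y = 0" using A'(1) F(2) f by (auto simp: zero_locus_def)
      qed (use A' A(2) in auto)
    qed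
    then show "p \<in> A" unfolding F(2) z(2) pt_def
      using cls_in_zero_locus[OF F(1) veronese_par_nonzero[OF z(1)]] by blast
  qed
qed (rule A(2))

lemma infinite_C: "infinite C"
proof
  assume "finite C"
  have "inj (\<lambda>c. pt (1, c))"
    by (rule injI) (subst (asm) pt_eq_iff, auto simp: lin_at_def)
  moreover have "range (\<lambda>c. pt (1, c)) \<subseteq> C" using C_iff by (metis image_subsetI prod.inject zero_neq_one)
  ultimately have "finite (UNIV :: 'k set)" using \<open>finite C\<close> finite_subset finite_imageD by metis
  then show False using infinite_UNIV_char_0 by blast
qed

lemma irreducible_C:
  assumes "zariski_closed N C" shows "irreducible_closed N C"
  unfolding irreducible_closed_def
proof (intro conjI allI impI)
  show "C \<noteq> {}" using infinite_C by auto
  fix A B assume AB: "zariski_closed N A \<and> zariski_closed N B \<and> C = A \<union> B"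
  then have "infinite A \<or> infinite B" using infinite_C by (metis finite_Un)
  then show "C = A \<or> C = B" using closed_infinite_eq_C AB by (metis sup_ge1 sup_ge2)
qed (rule assms)

text \<open>The chain consists of a point and the whole curve. A lower bound is enough to exclude
  \<open>r = N\<close> when \<open>X\<close> is the curve.\<close>

lemma proj_dim_C:
  assumes "zariski_closed N C" shows "proj_dim N C \<ge> 1"
proof -
  have p: "pt (1, 0) \<in> C" using C_iff by (metis prod.inject zero_neq_one)
  then have "pt (1, 0) \<in> proj_space N" using zariski_closed_subset[OF assms] by blast
  then have irr: "irreducible_closed N {pt (1, 0)}" by (rule irreducible_closed_sing)
  define Z where "Z = (\<lambda>i::nat. if i = 0 then {pt (1, 0)} else C)"
  have "{pt (1, 0)} \<noteq> C" using infinite_C by (metis finite.emptyI finite_insert)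
  then have "(\<forall>i\<le>1. irreducible_closed N (Z i) \<and> Z i \<subseteq> C) \<and> (\<forall>i<1. Z i \<subset> Z (Suc i))"
    using p irr irreducible_C[OF assms] by (auto simp: Z_def)
  then have "enat 1 \<le> proj_dim N C" unfolding proj_dim_def by (intro Sup_upper) blast
  then show ?thesis by (simp add: one_enat_def)
qed

end

section \<open>Conics\<close>

lemma square_root_exists: "\<exists>y::'k::alg_closed_field. y\<^sup>2 = x"
  using nth_root_exists[of 2 x] by auto

lemma quadratic_values:
  assumes "f \<in> binary_forms 2"
  shows "f (s, t) = s\<^sup>2 * f (1, 0) + s * t * (f (1, 1) - f (1, 0) - f (0, 1)) + t\<^sup>2 * (f (0, 1) :: 'k::field)"
proof -
  from homfun2_monomials[OF assms] show ?thesis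
  proof (induction rule: span_fun_induct)
    case zero
    show ?case by simp
  next
    case (add f g)
    then show ?case by (simp add: algebra_simps)
  next
    case (base c b)
    then obtain i where "b = (\<lambda>x. fst x ^ i * snd x ^ (2 - i))" "i \<le> 2" by auto
    moreover then have "i = 0 \<or> i = 1 \<or> i = 2" by linarith
    ultimately show ?case by (auto simp: power2_eq_square)
  qed
qed

text \<open>Adding \<open>c\<close> to all coordinates, each of the two conditions fails for only
  one \<open>c\<close>, so \<open>F\<close> restricts to a univariate polynomial with infinitely
  many zeros.\<close>

lemma polyfun_vanish:
  fixes F :: "(nat \<Rightarrow> 'k::field_char_0) \<Rightarrow> 'k"
  assumes "F \<in> polyfun (coords N)" "\<And>w. w 0 \<noteq> 0 \<Longrightarrow> w 2 \<noteq> 0 \<Longrightarrow> F w = 0"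
  shows "F w = 0"
proof -
  have "\<exists>p. \<forall>c. F (\<lambda>i. w i + c) = poly p c"
  proof (rule polyfun_poly[OF assms(1)])
    fix u :: "(nat \<Rightarrow> 'k) \<Rightarrow> 'k" assume "u \<in> coords N"
    then obtain j where "u = (\<lambda>x. x j)" by (auto simp: coords_def)
    then show "\<exists>p. \<forall>c. u (\<lambda>i. w i + c) = poly p c" by (intro exI[of _ "[:w j, 1:]"]) simp
  qed
  then obtain p where p: "\<And>c. F (\<lambda>i. w i + c) = poly p c" by blast
  have "p = 0"
  proof (rule ccontr)
    assume "p \<noteq> 0"
    then have "finite ({c. poly p c = 0} \<union> {- w 0, - w 2})" using poly_roots_finite by blast
    then obtain c where "c \<notin> {c. poly p c = 0} \<union> {- w 0, - w 2}"
      using ex_new_if_finite[OF infinite_UNIV_char_0] by blast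
    then have "poly p c \<noteq> 0" "w 0 + c \<noteq> 0" "w 2 + c \<noteq> 0" by (auto simp: add_eq_0_iff)
    then show False using assms(2)[of "\<lambda>i. w i + c"] p[of c] by simp
  qed
  then show ?thesis using p[of 0] by simp
qed

text \<open>Modulo \<open>x\<^sub>0 x\<^sub>2 - x\<^sub>1\<^sup>2\<close> every polynomial is \<open>A + x\<^sub>1 B\<close> with \<open>A\<close>, \<open>B\<close> free of \<open>x\<^sub>1\<close>; the
  substitutions \<open>(s\<^sup>2, \<plusminus>st, t\<^sup>2)\<close> show that \<open>A\<close> and \<open>B\<close> vanish.\<close>

lemma conic_divides:
  fixes F :: "(nat \<Rightarrow> 'k::{alg_closed_field, field_char_0}) \<Rightarrow> 'k"
  assumes F: "F \<in> polyfun (coords 2)"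
    and van: "\<And>s t. (s, t) \<noteq> (0, 0) \<Longrightarrow> F (\<lambda>i. if i = 0 then s\<^sup>2 else if i = 1 then s * t else t\<^sup>2) = 0"
  shows "\<exists>H\<in>polyfun (coords 2). \<forall>w. F w = (w 0 * w 2 - (w 1)\<^sup>2) * H w"
proof -
  let ?U = "{\<lambda>x. x 0, \<lambda>x. x 2} :: ((nat \<Rightarrow> 'k) \<Rightarrow> 'k) set"
  have sub: "A \<in> polyfun (coords 2)" if "A \<in> polyfun ?U" for A
    using polyfun_comp[OF that, of "\<lambda>x. x" "coords 2"] by (auto simp: coords_2 intro: polyfun.base)
  have dep: "A w = A w'" if "A \<in> polyfun ?U" "w 0 = w' 0" "w 2 = w' 2" for A w w'
    using that(1) by induction (use that in auto)
  have vars: "(\<lambda>x. x 0) \<in> polyfun (coords 2)" "(\<lambda>x. x 1) \<in> polyfun (coords 2)" "(\<lambda>x. x 2) \<in> polyfun (coords 2)"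
    by (auto simp: coords_2 intro: polyfun.base)
  have "\<exists>A\<in>polyfun ?U. \<exists>B\<in>polyfun ?U. \<exists>H\<in>polyfun (coords 2).
      \<forall>w. F w = A w + w 1 * B w + (w 0 * w 2 - (w 1)\<^sup>2) * H w"
    using F
  proof induction
    case (const c)
    show ?case
      by (rule bexI[of _ "\<lambda>x. c"], rule bexI[of _ "\<lambda>x. 0"], rule bexI[of _ "\<lambda>x. 0"]) (auto intro: polyfun.const)
  next
    case (base u)
    then consider "u = (\<lambda>x. x 0)" | "u = (\<lambda>x. x 1)" | "u = (\<lambda>x. x 2)" by (auto simp: coords_2)
    then show ?case
    proof cases
      case 1
      then show ?thesis
        by (intro bexI[of _ u] bexI[of _ "\<lambda>x. 0"]) (auto intro: polyfun.const polyfun.base)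
    next
      case 2
      then show ?thesis
        by (intro bexI[of _ "\<lambda>x. 0" "polyfun ?U"] bexI[of _ "\<lambda>x. 1"] bexI[of _ "\<lambda>x. 0" "polyfun (coords 2)"])
          (auto intro: polyfun.const)
    next
      case 3
      then show ?thesis
        by (intro bexI[of _ u] bexI[of _ "\<lambda>x. 0"]) (auto intro: polyfun.const polyfun.base)
    qed
  next
    case (add f g)
    then obtain A B H A' B' H' where AB:
      "A \<in> polyfun ?U" "B \<in> polyfun ?U" "H \<in> polyfun (coords 2)" "\<And>w. f w = A w + w 1 * B w + (w 0 * w 2 - (w 1)\<^sup>2) * H w"
      "A' \<in> polyfun ?U" "B' \<in> polyfun ?U" "H' \<in> polyfun (coords 2)" "\<And>w. g w = A' w + w 1 * B' w + (w 0 * w 2 - (w 1)\<^sup>2) * H' w"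
      by blast
    show ?case
    proof (rule bexI[of _ "\<lambda>x. A x + A' x"], rule bexI[of _ "\<lambda>x. B x + B' x"],
        rule bexI[of _ "\<lambda>x. H x + H' x"], rule allI)
      fix w
      show "f w + g w = (A w + A' w) + w 1 * (B w + B' w) + (w 0 * w 2 - (w 1)\<^sup>2) * (H w + H' w)"
        unfolding AB(4,8) by (simp add: algebra_simps)
    qed (intro polyfun.add AB)+
  next
    case (mult f g)
    then obtain A B H A' B' H' where
      AB: "A \<in> polyfun ?U" "B \<in> polyfun ?U" "H \<in> polyfun (coords 2)" "\<And>w. f w = A w + w 1 * B w + (w 0 * w 2 - (w 1)\<^sup>2) * H w"
      "A' \<in> polyfun ?U" "B' \<in> polyfun ?U" "H' \<in> polyfun (coords 2)" "\<And>w. g w = A' w + w 1 * B' w + (w 0 * w 2 - (w 1)\<^sup>2) * H' w"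
      by blast
    have gp: "g \<in> polyfun (coords 2)" using mult by simp
    have v: "(\<lambda>x. x 0) \<in> polyfun ?U" "(\<lambda>x. x 2) \<in> polyfun ?U" by (auto intro: polyfun.base)
    \<comment> \<open>The term with \<open>x 1\<close> squared is rewritten by
      \<open>(x 1)^2 = x 0 * x 2 - (x 0 * x 2 - (x 1)^2)\<close>: the first part joins the component
      free of \<open>x 1\<close>, the second gives the summand \<open>- B * B'\<close> of the
      multiple of the conic.\<close>
    show ?case
    proof (rule bexI[of _ "\<lambda>x. A x * A' x + x 0 * (x 2 * (B x * B' x))"],
        rule bexI[of _ "\<lambda>x. A x * B' x + B x * A' x"],
        rule bexI[of _ "\<lambda>x. H x * g x + ((A x + x 1 * B x) * H' x + (-1) * (B x * B' x))"], rule allI)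
      show "(\<lambda>x. A x * A' x + x 0 * (x 2 * (B x * B' x))) \<in> polyfun ?U"
        by (intro polyfun.add polyfun.mult AB v)
      show "(\<lambda>x. A x * B' x + B x * A' x) \<in> polyfun ?U"
        by (intro polyfun.add polyfun.mult AB)
      show "(\<lambda>x. H x * g x + ((A x + x 1 * B x) * H' x + (-1) * (B x * B' x))) \<in> polyfun (coords 2)"
        by (intro polyfun.add polyfun.mult polyfun.const AB sub vars gp)
      fix w
      show "f w * g w = (A w * A' w + w 0 * (w 2 * (B w * B' w))) + w 1 * (A w * B' w + B w * A' w) +
          (w 0 * w 2 - (w 1)\<^sup>2) * (H w * g w + ((A w + w 1 * B w) * H' w + (-1) * (B w * B' w)))"
        unfolding AB(4,8) by (simp add: algebra_simps power2_eq_square)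
    qed
  qed
  then obtain A B H where AB: "A \<in> polyfun ?U" "B \<in> polyfun ?U" "H \<in> polyfun (coords 2)"
    "\<And>w. F w = A w + w 1 * B w + (w 0 * w 2 - (w 1)\<^sup>2) * H w" by blast
  \<comment> \<open>Nonzero \<open>w 0\<close> and \<open>w 2\<close> make \<open>s * t\<close>
    invertible. The values at \<open>(s, t)\<close> and \<open>(- s, t)\<close> then separate
    \<open>A\<close> from \<open>B\<close>, as 2 is invertible; \<open>polyfun_vanish\<close> lifts
    the restriction on \<open>w\<close> afterwards.\<close>
  have zero: "A w = 0 \<and> B w = 0" if w: "w 0 \<noteq> 0" "w 2 \<noteq> 0" for w
  proof -
    obtain s t where st: "s\<^sup>2 = w 0" "t\<^sup>2 = w 2" using square_root_exists by metis
    then have nz: "s \<noteq> 0" "t \<noteq> 0" using w by auto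
    define W where "W = (\<lambda>s::'k. \<lambda>i::nat. if i = 0 then s\<^sup>2 else if i = 1 then s * t else t\<^sup>2)"
    have A: "A (W e) = A w" "B (W e) = B w" if "e\<^sup>2 = w 0" for e
      using that st by (auto intro!: dep[OF AB(1)] dep[OF AB(2)] simp: W_def)
    have F0: "A (W e) + e * t * B (W e) = 0" if "e \<noteq> 0" for e
    proof -
      have "F (W e) = 0" unfolding W_def using that by (intro van) simp
      moreover have "F (W e) = A (W e) + e * t * B (W e)"
        unfolding AB(4) by (simp add: W_def power_mult_distrib)
      ultimately show ?thesis by simp
    qed
    have e1: "A w + s * t * B w = 0" using F0[of s] A[of s] st nz by simp
    have e2: "A w + (- s) * t * B w = 0" using F0[of "- s"] A[of "- s"] st nz by simp
    have "2 * A w = (A w + s * t * B w) + (A w + (- s) * t * B w)" by simp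
    also have "\<dots> = 0" by (simp only: e1 e2 add_0)
    finally have "2 * A w = 0" .
    then have "A w = 0" by simp
    then show ?thesis using e1 nz by simp
  qed
  have "A w = 0" "B w = 0" for w
    using polyfun_vanish[OF sub[OF AB(1)]] polyfun_vanish[OF sub[OF AB(2)]] zero by blast+
  then show ?thesis using AB(3,4) by (intro bexI[of _ H]) auto
qed

lemma vanishing_ideal_add:
  "f \<in> vanishing_ideal N X \<Longrightarrow> g \<in> vanishing_ideal N X \<Longrightarrow> f + g \<in> vanishing_ideal N X"
  by (auto simp: vanishing_ideal_def intro: poly_ring_add)

lemma vanishing_ideal_mult:
  "f \<in> vanishing_ideal N X \<Longrightarrow> g \<in> poly_ring N \<Longrightarrow> g * f \<in> vanishing_ideal N X"
  by (auto simp: vanishing_ideal_def intro: poly_ring_mult)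

lemma ideal_gen_subset_vanishing:
  assumes "F \<subseteq> vanishing_ideal N X" shows "ideal_gen N F \<subseteq> vanishing_ideal N X"
proof
  fix f assume "f \<in> ideal_gen N F"
  then show "f \<in> vanishing_ideal N X"
  proof (induction rule: ideal_gen_induct)
    case zero
    show ?case by (simp add: vanishing_ideal_def)
  qed (use assms in \<open>auto intro: vanishing_ideal_add vanishing_ideal_mult\<close>)
qed

context veronese_line
begin

lemma C_subset_veronese: "C \<subseteq> veronese_variety 2 d"
  unfolding veronese_variety_eq[OF N] C_def pt_def using par_nonzero by blast

text \<open>Binary quadratic forms have the three coefficients \<open>a\<close>, \<open>b\<close>,
  \<open>c\<close> of \<open>s^2\<close>, \<open>s t\<close>, \<open>t^2\<close>, so the curve lies
  in a plane with these coordinates and equation \<open>a c = b^2\<close>. For the ideals, a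
  polynomial vanishing on the curve is restricted to the plane and divided there by the equation;
  after extending the quotient to the ambient space, the remainder vanishes on the plane.\<close>

lemma conic_C:
  assumes d2: "d = 2"
  shows "conic N C"
proof -
  define nu where "nu = (\<lambda>s t. veronese_vec 2 d (par (s, t)))"
  \<comment> \<open>By polarization, the coefficient of \<open>s t\<close> in
    \<open>nu s t\<close>.\<close>
  define b1 where "b1 = (\<lambda>j. nu 1 1 j - nu 1 0 j - nu 0 1 j)"
  define cb where "cb = (\<lambda>a b c j. a * nu 1 0 j + (b * b1 j + c * nu 0 1 j))"
  have nu_cb: "nu s t = cb (s\<^sup>2) (s * t) (t\<^sup>2)" for s t
  proof
    fix j
    show "nu s t j = cb (s\<^sup>2) (s * t) (t\<^sup>2) j"
    proof (cases "j < (d + 2 choose 2)")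
      case True
      have "(\<lambda>z. vpar z j) \<in> binary_forms 2"
        using pull_par[OF veronese_coord[OF True]] d2 by simp
      from quadratic_values[OF this] show ?thesis by (simp add: nu_def cb_def b1_def algebra_simps)
    next
      case False
      then show ?thesis by (simp add: nu_def cb_def b1_def veronese_vec_0)
    qed
  qed
  have lin: "peval l (cb a b c) = a * peval l (nu 1 0) + b * peval l b1 + c * peval l (nu 0 1)"
    if "l \<in> forms N 1" for l a b c
  proof -
    note L = peval_homfun[OF that]
    show ?thesis unfolding cb_def
      using linear_fun_add[OF L, of "\<lambda>j. a * nu 1 0 j" "\<lambda>j. b * b1 j + c * nu 0 1 j"]
        linear_fun_add[OF L, of "\<lambda>j. b * b1 j" "\<lambda>j. c * nu 0 1 j"]
        linear_fun_scale[OF L, of a "nu 1 0"] linear_fun_scale[OF L, of b b1] linear_fun_scale[OF L, of c "nu 0 1"]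
      by simp
  qed
  have b1v: "peval l b1 = peval l (nu 1 1) - peval l (nu 1 0) - peval l (nu 0 1)" if "l \<in> forms N 1" for l
    using lin[OF that, of 1 1 1] nu_cb[of 1 1] by simp
  have m: "(\<lambda>z. fst z * fst z) \<in> binary_forms (d * 1)" "(\<lambda>z. fst z * snd z) \<in> binary_forms (d * 1)"
    "(\<lambda>z. snd z * snd z) \<in> binary_forms (d * 1)"
  proof -
    have dd: "d * 1 = 1 + 1" using d2 by simp
    show "(\<lambda>z. fst z * fst z) \<in> binary_forms (d * 1)" "(\<lambda>z. fst z * snd z) \<in> binary_forms (d * 1)"
      "(\<lambda>z. snd z * snd z) \<in> binary_forms (d * 1)"
      unfolding dd by (intro homfun_mult homfun_base insertI1 insertI2)+
  qed
  obtain l0 where l0: "l0 \<in> forms N 1" "\<And>z. peval l0 (vpar z) = fst z * fst z"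
    using par_form[OF m(1)] by blast
  obtain l1 where l1: "l1 \<in> forms N 1" "\<And>z. peval l1 (vpar z) = fst z * snd z"
    using par_form[OF m(2)] by blast
  obtain l2 where l2: "l2 \<in> forms N 1" "\<And>z. peval l2 (vpar z) = snd z * snd z"
    using par_form[OF m(3)] by blast
  have lcb: "peval l0 (cb a b c) = a" "peval l1 (cb a b c) = b" "peval l2 (cb a b c) = c" for a b c
    by (simp_all add: lin[OF l0(1)] lin[OF l1(1)] lin[OF l2(1)] b1v[OF l0(1)] b1v[OF l1(1)] b1v[OF l2(1)])
       (simp_all add: nu_def l0(2) l1(2) l2(2))
  have cb0: "cb a b c = (\<lambda>i. 0) \<longrightarrow> a = 0 \<and> b = 0 \<and> c = 0" for a b c
  proof
    assume z: "cb a b c = (\<lambda>i. 0)"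
    have "peval l (\<lambda>i. 0) = 0" if "l \<in> forms N 1" for l :: "'k mpoly"
      using forms_scale[OF that, of 0 "\<lambda>i. 0"] by simp
    then show "a = 0 \<and> b = 0 \<and> c = 0" using lcb[of a b c] l0(1) l1(1) l2(1) unfolding z by simp
  qed
  have cbnz: "cb a b c \<in> nonzero_vecs N" if "(a, b, c) \<noteq> (0, 0, 0)" for a b c
  proof -
    have N1: "N + 1 = (d + 2 choose 2)" using N by simp
    have z: "cb a b c j = 0" if "j > N" for j
      using that N1 by (simp add: cb_def b1_def nu_def veronese_vec_0)
    have "cb a b c \<noteq> (\<lambda>i. 0)" using cb0[of a b c] that by blast
    then obtain j where j: "cb a b c j \<noteq> 0" by (auto simp only: fun_eq_iff)
    then have "j \<le> N" using z by (meson linorder_not_less)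
    then show ?thesis using z j by (auto simp: nonzero_vecs_def)
  qed
  define P where "P = {cls N (\<lambda>i. a * nu 1 0 i + b * b1 i + c * nu 0 1 i) | a b c. (a, b, c) \<noteq> (0, 0, 0)}"
  have P_eq: "P = {cls N (cb a b c) | a b c. (a, b, c) \<noteq> (0, 0, 0)}"
    by (simp add: P_def cb_def add.assoc)
  have "plane N P"
    unfolding plane_def
  proof (intro exI conjI)
    have "cb 1 0 0 = nu 1 0" "cb 0 1 0 = b1" "cb 0 0 1 = nu 0 1" by (auto simp: cb_def)
    then show "{nu 1 0, b1, nu 0 1} \<subseteq> nonzero_vecs N"
      using cbnz[of 1 0 0] cbnz[of 0 1 0] cbnz[of 0 0 1] by simp
    show "\<forall>a b c. (\<lambda>i. a * nu 1 0 i + b * b1 i + c * nu 0 1 i) = (\<lambda>i. 0) \<longrightarrow> a = 0 \<and> b = 0 \<and> c = 0"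
      using cb0 by (simp add: cb_def add.assoc)
  qed (rule P_def)
  have "(\<lambda>x. peval l0 x * peval l2 x + (-1) * (peval l1 x * peval l1 x)) \<in> homfun (coords N) (1 + 1)"
    by (intro homfun_closed(2,3) homfun_mult peval_homfun l0 l1 l2)
  from homfun_form[OF this] obtain q where q: "q \<in> forms N 2"
    "\<And>x. peval q x = peval l0 x * peval l2 x + (-1) * (peval l1 x * peval l1 x)"
    by (metis one_add_one)
  have qcb: "peval q (cb a b c) = a * c - b * b" for a b c by (simp add: q(2) lcb)
  have vanP: "f \<in> vanishing_ideal N P \<longleftrightarrow> f \<in> poly_ring N \<and> (\<forall>a b c. (a, b, c) \<noteq> (0, 0, 0) \<longrightarrow> peval f (cb a b c) = 0)" for f
  proof
    assume f: "f \<in> vanishing_ideal N P"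
    have "peval f (cb a b c) = 0" if "(a, b, c) \<noteq> (0, 0, 0)" for a b c
    proof -
      have "cls N (cb a b c) \<in> P" using that P_eq by blast
      moreover have "cb a b c \<in> cls N (cb a b c)" by (rule cls_self[OF cbnz[OF that]])
      ultimately show ?thesis using f unfolding vanishing_ideal_def by blast
    qed
    then show "f \<in> poly_ring N \<and> (\<forall>a b c. (a, b, c) \<noteq> (0, 0, 0) \<longrightarrow> peval f (cb a b c) = 0)"
      using f by (simp add: vanishing_ideal_def)
  next
    assume f: "f \<in> poly_ring N \<and> (\<forall>a b c. (a, b, c) \<noteq> (0, 0, 0) \<longrightarrow> peval f (cb a b c) = 0)"
    have "peval f y = 0" if "p \<in> P" "y \<in> p" for p y
    proof -
      from that(1) obtain a b c where abc: "(a, b, c) \<noteq> (0, 0, 0)" "p = cls N (cb a b c)" using P_eq by blast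
      from that(2) obtain e where e: "e \<noteq> 0" "y = (\<lambda>i. e * cb a b c i)"
        using in_cls[OF cbnz[OF abc(1)]] unfolding abc(2) by blast
      have "y = cb (e * a) (e * b) (e * c)" unfolding e(2) by (simp add: cb_def algebra_simps)
      moreover have "(e * a, e * b, e * c) \<noteq> (0, 0, 0)" using abc(1) e(1) by simp
      ultimately show ?thesis using f by blast
    qed
    then show "f \<in> vanishing_ideal N P" using f by (simp add: vanishing_ideal_def)
  qed
  have "q \<notin> vanishing_ideal N P"
  proof
    assume "q \<in> vanishing_ideal N P"
    then have "\<forall>a b c. (a, b, c) \<noteq> (0, 0, 0) \<longrightarrow> peval q (cb a b c) = 0" using vanP[of q] by simp
    from this[rule_format, of 0 1 0] have "peval q (cb 0 1 0) = 0" by simp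
    then show False using qcb[of 0 1 0] by simp
  qed
  have nz2: "(s\<^sup>2, s * t, t\<^sup>2) \<noteq> (0, 0, 0)" if "(s, t) \<noteq> (0, 0)" for s t :: 'k using that by auto
  have pt_cb: "pt (s, t) = cls N (cb (s\<^sup>2) (s * t) (t\<^sup>2))" for s t
    unfolding pt_def nu_cb[symmetric] nu_def ..
  have qzero: "{q} \<subseteq> (\<Union>a. forms N a)" using q(1) by blast
  have CP: "C \<subseteq> P"
  proof
    fix p assume "p \<in> C"
    then obtain s t where "(s, t) \<noteq> (0, 0)" "p = pt (s, t)" using C_iff by (metis prod.collapse)
    then show "p \<in> P" using P_eq pt_cb nz2 by blast
  qed
  have C_eq: "C = P \<inter> zero_locus N {q}"
  proof (intro set_eqI iffI)
    fix p assume p: "p \<in> C"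
    then obtain s t where st: "(s, t) \<noteq> (0, 0)" "p = pt (s, t)" using C_iff by (metis prod.collapse)
    have "p \<in> zero_locus N {q}" unfolding st(2) pt_cb
      using cls_in_zero_locus[OF qzero cbnz[OF nz2[OF st(1)]]] qcb by (simp add: power2_eq_square)
    then show "p \<in> P \<inter> zero_locus N {q}" using CP p by blast
  next
    fix p assume p: "p \<in> P \<inter> zero_locus N {q}"
    then obtain a b c where abc: "(a, b, c) \<noteq> (0, 0, 0)" "p = cls N (cb a b c)" using P_eq by blast
    have "peval q (cb a b c) = 0"
      using p cls_in_zero_locus[OF qzero cbnz[OF abc(1)]] unfolding abc(2) by simp
    then have eq: "a * c = b * b" using qcb by simp
    obtain s t where st: "a = s\<^sup>2" "b = s * t" "c = t\<^sup>2"
    proof (cases "a = 0")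
      case True
      then have "b = 0" using eq by simp
      obtain t where "t\<^sup>2 = c" using square_root_exists by blast
      then show ?thesis using that[of 0 t] True \<open>b = 0\<close> by simp
    next
      case False
      obtain s where s: "s\<^sup>2 = a" using square_root_exists by blast
      then have "s \<noteq> 0" using False by auto
      then show ?thesis using that[of s "b / s"] s eq False by (simp add: power_divide field_simps power2_eq_square)
    qed
    have "(s, t) \<noteq> (0, 0)" using abc(1) st by auto
    then show "p \<in> C" using C_iff pt_cb abc(2) st by blast
  qed
  have "vanishing_ideal N C = ideal_gen N (vanishing_ideal N P \<union> {q})"
  proof
    have "vanishing_ideal N P \<subseteq> vanishing_ideal N C" using CP by (auto simp: vanishing_ideal_def)
    moreover have "q \<in> vanishing_ideal N C"
      using C_eq forms_poly_ring[OF q(1)] by (auto simp: vanishing_ideal_def zero_locus_def)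
    ultimately show "ideal_gen N (vanishing_ideal N P \<union> {q}) \<subseteq> vanishing_ideal N C"
      by (intro ideal_gen_subset_vanishing) simp
    show "vanishing_ideal N C \<subseteq> ideal_gen N (vanishing_ideal N P \<union> {q})"
    proof
      fix f assume f: "f \<in> vanishing_ideal N C"
      then have fr: "f \<in> poly_ring N" by (simp add: vanishing_ideal_def)
      define phi where "phi = (\<lambda>w::nat\<Rightarrow>'k. cb (w 0) (w 1) (w 2))"
      have vars: "(\<lambda>x. x 0) \<in> polyfun (coords 2)" "(\<lambda>x. x 1) \<in> polyfun (coords 2)" "(\<lambda>x. x 2) \<in> polyfun (coords 2)"
        by (auto simp: coords_2 intro: polyfun.base)
      have F: "(\<lambda>w. peval f (phi w)) \<in> polyfun (coords 2)"
      proof (rule polyfun_comp[OF peval_polyfun[OF fr]])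
        fix u :: "(nat \<Rightarrow> 'k) \<Rightarrow> 'k" assume "u \<in> coords N"
        then obtain j where "u = (\<lambda>x. x j)" by (auto simp: coords_def)
        then show "(\<lambda>w. u (phi w)) \<in> polyfun (coords 2)"
          unfolding phi_def cb_def by (simp only:) (intro polyfun.add polyfun.mult polyfun.const vars)
      qed
      have "\<exists>H\<in>polyfun (coords 2). \<forall>w. peval f (phi w) = (w 0 * w 2 - (w 1)\<^sup>2) * H w"
      proof (rule conic_divides[OF F])
        fix s t :: 'k assume st: "(s, t) \<noteq> (0, 0)"
        have "pt (s, t) \<in> C" using st C_iff by blast
        moreover have "cb (s\<^sup>2) (s * t) (t\<^sup>2) \<in> pt (s, t)"
          unfolding pt_cb by (rule cls_self[OF cbnz[OF nz2[OF st]]])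
        ultimately have "peval f (cb (s\<^sup>2) (s * t) (t\<^sup>2)) = 0"
          using f unfolding vanishing_ideal_def by blast
        then show "peval f (phi (\<lambda>i. if i = 0 then s\<^sup>2 else if i = 1 then s * t else t\<^sup>2)) = 0"
          by (simp add: phi_def)
      qed
      then obtain H where H: "H \<in> polyfun (coords 2)" "\<And>w. peval f (phi w) = (w 0 * w 2 - (w 1)\<^sup>2) * H w" by blast
      \<comment> \<open>Linear forms of the ambient space that read off the coordinates in the
        plane; composition with them extends the quotient \<open>H\<close> beyond the plane.\<close>
      define lam where "lam = (\<lambda>x (i::nat). if i = 0 then peval l0 x else if i = 1 then peval l1 x else peval l2 x)"
      have "(\<lambda>x. H (lam x)) \<in> polyfun (coords N)"
      proof (rule polyfun_comp[OF H(1)])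
        fix u :: "(nat \<Rightarrow> 'k) \<Rightarrow> 'k" assume "u \<in> coords 2"
        then have "u = (\<lambda>x. x 0) \<or> u = (\<lambda>x. x 1) \<or> u = (\<lambda>x. x 2)" by (simp add: coords_2)
        moreover have "peval l0 \<in> polyfun (coords N)" "peval l1 \<in> polyfun (coords N)" "peval l2 \<in> polyfun (coords N)"
          using l0(1) l1(1) l2(1) forms_poly_ring peval_polyfun by blast+
        ultimately show "(\<lambda>x. u (lam x)) \<in> polyfun (coords N)"
          by (auto simp: lam_def)
      qed
      from polyfun_poly_ring[OF this] obtain h where h: "h \<in> poly_ring N" "\<And>x. peval h x = H (lam x)" by metis
      have HH: "peval f (cb a b c) = (a * c - b * b) * peval h (cb a b c)" for a b c
      proof -
        define w where "w = (\<lambda>i::nat. if i = 0 then a else if i = 1 then b else c)"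
        have "lam (cb a b c) = w" by (auto simp: lam_def w_def lcb)
        moreover have "phi w = cb a b c" by (simp add: phi_def w_def)
        ultimately show ?thesis using H(2)[of w] h(2)[of "cb a b c"] by (simp add: w_def power2_eq_square)
      qed
      define f' where "f' = f + pconst (-1) * (h * q)"
      have f'r: "f' \<in> poly_ring N" unfolding f'_def
        by (intro poly_ring_add poly_ring_mult poly_ring_const fr h forms_poly_ring[OF q(1)])
      have "peval f' (cb a b c) = 0" for a b c
      proof -
        have "peval f' (cb a b c) = peval f (cb a b c) + (- 1) * (peval h (cb a b c) * peval q (cb a b c))"
          unfolding f'_def peval_add peval_mult peval_const ..
        then show ?thesis unfolding HH qcb by simp
      qed
      then have f'P: "f' \<in> vanishing_ideal N P" using vanP[of f'] f'r by blast
      have "f = f' + h * q"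
        by (simp add: f'_def single_uminus)
      moreover have "f' + h * q \<in> ideal_gen N (vanishing_ideal N P \<union> {q})"
        using f'P by (intro ideal_gen_add ideal_gen_mult[OF _ h(1)] ideal_gen_base) auto
      ultimately show "f \<in> ideal_gen N (vanishing_ideal N P \<union> {q})" by simp
    qed
  qed
  then show ?thesis
    unfolding conic_def using \<open>plane N P\<close> q(1) \<open>q \<notin> vanishing_ideal N P\<close> C_eq
    by (intro exI[of _ P] exI[of _ q] conjI)
qed

end

section \<open>Complete intersections on the Veronese surface\<close>

lemma sorted_nth_le_iff:
  fixes a :: "nat list"
  assumes "sorted a" "i < length a"
  shows "a ! i \<le> k \<longleftrightarrow> i < card {j. j < length a \<and> a ! j \<le> k}"
proof
  assume "a ! i \<le> k"
  then have "{..i} \<subseteq> {j. j < length a \<and> a ! j \<le> k}"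
    using assms sorted_nth_mono[OF assms(1)] by fastforce
  then have "card {..i} \<le> card {j. j < length a \<and> a ! j \<le> k}" by (intro card_mono) auto
  then show "i < card {j. j < length a \<and> a ! j \<le> k}" by simp
next
  assume l: "i < card {j. j < length a \<and> a ! j \<le> k}"
  show "a ! i \<le> k"
  proof (rule ccontr)
    assume n: "\<not> a ! i \<le> k"
    have "{j. j < length a \<and> a ! j \<le> k} \<subseteq> {..<i}"
    proof
      fix j assume j: "j \<in> {j. j < length a \<and> a ! j \<le> k}"
      show "j \<in> {..<i}"
      proof (rule ccontr)
        assume "j \<notin> {..<i}"
        then have "a ! i \<le> a ! j" using j by (intro sorted_nth_mono[OF assms(1)]) auto
        then show False using j n by simp
      qed
    qed
    then have "card {j. j < length a \<and> a ! j \<le> k} \<le> card {..<i}" by (intro card_mono) auto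
    then show False using l by simp
  qed
qed

locale veronese_ci =
  fixes d N :: nat and X :: "(nat \<Rightarrow> 'k::{alg_closed_field, field_char_0}) set set"
    and a :: "nat list" and fs :: "'k mpoly list"
  assumes d2: "d \<ge> 2" and N: "N = (d + 2 choose 2) - 1"
    and XV: "X \<subseteq> veronese_variety 2 d"
    and closed: "zariski_closed N X" and nonempty: "X \<noteq> {}"
    and len: "length fs = length a"
    and deg: "\<And>i. i < length a \<Longrightarrow> 1 \<le> a ! i" "\<And>i. i < length a \<Longrightarrow> fs ! i \<in> forms N (a ! i)"
    and ideal: "vanishing_ideal N X = ideal_gen N (set fs)"
    and dim: "proj_dim N X + enat (length a) = enat N"
begin

abbreviation nu :: "(nat \<Rightarrow> 'k) \<Rightarrow> nat \<Rightarrow> 'k" where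
  "nu \<equiv> veronese_vec 2 d"

definition Y :: "(nat \<Rightarrow> 'k) set" where
  "Y = {y \<in> nonzero_vecs 2. cls N (nu y) \<in> X}"

text \<open>The Hilbert function of \<open>X\<close>, computed on the cone over its preimage in the
  plane; \<open>veronese_pull\<close> and \<open>veronese_push\<close> match the two.\<close>

definition hilb :: "nat \<Rightarrow> nat" where
  "hilb k = fdim Y (homfun (coords 2) (d * k))"

text \<open>Positions instead of polynomials, so that cardinalities are multiplicities in
  \<open>a\<close> even if a generator is repeated.\<close>

definition gens :: "nat \<Rightarrow> nat set" where
  "gens k = {i. i < length a \<and> a ! i = k}"

lemma finite_gens [simp]: "finite (gens k)"
  by (simp add: gens_def)

lemma length_le: "length a \<le> N"
  using dim by (cases "proj_dim N X") auto

lemma X_eq: "X = (\<lambda>y. cls N (nu y)) ` Y"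
proof
  show "X \<subseteq> (\<lambda>y. cls N (nu y)) ` Y"
    using XV unfolding veronese_variety_eq[OF N] Y_def by blast
qed (auto simp: Y_def)

lemma X_iff: "p \<in> X \<longleftrightarrow> (\<exists>y\<in>Y. p = cls N (nu y))"
  using X_eq by blast

lemma Y_nonzero: "Y \<subseteq> nonzero_vecs 2"
  by (simp add: Y_def)

lemma nu_nonzero: "y \<in> Y \<Longrightarrow> nu y \<in> nonzero_vecs N"
  using veronese_nonzero[OF N] Y_nonzero by blast

lemma Y_scale:
  assumes "y \<in> Y" "c \<noteq> 0" shows "(\<lambda>i. c * y i) \<in> Y"
proof -
  have "cls N (nu (\<lambda>i. c * y i)) = cls N (nu y)"
    unfolding veronese_scale by (rule cls_eqI[OF nu_nonzero[OF assms(1)]]) (use assms(2) in simp)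
  then show ?thesis using assms nonzero_vecs_scale[of y 2 c] by (simp add: Y_def)
qed

lemma form_in_ideal_iff:
  assumes "f \<in> forms N t"
  shows "f \<in> vanishing_ideal N X \<longleftrightarrow> (\<forall>y\<in>Y. peval f (nu y) = 0)"
proof -
  have "(\<forall>z\<in>cls N (nu y). peval f z = 0) \<longleftrightarrow> peval f (nu y) = 0" if "y \<in> Y" for y
    by (rule form_cls_iff[OF assms nu_nonzero[OF that]])
  then show ?thesis using forms_poly_ring[OF assms] unfolding vanishing_ideal_def by (subst X_eq) simp
qed

lemma gen_in_ideal: "i < length a \<Longrightarrow> fs ! i \<in> vanishing_ideal N X"
  unfolding ideal using len by (intro ideal_gen_base) auto

lemma gen_vanish: "i < length a \<Longrightarrow> y \<in> Y \<Longrightarrow> peval (fs ! i) (nu y) = 0"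
  using form_in_ideal_iff[OF deg(2)] gen_in_ideal by blast

lemma in_X_if_gens_vanish:
  assumes "x \<in> nonzero_vecs N" "\<And>i. i < length a \<Longrightarrow> peval (fs ! i) x = 0"
  shows "cls N x \<in> X"
proof -
  obtain F where F: "F \<subseteq> (\<Union>a. forms N a)" "X = zero_locus N F" using closed by (auto simp: zariski_closed_def)
  have "peval f x = 0" if f: "f \<in> F" for f
  proof -
    have "f \<in> poly_ring N" using f F(1) forms_poly_ring by blast
    then have "f \<in> vanishing_ideal N X" using f F(2) by (auto simp: vanishing_ideal_def zero_locus_def)
    then obtain g where "f = (\<Sum>i<length fs. g i * fs ! i)" unfolding ideal using ideal_gen_list by blast
    then show ?thesis using assms(2) len by simp
  qed
  then show ?thesis unfolding F(2) using cls_in_zero_locus[OF F(1) assms(1)] by blast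
qed

text \<open>For reasons of degree, generators of degree above \<open>k\<close> do not contribute and
  those of degree \<open>k\<close> enter only with scalar coefficients.\<close>

lemma form_in_ideal_combination:
  assumes "f \<in> forms N k" "f \<in> vanishing_ideal N X"
  shows "\<exists>c. \<forall>x. (\<forall>i<length a. a ! i < k \<longrightarrow> peval (fs ! i) x = 0) \<longrightarrow>
    peval f x = (\<Sum>i\<in>gens k. c i * peval (fs ! i) x)"
proof -
  obtain g where g: "\<And>i. i < length fs \<Longrightarrow> g i \<in> poly_ring N" "f = (\<Sum>i<length fs. g i * fs ! i)"
    using ideal_gen_list assms(2) unfolding ideal by blast
  have e: "{i. i < length fs \<and> a ! i = k} = gens k" by (auto simp: gens_def len)
  show ?thesis
  proof (intro exI[of _ "\<lambda>i. peval (g i) (\<lambda>_. 0)"] allI impI)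
    fix x assume x: "\<forall>i<length a. a ! i < k \<longrightarrow> peval (fs ! i) x = 0"
    show "peval f x = (\<Sum>i\<in>gens k. peval (g i) (\<lambda>_. 0) * peval (fs ! i) x)"
      unfolding e[symmetric]
      by (rule form_in_ideal_eval[OF assms(1) g(2), of "\<lambda>i. a ! i"]) (use deg x g len in auto)
  qed
qed

section \<open>Lower bounds for the numbers of linear and quadratic generators\<close>

lemma dual_basis:
  "\<exists>p G. (\<forall>i<hilb k. p i \<in> Y \<and> G i \<in> homfun (coords N) k) \<and>
    (\<forall>i<hilb k. \<forall>j<hilb k. G i (nu (p j)) = (if i = j then 1 else 0)) \<and>
    (\<forall>f\<in>homfun (coords N) k. \<forall>y\<in>Y. f (nu y) = (\<Sum>i<hilb k. f (nu (p i)) * G i (nu y)))"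
proof -
  have "fin_gen (homfun (coords 2 :: ((nat \<Rightarrow> 'k) \<Rightarrow> 'k) set) (d * k))" by (rule fin_gen_homfun) simp
  from dual_sys_exists[OF homfun_subspace this, of Y] obtain p g where
    pg: "dual_sys Y (homfun (coords 2) (d * k)) (hilb k) p g"
      "\<forall>f\<in>homfun (coords 2) (d * k). \<forall>y\<in>Y. f y = (\<Sum>i<hilb k. f (p i) * g i y)"
    unfolding hilb_def by blast
  have "\<forall>i. i < hilb k \<longrightarrow> (\<exists>G\<in>homfun (coords N) k. \<forall>x. G (nu x) = g i x)"
  proof (intro allI impI)
    fix i assume "i < hilb k"
    then have "g i \<in> homfun (coords 2) (d * k)" using pg(1) by (simp add: dual_sys_def)
    from veronese_push[OF N this] show "\<exists>G\<in>homfun (coords N) k. \<forall>x. G (nu x) = g i x" .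
  qed
  then obtain G where G: "\<And>i. i < hilb k \<Longrightarrow> G i \<in> homfun (coords N) k" "\<And>i x. i < hilb k \<Longrightarrow> G i (nu x) = g i x" by metis
  have "f (nu y) = (\<Sum>i<hilb k. f (nu (p i)) * G i (nu y))" if "f \<in> homfun (coords N) k" "y \<in> Y" for f y
  proof -
    have "(\<lambda>x. f (nu x)) \<in> homfun (coords 2) (d * k)" by (rule veronese_pull[OF N that(1)])
    from pg(2)[rule_format, OF this that(2)] show ?thesis using G(2) by simp
  qed
  then show ?thesis using G pg(1)
    by (intro exI[of _ p] exI[of _ G]) (simp add: dual_sys_def)
qed

text \<open>On the common zeros of the generators of degree less than \<open>k\<close>, a form of degree \<open>k\<close> is determined
  by its values on \<open>Y\<close> up to a linear combination of the generators of degree \<open>k\<close>.\<close>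

lemma quotient_bound:
  assumes fin: "finite I" and f: "\<And>i. i \<in> I \<Longrightarrow> f i \<in> homfun (coords N) k"
    and ind: "\<And>c. (\<forall>x. (\<forall>i<length a. a ! i < k \<longrightarrow> peval (fs ! i) x = 0) \<longrightarrow> (\<Sum>i\<in>I. c i * f i x) = 0) \<Longrightarrow> \<forall>i\<in>I. c i = 0"
  shows "card I \<le> card (gens k) + hilb k"
proof -
  let ?T = "{x. \<forall>i<length a. a ! i < k \<longrightarrow> peval (fs ! i) x = 0}"
  obtain p G where G: "\<And>i. i < hilb k \<Longrightarrow> G i \<in> homfun (coords N) k"
    "\<And>f y. f \<in> homfun (coords N) k \<Longrightarrow> y \<in> Y \<Longrightarrow> f (nu y) = (\<Sum>i<hilb k. f (nu (p i)) * G i (nu y))"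
    using dual_basis[of k] by blast
  let ?B = "(\<lambda>i. peval (fs ! i)) ` gens k \<union> G ` {..<hilb k}"
  have "card I \<le> card ?B"
  proof (rule indep_on_card_le[where E = ?T and f = f, OF fin])
    show "\<forall>i\<in>I. c i = 0" if "\<forall>x\<in>?T. (\<Sum>i\<in>I. c i * f i x) = 0" for c
      by (rule ind) (use that in simp)
    fix i assume i: "i \<in> I"
    \<comment> \<open>Subtracting the interpolation on \<open>Y\<close> leaves a form that vanishes
      on \<open>Y\<close>, hence lies in the ideal and is a combination of generators of degree
      \<open>k\<close> on \<open>?T\<close>.\<close>
    define D where "D = (\<lambda>x. f i x - (\<Sum>j<hilb k. f i (nu (p j)) * G j x))"
    have "D \<in> homfun (coords N) k" unfolding D_def by (intro homfun_closed f i G) simp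
    then obtain h where h: "h \<in> forms N k" "peval h = D" using homfun_form by blast
    have "h \<in> vanishing_ideal N X"
      unfolding form_in_ideal_iff[OF h(1)] h(2) D_def using G(2)[OF f[OF i]] by simp
    from form_in_ideal_combination[OF h(1) this] obtain c where
      c: "\<And>x. x \<in> ?T \<Longrightarrow> peval h x = (\<Sum>i\<in>gens k. c i * peval (fs ! i) x)" by blast
    let ?h = "\<lambda>x. (\<Sum>i\<in>gens k. c i * peval (fs ! i) x) + (\<Sum>j<hilb k. f i (nu (p j)) * G j x)"
    show "\<exists>h\<in>funs.span ?B. \<forall>x\<in>?T. f i x = h x"
    proof (intro bexI[of _ ?h] ballI)
      show "?h \<in> funs.span ?B" by (intro span_add_fun span_sum_fun funs.span_base) auto
      fix x assume "x \<in> ?T"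
      from c[OF this] show "f i x = ?h x" unfolding h(2) D_def by (simp add: algebra_simps)
    qed
  qed simp
  also have "\<dots> \<le> card ((\<lambda>i. peval (fs ! i)) ` gens k) + card (G ` {..<hilb k})" by (rule card_Un_le)
  also have "\<dots> \<le> card (gens k) + hilb k"
    using card_image_le[of "gens k" "\<lambda>i. peval (fs ! i)"] card_image_le[of "{..<hilb k}" G] by simp
  finally show ?thesis .
qed

text \<open>\<open>quotient_bound\<close> for the coordinates: all degrees are at least 1, so no
  generator restricts the set of arguments.\<close>

lemma linear_bound: "N + 1 \<le> card (gens 1) + hilb 1"
proof -
  have "card {..N} \<le> card (gens 1) + hilb 1"
  proof (rule quotient_bound[where f = "\<lambda>j x. x j"])
    fix c :: "nat \<Rightarrow> 'k"
    assume c: "\<forall>x. (\<forall>i<length a. a ! i < 1 \<longrightarrow> peval (fs ! i) x = 0) \<longrightarrow> (\<Sum>j\<le>N. c j * x j) = 0"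
    have 0: "(\<Sum>j\<le>N. c j * x j) = 0" for x
    proof -
      have "\<forall>i<length a. a ! i < 1 \<longrightarrow> peval (fs ! i) x = 0"
      proof (intro allI impI)
        fix i assume "i < length a" "a ! i < 1"
        then show "peval (fs ! i) x = 0" using deg(1)[of i] by simp
      qed
      then show ?thesis using c by blast
    qed
    show "\<forall>j\<in>{..N}. c j = 0"
    proof
      fix k assume "k \<in> {..N}"
      then show "c k = 0" using 0[of "\<lambda>j. if j = k then 1 else 0"] by (simp add: if_distrib cong: if_cong)
    qed
  qed (auto intro: homfun_base[unfolded One_nat_def] coordsI simp del: homfun.simps)
  then show ?thesis by simp
qed

text \<open>With \<open>b = hilb 1\<close>, the \<open>b * (b + 1) / 2\<close> products of dual
  linear forms are independent quadrics on the zeros of the linear generators, and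
  \<open>quotient_bound\<close> applies to them. Both sides are doubled to avoid a division.\<close>

lemma quadric_bound: "hilb 1 * (hilb 1 + 1) \<le> 2 * card (gens 2) + 2 * hilb 2"
proof -
  let ?b = "hilb 1"
  obtain p G where G: "\<And>i. i < ?b \<Longrightarrow> p i \<in> Y" "\<And>i. i < ?b \<Longrightarrow> G i \<in> homfun (coords N) 1"
    "\<And>i j. i < ?b \<Longrightarrow> j < ?b \<Longrightarrow> G i (nu (p j)) = (if i = j then 1 else 0)"
    using dual_basis[of 1] by blast
  let ?I = "Sigma {..<?b} (\<lambda>j. {..j})"
  have "card ?I \<le> card (gens 2) + hilb 2"
  proof (rule quotient_bound[where f = "\<lambda>(j, i) x. G j x * G i x"])
    fix e assume "e \<in> ?I"
    then obtain j i where e: "e = (j, i)" "j < ?b" "i < ?b" by auto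
    from homfun_mult[OF G(2)[OF e(2)] G(2)[OF e(3)]]
    show "(case e of (j, i) \<Rightarrow> \<lambda>x. G j x * G i x) \<in> homfun (coords N) 2"
      by (simp only: e(1) prod.case one_add_one)
  next
    fix c :: "nat \<times> nat \<Rightarrow> 'k"
    assume c: "\<forall>x. (\<forall>i<length a. a ! i < 2 \<longrightarrow> peval (fs ! i) x = 0) \<longrightarrow>
      (\<Sum>e\<in>?I. c e * (case e of (j, i) \<Rightarrow> \<lambda>x. G j x * G i x) x) = 0"
    \<comment> \<open>The linear forms \<open>G i\<close> are dual to the points \<open>nu (p i)\<close>, and the zeros of the linear generators
      form a vector space, so that one may evaluate at \<open>nu (p k) + nu (p l)\<close>.\<close>
    have diag: "c (k, k) = 0" if k: "k < ?b" for k
    proof -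
      have "(\<Sum>e\<in>?I. c e * (case e of (j, i) \<Rightarrow> \<lambda>x. G j x * G i x) (nu (p k))) = 0"
        using c gen_vanish G(1)[OF k] by blast
      moreover have "(\<Sum>e\<in>?I. c e * (case e of (j, i) \<Rightarrow> \<lambda>x. G j x * G i x) (nu (p k))) =
          (\<Sum>e\<in>{(k, k)}. c e * (case e of (j, i) \<Rightarrow> \<lambda>x. G j x * G i x) (nu (p k)))"
        by (rule sum.mono_neutral_right) (use k in \<open>auto simp: G(3) split: if_splits\<close>)
      ultimately show ?thesis using k by (simp add: G(3))
    qed
    have off: "c (k, l) = 0" if kl: "k < ?b" "l < k" for k l
    proof -
      let ?x = "\<lambda>i. nu (p k) i + nu (p l) i"
      have l: "l < ?b" using kl by simp
      have Gx: "G j ?x = (if j = k then 1 else 0) + (if j = l then 1 else 0)" if "j < ?b" for j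
        using linear_fun_add[OF G(2)[OF that]] G(3)[OF that kl(1)] G(3)[OF that l] by simp
      have "peval (fs ! i) ?x = 0" if i: "i < length a" "a ! i < 2" for i
      proof -
        have "a ! i = 1" using deg(1)[OF i(1)] i(2) by linarith
        then have "peval (fs ! i) \<in> homfun (coords N) 1" using peval_homfun[OF deg(2)[OF i(1)]] by simp
        from linear_fun_add[OF this] show ?thesis using gen_vanish[OF i(1)] G(1)[OF kl(1)] G(1)[OF l] by simp
      qed
      then have "(\<Sum>e\<in>?I. c e * (case e of (j, i) \<Rightarrow> \<lambda>x. G j x * G i x) ?x) = 0" using c by blast
      moreover have "(\<Sum>e\<in>?I. c e * (case e of (j, i) \<Rightarrow> \<lambda>x. G j x * G i x) ?x) =
          (\<Sum>e\<in>{(k, k), (k, l), (l, l)}. c e * (case e of (j, i) \<Rightarrow> \<lambda>x. G j x * G i x) ?x)"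
        by (rule sum.mono_neutral_right) (use kl in \<open>auto simp: Gx split: if_splits\<close>)
      ultimately show ?thesis using kl diag[OF kl(1)] diag[OF l] by (simp add: Gx)
    qed
    show "\<forall>e\<in>?I. c e = 0"
    proof
      fix e assume "e \<in> ?I"
      then obtain j i where "e = (j, i)" "j < ?b" "i \<le> j" by auto
      then show "c e = 0" using diag off by (cases "i = j") auto
    qed
  qed simp
  moreover have "card ?I = (\<Sum>j<?b. Suc j)" by (simp add: card_SigmaI)
  moreover have "2 * (\<Sum>j<n. Suc j) = n * (n + 1)" for n by (induction n) auto
  ultimately show ?thesis by (metis add_mult_distrib2 mult_le_mono2)
qed

lemma gens_bound: "card (gens 1) + card (gens 2) \<le> length a"
proof -
  have "card (gens 1) + card (gens 2) = card (gens 1 \<union> gens 2)"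
    by (rule card_Un_disjoint[symmetric]) (auto simp: gens_def)
  also have "\<dots> \<le> card {..<length a}" by (rule card_mono) (auto simp: gens_def)
  finally show ?thesis by simp
qed

text \<open>\<open>linear_bound\<close> and \<open>r <= N\<close> leave at most \<open>b - 1\<close>
  quadric generators; inserted into \<open>quadric_bound\<close> and freed of subtraction this reads
  \<open>b * b + 2 <= 2 * H + b\<close>. The value \<open>b = 0\<close> would require
  \<open>N + 1\<close> linear generators.\<close>

lemma hilb_cases:
  "(hilb 1 = 1 \<or> hilb 1 = 2) \<and> hilb 2 \<le> hilb 1 \<or>
   (d \<le> 3 \<and> hilb 1 = d + 1 \<and> hilb 2 \<le> 2 * d + 1 \<and> fdim Y (homfun (coords 2) 1) = 2)"
proof -
  have "hilb 1 \<noteq> 0" using linear_bound gens_bound length_le by linarith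
  moreover have "hilb 1 * hilb 1 + 2 \<le> 2 * hilb 2 + hilb 1"
    using linear_bound quadric_bound gens_bound length_le by (simp add: algebra_simps)
  ultimately show ?thesis
    using plane_growth[OF Y_nonzero Y_scale d2 refl refl] by (simp add: hilb_def mult.commute) linarith
qed

section \<open>The type of \<open>X\<close> from the values of its Hilbert function\<close>

lemma sorted_gens:
  assumes "sorted a" "i < length a"
  shows "a ! i = 1 \<longleftrightarrow> i < card (gens 1)" "a ! i \<le> 2 \<longleftrightarrow> i < card (gens 1) + card (gens 2)"
proof -
  have "{j. j < length a \<and> a ! j \<le> 1} = gens 1" using deg(1) by (force simp: gens_def)
  then show "a ! i = 1 \<longleftrightarrow> i < card (gens 1)"
    using sorted_nth_le_iff[OF assms, of 1] deg(1)[OF assms(2)] by auto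
  have "{j. j < length a \<and> a ! j \<le> 2} = gens 1 \<union> gens 2"
  proof (intro set_eqI iffI)
    fix j assume "j \<in> {j. j < length a \<and> a ! j \<le> 2}"
    then have "j < length a" "a ! j = 1 \<or> a ! j = 2" using deg(1)[of j] by auto
    then show "j \<in> gens 1 \<union> gens 2" by (auto simp: gens_def)
  qed (auto simp: gens_def)
  moreover have "card (gens 1 \<union> gens 2) = card (gens 1) + card (gens 2)"
    by (rule card_Un_disjoint) (auto simp: gens_def)
  ultimately show "a ! i \<le> 2 \<longleftrightarrow> i < card (gens 1) + card (gens 2)"
    using sorted_nth_le_iff[OF assms, of 2] by simp
qed

lemma point_case:
  assumes b: "hilb 1 = 1" and srt: "sorted a"
  shows "length a = N \<and> a = replicate N 1 \<and> (\<exists>p. X = {p})"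
proof -
  have m: "card (gens 1) = N" "length a = N" using linear_bound gens_bound length_le b by linarith+
  have "a = replicate N 1"
    using sorted_gens(1)[OF srt] m by (intro nth_equalityI) auto
  moreover obtain p G where pG: "\<forall>i<1::nat. p i \<in> Y \<and> G i \<in> homfun (coords N) 1"
    "\<forall>f\<in>homfun (coords N) 1. \<forall>y\<in>Y. f (nu y) = (\<Sum>i<1::nat. f (nu (p i)) * G i (nu y))"
    using dual_basis[of 1] unfolding b by (elim exE conjE) (rule that; assumption)
  have G: "p 0 \<in> Y" using pG(1) by simp
  have expand: "f (nu y) = f (nu (p 0)) * G 0 (nu y)" if "f \<in> homfun (coords N) 1" "y \<in> Y" for f y
    using pG(2)[rule_format, OF that] by simp
  have "cls N (nu y) = cls N (nu (p 0))" if y: "y \<in> Y" for y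
  proof -
    \<comment> \<open>With a single dual form, each coordinate restricted to \<open>Y\<close> is a
      multiple of \<open>G 0\<close>, so all these vectors are proportional.\<close>
    have e: "nu y = (\<lambda>j. G 0 (nu y) * nu (p 0) j)"
    proof
      fix j
      show "nu y j = G 0 (nu y) * nu (p 0) j"
      proof (cases "j \<le> N")
        case True
        from expand[OF homfun_base[OF coordsI[OF this]] y] show ?thesis by (simp add: mult.commute)
      next
        case False
        then show ?thesis using nu_nonzero[OF y] nu_nonzero[OF G] by (simp add: nonzero_vecs_def)
      qed
    qed
    moreover have "G 0 (nu y) \<noteq> 0"
    proof
      assume "G 0 (nu y) = 0"
      then have "nu y = (\<lambda>j. 0 * nu (p 0) j)" using e by metis
      then show False using nu_nonzero[OF y] by (simp add: nonzero_vecs_def)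
    qed
    ultimately show ?thesis using cls_eq_iff[OF nu_nonzero[OF G] nu_nonzero[OF y]] by blast
  qed
  then have "X = {cls N (nu (p 0))}" using G by (intro set_eqI) (metis X_iff singleton_iff)
  ultimately show ?thesis using m by blast
qed

text \<open>For any two of the points a linear form vanishes at the first and not at the second.
  Products of two such forms isolate each of the three points, which thus impose independent
  conditions on quadrics.\<close>

lemma three_points:
  fixes y :: "nat \<Rightarrow> nat \<Rightarrow> 'k"
  assumes y: "\<And>i. i < 3 \<Longrightarrow> y i \<in> Y"
    and ne: "\<And>i j. i < 3 \<Longrightarrow> j < 3 \<Longrightarrow> i \<noteq> j \<Longrightarrow> cls N (nu (y i)) \<noteq> cls N (nu (y j))"
  shows "3 \<le> hilb 2"
proof -
  have "\<forall>i j. \<exists>G. i < (3::nat) \<longrightarrow> j < (3::nat) \<longrightarrow> i \<noteq> j \<longrightarrow> G \<in> homfun (coords 2) d \<and> G (y i) = 0 \<and> G (y j) \<noteq> 0"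
  proof (intro allI)
    fix i j :: nat
    show "\<exists>G. i < 3 \<longrightarrow> j < 3 \<longrightarrow> i \<noteq> j \<longrightarrow> G \<in> homfun (coords 2) d \<and> G (y i) = 0 \<and> G (y j) \<noteq> 0"
    proof (cases "i < 3 \<and> j < 3 \<and> i \<noteq> j")
      case True
      then obtain k l where kl: "k \<le> N" "l \<le> N" "nu (y i) k * nu (y j) l \<noteq> nu (y i) l * nu (y j) k"
        using cls_neq_coords[OF nu_nonzero nu_nonzero ne] y by blast
      define G where "G = (\<lambda>x. nu (y i) k * nu x l - nu (y i) l * nu x k)"
      have N1: "N + 1 = (d + 2 choose 2)" using N by simp
      have "G \<in> homfun (coords 2) d" unfolding G_def
        by (intro homfun_closed(3,4) veronese_coord) (use kl N1 in auto)
      then show ?thesis using kl(3) by (intro exI[of _ G]) (simp add: G_def algebra_simps)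
    qed auto
  qed
  then obtain G where G: "\<And>i j. i < 3 \<Longrightarrow> j < 3 \<Longrightarrow> i \<noteq> j \<Longrightarrow> G i j \<in> homfun (coords 2) d \<and> G i j (y i) = 0 \<and> G i j (y j) \<noteq> 0"
    by metis
  \<comment> \<open>\<open>s i\<close> and \<open>t i\<close> are the two indices other than
    \<open>i\<close>.\<close>
  define s t :: "nat \<Rightarrow> nat" where st: "s = (\<lambda>i. if i = 0 then 1 else 0)" "t = (\<lambda>i. if i = 2 then 1 else 2)"
  have sti: "s i < 3" "t i < 3" "s i \<noteq> i" "t i \<noteq> i" "\<And>j. j < 3 \<Longrightarrow> j \<noteq> i \<Longrightarrow> j = s i \<or> j = t i" if "i < 3" for i
    using that by (auto simp: st)
  define Q where "Q = (\<lambda>i x. G (s i) i x * G (t i) i x)"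
  have QY: "Q i (y j) = 0" if "i < 3" "j < 3" "j \<noteq> i" for i j
    using sti(5)[OF that(1,2,3)] G[OF sti(1) _ sti(3)] G[OF sti(2) _ sti(4)] that by (auto simp: Q_def)
  have Qi: "Q i (y i) \<noteq> 0" if "i < 3" for i
    using G[OF sti(1) _ sti(3)] G[OF sti(2) _ sti(4)] that by (simp add: Q_def)
  have "dual_sys Y (homfun (coords 2) (d * 2)) 3 y (\<lambda>i x. (1 / Q i (y i)) * Q i x)"
    unfolding dual_sys_def
  proof (intro conjI allI impI)
    fix i :: nat assume i: "i < 3"
    show "y i \<in> Y" by (rule y[OF i])
    have "Q i \<in> homfun (coords 2) (d + d)" unfolding Q_def
      using G[OF sti(1) i sti(3)] G[OF sti(2) i sti(4)] i by (intro homfun_mult) auto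
    then show "(\<lambda>x. (1 / Q i (y i)) * Q i x) \<in> homfun (coords 2) (d * 2)"
      by (intro homfun_closed) (simp add: mult_2_right)
    fix j :: nat assume j: "j < 3"
    show "(1 / Q i (y i)) * Q i (y j) = (if i = j then 1 else 0)"
      using QY[OF i j] Qi[OF i] by auto
  qed
  then show ?thesis unfolding hilb_def by (rule dual_sys_le_fdim) (simp add: fin_gen_homfun)
qed

lemma two_points_case:
  assumes b: "hilb 1 = 2" "hilb 2 \<le> 2" and srt: "sorted a"
  shows "length a = N \<and> a = replicate (N - 1) 1 @ [2] \<and> card X = 2"
proof -
  \<comment> \<open>As \<open>hilb 2 <= 2\<close>, there is a quadric generator; beside at least
    \<open>N - 1\<close> linear ones there is room for exactly one.\<close>
  have q: "6 \<le> 2 * card (gens 2) + 2 * hilb 2" using quadric_bound unfolding b by simp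
  have N0: "N > 0" using b length_le gens_bound q by linarith
  have m: "card (gens 1) = N - 1" "card (gens 2) = 1" "length a = N"
    using linear_bound gens_bound length_le b q by linarith+
  have "a = replicate (N - 1) 1 @ [2]"
  proof (rule nth_equalityI)
    show "length a = length (replicate (N - 1) 1 @ [2])" using m N0 by simp
    fix i assume i: "i < length a"
    show "a ! i = (replicate (N - 1) 1 @ [2]) ! i"
    proof (cases "i < N - 1")
      case True
      then show ?thesis using sorted_gens(1)[OF srt i] m by (simp add: nth_append)
    next
      case False
      then have "i = N - 1" using i m by simp
      moreover have "a ! i \<noteq> 1" "a ! i \<le> 2" using sorted_gens[OF srt i] m False i by auto
      ultimately show ?thesis using deg(1)[OF i] by (simp add: nth_append)
    qed
  qed
  moreover have "card X = 2"
  proof -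
    obtain p G where pG': "\<forall>i<2::nat. p i \<in> Y \<and> G i \<in> homfun (coords N) 1"
      "\<forall>i<2::nat. \<forall>j<2::nat. G i (nu (p j)) = (if i = j then 1 else 0)"
      using dual_basis[of 1] unfolding b by (elim exE conjE) (rule that; assumption)
    have pG: "\<And>i::nat. i < 2 \<Longrightarrow> p i \<in> Y" "\<And>i::nat. i < 2 \<Longrightarrow> G i \<in> homfun (coords N) 1"
      "\<And>i j::nat. i < 2 \<Longrightarrow> j < 2 \<Longrightarrow> G i (nu (p j)) = (if i = j then 1 else 0)"
      using pG' by blast+
    have ne: "cls N (nu (p 0)) \<noteq> cls N (nu (p 1))"
    proof
      assume "cls N (nu (p 0)) = cls N (nu (p 1))"
      then obtain c where "nu (p 1) = (\<lambda>i. c * nu (p 0) i)"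
        using cls_eq_iff[OF nu_nonzero nu_nonzero] pG(1)[of 0] pG(1)[of 1] by auto
      then have "G 1 (nu (p 1)) = c * G 1 (nu (p 0))" using linear_fun_scale[OF pG(2)[of 1]] by simp
      then show False using pG(3) by simp
    qed
    have "X = {cls N (nu (p 0)), cls N (nu (p 1))}"
    proof (rule ccontr)
      assume "X \<noteq> {cls N (nu (p 0)), cls N (nu (p 1))}"
      moreover have "cls N (nu (p 0)) \<in> X" "cls N (nu (p 1)) \<in> X"
        using pG(1)[of 0] pG(1)[of 1] unfolding Y_def by simp_all
      ultimately obtain P where P: "P \<in> X" "P \<noteq> cls N (nu (p 0))" "P \<noteq> cls N (nu (p 1))" by blast
      obtain y where y: "y \<in> Y" "P = cls N (nu y)" using P(1) X_iff by blast
      have "3 \<le> hilb 2"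
      proof (rule three_points[of "\<lambda>i. if i < 2 then p i else y"])
        fix i j :: nat assume ij: "i < 3" "j < 3" "i \<noteq> j"
        then have "i = 0 \<or> i = 1 \<or> i = 2" "j = 0 \<or> j = 1 \<or> j = 2" by auto
        then show "cls N (nu (if i < 2 then p i else y)) \<noteq> cls N (nu (if j < 2 then p j else y))"
          using ij(3) ne P(2,3)[unfolded y(2)] by (elim disjE) (auto simp del: Image_singleton_iff)
      qed (use y pG in auto)
      then show False using b by simp
    qed
    then show ?thesis using ne by simp
  qed
  ultimately show ?thesis using m by blast
qed

end

text \<open>In a relation between a dual system on \<open>E\<close> and the given functions,
  restriction to \<open>E\<close> kills the latter and hence the coefficients of the former; what
  remains is a relation on \<open>E'\<close>.\<close>

lemma fdim_extend:
  fixes W :: "('a \<Rightarrow> 'k::field) set"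
  assumes W: "funs.subspace W" "fin_gen W" and E: "E \<subseteq> E'"
    and f: "\<And>j. j < m \<Longrightarrow> f j \<in> W" "\<And>j x. j < m \<Longrightarrow> x \<in> E \<Longrightarrow> f j x = 0"
    and ind: "\<And>c. \<forall>x\<in>E'. (\<Sum>j<m. c j * f j x) = 0 \<Longrightarrow> \<forall>j<m. c j = 0"
  shows "fdim E W + m \<le> fdim E' W"
proof -
  let ?n = "fdim E W"
  obtain p g where pg: "dual_sys E W ?n p g" using dual_sys_exists[OF W] by blast
  let ?I = "{..<?n} <+> {..<m}"
  let ?h = "case_sum g f"
  have "card ?I \<le> fdim E' W"
  proof (rule indep_on_le_fdim[OF W(2)])
    fix i assume "i \<in> ?I"
    then show "?h i \<in> W" using f(1) pg by (auto simp: dual_sys_def)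
  next
    fix c assume c: "\<forall>x\<in>E'. (\<Sum>i\<in>?I. c i * ?h i x) = 0"
    have s: "(\<Sum>i<?n. c (Inl i) * g i x) + (\<Sum>j<m. c (Inr j) * f j x) = 0" if "x \<in> E'" for x
      using c that by (simp add: sum.Plus)
    have "\<forall>x\<in>E. (\<Sum>i<?n. c (Inl i) * g i x) = 0"
    proof
      fix x assume x: "x \<in> E"
      have "(\<Sum>j<m. c (Inr j) * f j x) = 0" by (rule sum.neutral) (simp add: f(2)[OF _ x])
      then show "(\<Sum>i<?n. c (Inl i) * g i x) = 0" using s[of x] E x by auto
    qed
    then have g0: "c (Inl i) = 0" if "i < ?n" for i using dual_sys_indep[OF pg order_refl, of "\<lambda>i. c (Inl i)"] that by simp
    then have "\<forall>x\<in>E'. (\<Sum>j<m. c (Inr j) * f j x) = 0" using s by simp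
    from ind[OF this] g0 show "\<forall>i\<in>?I. c i = 0" by auto
  qed simp
  then show ?thesis by (simp add: card_Plus)
qed

locale veronese_ci_line = veronese_ci d N X a fs + line: veronese_line d N u v g0 g1
  for d N and X :: "(nat \<Rightarrow> 'k::{alg_closed_field, field_char_0}) set set" and a fs
    and u v :: "nat \<Rightarrow> 'k" and g0 g1 +
  assumes on_line: "\<And>y. y \<in> Y \<Longrightarrow> y = line.par (g0 y, g1 y)"
begin

lemma Y_par: "y \<in> Y \<Longrightarrow> \<exists>z. z \<noteq> (0, 0) \<and> y = line.par z"
proof (intro exI conjI)
  assume y: "y \<in> Y"
  show "(g0 y, g1 y) \<noteq> (0, 0)"
  proof
    assume "(g0 y, g1 y) = (0, 0)"
    then have "y = line.par (0, 0)" using on_line[OF y] by simp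
    then have "y = (\<lambda>i. 0)" by (simp add: line.par_def)
    then show False using y Y_nonzero by (auto simp: nonzero_vecs_def)
  qed
  show "y = line.par (g0 y, g1 y)" by (rule on_line[OF y])
qed

lemma X_subset_C: "X \<subseteq> line.C"
proof
  fix p assume "p \<in> X"
  then obtain y where y: "y \<in> Y" "p = cls N (nu y)" using X_iff by blast
  then obtain z where "z \<noteq> (0, 0)" "y = line.par z" using Y_par by blast
  then show "p \<in> line.C" using y(2) line.C_iff line.pt_def by metis
qed

section \<open>Restriction of the ideal of \<open>X\<close> to the rational normal curve\<close>

definition YC :: "(nat \<Rightarrow> 'k) set" where
  "YC = line.par ` {z. z \<noteq> (0, 0)}"

lemma Y_subset_YC: "Y \<subseteq> YC"
  using Y_par by (auto simp: YC_def)

lemma fdim_line_points: "fdim YC (homfun (coords 2) k) \<le> k + 1"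
proof -
  let ?M = "(\<lambda>i z. fst z ^ i * snd z ^ (k - i)) ` {..k} :: ('k \<times> 'k \<Rightarrow> 'k) set"
  let ?B = "(\<lambda>i x. g0 x ^ i * g1 x ^ (k - i)) ` {..k}"
  have "fdim YC (homfun (coords 2) k) \<le> card ?B"
  proof (rule fdim_le)
    fix f :: "(nat \<Rightarrow> 'k) \<Rightarrow> 'k" assume f: "f \<in> homfun (coords 2) k"
    define F where "F = (\<lambda>z. f (line.par z))"
    have "F \<in> funs.span ?M" unfolding F_def by (rule homfun2_monomials[OF line.pull_par[OF f]])
    then have "(\<lambda>x. F (g0 x, g1 x)) \<in> funs.span ?B"
    proof (induction rule: span_fun_induct)
      case zero
      show ?case by (simp only: mult_zero_right span_zero_fun)
    next
      case (add f g)
      then show ?case by (rule span_add_fun)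
    next
      case (base c b)
      then obtain i where "i \<le> k" "b = (\<lambda>z. fst z ^ i * snd z ^ (k - i))" by auto
      then have "(\<lambda>x. b (g0 x, g1 x)) \<in> ?B" by auto
      from funs.span_scale[OF funs.span_base[OF this], of c] show ?case .
    qed
    moreover have "f x = F (g0 x, g1 x)" if "x \<in> YC" for x
      using that by (auto simp: YC_def F_def line.g_par)
    ultimately show "\<exists>h\<in>funs.span ?B. \<forall>x\<in>YC. f x = h x"
      by (intro bexI[of _ "\<lambda>x. F (g0 x, g1 x)"] ballI)
  qed simp
  also have "\<dots> \<le> k + 1" using card_image_le[of "{..k}" "\<lambda>i x. g0 x ^ i * g1 x ^ (k - i)"] by simp
  finally show ?thesis .
qed

text \<open>Forms that vanish on \<open>X\<close> but stay independent on the curve add to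
  \<open>hilb k\<close> inside a space of dimension at most \<open>d * k + 1\<close>. Room for none
  and for one such form gives \<open>vanish_on_C\<close> and
  \<open>proportional_on_C\<close>.\<close>

lemma extend_bound:
  assumes f: "\<And>j. j < m \<Longrightarrow> f j \<in> forms N k" "\<And>j. j < m \<Longrightarrow> f j \<in> vanishing_ideal N X"
    and ind: "\<And>c. \<forall>z. z \<noteq> (0, 0) \<longrightarrow> (\<Sum>j<m. c j * peval (f j) (nu (line.par z))) = 0 \<Longrightarrow> \<forall>j<m. c j = 0"
  shows "hilb k + m \<le> d * k + 1"
proof -
  have "hilb k + m \<le> fdim YC (homfun (coords 2) (d * k))"
    unfolding hilb_def
  proof (rule fdim_extend[where f = "\<lambda>j y. peval (f j) (nu y)"])
    show "fin_gen (homfun (coords 2 :: ((nat \<Rightarrow> 'k) \<Rightarrow> 'k) set) (d * k))" by (rule fin_gen_homfun) simp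
    show "Y \<subseteq> YC" by (rule Y_subset_YC)
    show "(\<lambda>y. peval (f j) (nu y)) \<in> homfun (coords 2) (d * k)" if "j < m" for j
      by (rule veronese_pull[OF N peval_homfun[OF f(1)[OF that]]])
    show "peval (f j) (nu x) = 0" if "j < m" "x \<in> Y" for j x
      using form_in_ideal_iff[OF f(1)[OF that(1)]] f(2)[OF that(1)] that(2) by blast
    show "\<forall>j<m. c j = 0" if "\<forall>x\<in>YC. (\<Sum>j<m. c j * peval (f j) (nu x)) = 0" for c
      by (rule ind) (use that in \<open>auto simp: YC_def\<close>)
  qed simp
  then show ?thesis using fdim_line_points[of "d * k"] by linarith
qed

lemma vanish_on_C:
  assumes "d * k + 1 \<le> hilb k" "f \<in> forms N k" "f \<in> vanishing_ideal N X" "z \<noteq> (0, 0)"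
  shows "peval f (nu (line.par z)) = 0"
proof (rule ccontr)
  assume n: "peval f (nu (line.par z)) \<noteq> 0"
  have "hilb k + 1 \<le> d * k + 1"
  proof (rule extend_bound[where f = "\<lambda>_. f"])
    fix c :: "nat \<Rightarrow> 'k"
    assume "\<forall>z. z \<noteq> (0, 0) \<longrightarrow> (\<Sum>j<1. c j * peval f (nu (line.par z))) = 0"
    then have "(\<Sum>j<1::nat. c j * peval f (nu (line.par z))) = 0" using assms(4) by blast
    then show "\<forall>j<1. c j = 0" using n by simp
  qed (use assms in auto)
  then show False using assms(1) by simp
qed

lemma proportional_on_C:
  assumes "d * k \<le> hilb k" and f: "f \<in> forms N k" "f \<in> vanishing_ideal N X"
    and h: "h \<in> forms N k" "h \<in> vanishing_ideal N X" "w \<noteq> (0, 0)" "peval h (nu (line.par w)) \<noteq> 0"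
  shows "\<exists>c. \<forall>z. z \<noteq> (0, 0) \<longrightarrow> peval f (nu (line.par z)) = c * peval h (nu (line.par z))"
proof (rule ccontr)
  assume n: "\<not> ?thesis"
  have "hilb k + 2 \<le> d * k + 1"
  proof (rule extend_bound[where f = "\<lambda>j. if j = 0 then f else h"])
    fix c :: "nat \<Rightarrow> 'k"
    assume c: "\<forall>z. z \<noteq> (0, 0) \<longrightarrow> (\<Sum>j<2. c j * peval (if j = 0 then f else h) (nu (line.par z))) = 0"
    have e: "c 0 * peval f (nu (line.par z)) + c 1 * peval h (nu (line.par z)) = 0" if "z \<noteq> (0, 0)" for z
      using c[rule_format, OF that] by (simp add: numeral_2_eq_2)
    have "c 0 = 0"
    proof (rule ccontr)
      assume c0: "c 0 \<noteq> 0"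
      have "peval f (nu (line.par z)) = (- (c 1 / c 0)) * peval h (nu (line.par z))" if "z \<noteq> (0, 0)" for z
        using e[OF that] c0 by (simp add: field_simps add_eq_0_iff)
      then show False using n by blast
    qed
    moreover have "c 1 = 0" using e[OF h(3)] h(4) \<open>c 0 = 0\<close> by simp
    ultimately show "\<forall>j<2. c j = 0" by (auto simp: less_Suc_eq numeral_2_eq_2)
  qed (use f h in auto)
  then show False using assms(1) by simp
qed

lemma X_eq_C_if_gens_vanish:
  assumes "\<And>i z. i < length a \<Longrightarrow> z \<noteq> (0, 0) \<Longrightarrow> peval (fs ! i) (nu (line.par z)) = 0"
  shows "X = line.C \<and> length a + 1 \<le> N"
proof -
  have XC: "X = line.C"
  proof
    show "line.C \<subseteq> X"
      using in_X_if_gens_vanish[OF line.veronese_par_nonzero] assms line.C_iff line.pt_def by (metis subsetI)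
  qed (rule X_subset_C)
  have "1 \<le> proj_dim N X" using line.proj_dim_C closed unfolding XC by blast
  then have "length a + 1 \<le> N"
    using dim by (cases "proj_dim N X") (auto simp: one_enat_def)
  then show ?thesis using XC by blast
qed

lemma low_degree_gens:
  assumes h: "d + 1 \<le> hilb 1" "2 * d + 1 \<le> hilb 2" and m: "card (gens 1) + card (gens 2) = length a"
  shows "X = line.C \<and> length a + 1 \<le> N"
proof (rule X_eq_C_if_gens_vanish)
  fix i z assume i: "i < length a" and z: "z \<noteq> (0 :: 'k, 0 :: 'k)"
  have "card (gens 1 \<union> gens 2) = card {..<length a}"
    using m by (subst card_Un_disjoint) (auto simp: gens_def)
  then have "gens 1 \<union> gens 2 = {..<length a}"
    by (intro card_subset_eq) (auto simp: gens_def)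
  then have "i \<in> gens 1 \<union> gens 2" using i by blast
  then consider "a ! i = 1" | "a ! i = 2" by (auto simp: gens_def)
  then show "peval (fs ! i) (nu (line.par z)) = 0"
  proof cases
    case 1
    then show ?thesis using vanish_on_C[of 1 "fs ! i" z] h deg(2)[OF i] gen_in_ideal[OF i] z by simp
  next
    case 2
    then show ?thesis using vanish_on_C[of 2 "fs ! i" z] h deg(2)[OF i] gen_in_ideal[OF i] z by (simp add: mult.commute)
  qed
qed

lemma form_in_ideal_C_iff:
  assumes "f \<in> forms N t"
  shows "f \<in> vanishing_ideal N line.C \<longleftrightarrow> (\<forall>z. z \<noteq> (0, 0) \<longrightarrow> peval f (nu (line.par z)) = 0)"
proof -
  have "f \<in> vanishing_ideal N line.C \<longleftrightarrow> (\<forall>z. z \<noteq> (0, 0) \<longrightarrow> (\<forall>y\<in>line.pt z. peval f y = 0))"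
    using forms_poly_ring[OF assms] unfolding vanishing_ideal_def line.C_def by blast
  then show ?thesis using line.pt_vanish_iff[OF assms] by blast
qed

text \<open>By \<open>gens\<close>, the ideal is generated on the curve by \<open>h\<close> alone,
  and only generators of degree \<open>b\<close> are nonzero there. Counting zeros bounds the number
  of points by \<open>d * b\<close>; equality holds since the ideal contains all forms vanishing on
  \<open>X\<close>.\<close>

lemma one_form_section:
  assumes h: "h \<in> forms N b" "h \<in> vanishing_ideal N X" "w \<noteq> (0, 0)" "peval h (nu (line.par w)) \<noteq> 0"
    and gens: "\<And>i. i < length a \<Longrightarrow> \<exists>c. (\<forall>z. z \<noteq> (0, 0) \<longrightarrow>
      peval (fs ! i) (nu (line.par z)) = c * peval h (nu (line.par z))) \<and> (a ! i \<noteq> b \<longrightarrow> c = 0)"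
  shows "card X = d * b \<and> hypersurface_section N b line.C X"
proof (rule conjI)
  obtain e where e: "\<And>i z. i < length a \<Longrightarrow> z \<noteq> (0, 0) \<Longrightarrow>
      peval (fs ! i) (nu (line.par z)) = e i * peval h (nu (line.par z))"
    "\<And>i. i < length a \<Longrightarrow> a ! i \<noteq> b \<Longrightarrow> e i = 0" using gens by metis
  let ?F = "\<lambda>z. peval h (nu (line.par z))"
  have F: "?F \<in> binary_forms (d * b)" by (rule line.form_par[OF h(1)])
  have hC: "h \<notin> vanishing_ideal N line.C" using form_in_ideal_C_iff[OF h(1)] h(3,4) by blast
  have finX: "finite X"
  proof (rule ccontr)
    assume "infinite X"
    then have "X = line.C" using line.closed_infinite_eq_C[OF closed X_subset_C] by blast
    then show False using h(2) hC by simp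
  qed
  obtain Z where Z: "finite Z" "card Z = card X" "(0, 0) \<notin> Z" "line.pt ` Z = X"
    "\<And>z w. z \<in> Z \<Longrightarrow> w \<in> Z \<Longrightarrow> z \<noteq> w \<Longrightarrow> lin_at z w \<noteq> 0"
    using line.reps_exist[OF X_subset_C finX] by blast
  have Znz: "z \<noteq> (0, 0)" if "z \<in> Z" for z using that Z(3) by auto
  show "card X = d * b"
  proof (rule antisym)
    show "card X \<le> d * b"
    proof (rule ccontr)
      assume n: "\<not> card X \<le> d * b"
      have "?F w = 0"
      proof (rule binary_vanish[OF F Z(1)])
        fix z assume z: "z \<in> Z"
        then have "line.pt z \<in> X" using Z(4) by blast
        then have "\<forall>y\<in>line.pt z. peval h y = 0" using h(2) unfolding vanishing_ideal_def by blast
        then show "?F z = 0" using line.pt_vanish_iff[OF h(1) Znz[OF z]] by blast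
      qed (use Z n in auto)
      then show False using h(4) by simp
    qed
    show "d * b \<le> card X"
    proof (rule ccontr)
      assume "\<not> d * b \<le> card X"
      then have lt: "card Z < d * b" using Z(2) by simp
      define j where "j = d * b - card Z"
      have j: "j > 0" "card Z + j = d * b" using lt by (auto simp: j_def)
      \<comment> \<open>The product of the linear factors of all points. If its degree is too small,
        \<open>fst ^ j\<close> and \<open>snd ^ j\<close> fill it up to two forms of degree
        \<open>d * b\<close> vanishing on \<open>X\<close>; both would be multiples of
        \<open>?F\<close>, hence proportional to each other.\<close>
      define q where "q = (\<lambda>x. \<Prod>z\<in>Z. lin_at z x)"
      have lz: "lin_at z \<in> binary_forms 1" for z :: "'k \<times> 'k"
      proof -
        have "(\<lambda>x. snd z * fst x + (- fst z) * snd x) \<in> funs.span {fst, snd}"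
          by (intro span_add_fun funs.span_scale funs.span_base) auto
        then show ?thesis by (simp only: homfun_1) (simp add: lin_at_def)
      qed
      have q: "q \<in> binary_forms (card Z)"
        using homfun_prod[OF Z(1), of lin_at "{fst, snd}" "\<lambda>_. 1"] lz by (simp add: q_def)
      have multiple: "\<exists>c. \<forall>z. z \<noteq> (0, 0) \<longrightarrow> q z * m z ^ j = c * ?F z" if m: "m \<in> {fst, snd}" for m
      proof -
        have "(\<lambda>x. q x * m x ^ j) \<in> binary_forms (card Z + 1 * j)"
          by (intro homfun_mult q homfun_power homfun_base m)
        then have "(\<lambda>x. q x * m x ^ j) \<in> binary_forms (d * b)" using j(2) by simp
        from line.par_form[OF this] obtain f where
          f: "f \<in> forms N b" "\<And>z. peval f (nu (line.par z)) = q z * m z ^ j" by blast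
        have "peval f (nu y) = 0" if y: "y \<in> Y" for y
        proof -
          obtain z where z: "z \<noteq> (0, 0)" "y = line.par z" using Y_par[OF y] by blast
          have "line.pt z \<in> X" using y z(2) unfolding line.pt_def Y_def by simp
          then obtain w where w: "w \<in> Z" "line.pt w = line.pt z" using Z(4) by auto
          then have "lin_at w z = 0" using line.pt_eq_iff[OF Znz z(1)] by blast
          then have "q z = 0" using w(1) Z(1) by (auto simp: q_def)
          then show ?thesis by (simp add: z(2) f(2))
        qed
        then have "f \<in> vanishing_ideal N X" using form_in_ideal_iff[OF f(1)] by blast
        from form_in_ideal_combination[OF f(1) this] obtain c where
          c: "\<And>x. (\<forall>i<length a. a ! i < b \<longrightarrow> peval (fs ! i) x = 0) \<Longrightarrow>
            peval f x = (\<Sum>i\<in>gens b. c i * peval (fs ! i) x)" by blast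
        have "q z * m z ^ j = (\<Sum>i\<in>gens b. c i * e i) * ?F z" if z: "z \<noteq> (0, 0)" for z
        proof -
          have "\<forall>i<length a. a ! i < b \<longrightarrow> peval (fs ! i) (nu (line.par z)) = 0"
            using e z by simp
          from c[OF this] have "q z * m z ^ j = (\<Sum>i\<in>gens b. c i * peval (fs ! i) (nu (line.par z)))"
            by (simp add: f(2))
          also have "\<dots> = (\<Sum>i\<in>gens b. (c i * e i) * ?F z)"
            by (rule sum.cong) (use e(1)[OF _ z] in \<open>auto simp: gens_def\<close>)
          finally show ?thesis by (simp add: sum_distrib_right)
        qed
        then show ?thesis by blast
      qed
      obtain c1 where c1: "\<And>z. z \<noteq> (0, 0) \<Longrightarrow> q z * fst z ^ j = c1 * ?F z" using multiple[of fst] by blast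
      obtain c2 where c2: "\<And>z. z \<noteq> (0, 0) \<Longrightarrow> q z * snd z ^ j = c2 * ?F z" using multiple[of snd] by blast
      have "finite {c. q (1, c) = 0}"
      proof -
        have eq: "{c. q (1, c) = 0} = (\<Union>z\<in>Z. {c. poly [:snd z, - fst z:] c = 0})"
          using Z(1) by (auto simp: q_def lin_at_def algebra_simps)
        have "finite {c. poly [:snd z, - fst z:] c = 0}" if "z \<in> Z" for z
        proof (rule poly_roots_finite)
          show "[:snd z, - fst z:] \<noteq> 0" using Znz[OF that] by (auto simp: prod_eq_iff)
        qed
        then show ?thesis unfolding eq by (rule finite_UN_I[OF Z(1)])
      qed
      then obtain x1 where x1: "q (1, x1) \<noteq> 0" using ex_new_if_finite[OF infinite_UNIV_char_0] by blast
      have nz: "c2 = c1 * x ^ j \<and> c1 \<noteq> 0" if "q (1, x) \<noteq> 0" for x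
      proof -
        have a1: "q (1, x) = c1 * ?F (1, x)" using c1[of "(1, x)"] by simp
        then have "c1 \<noteq> 0" "?F (1, x) \<noteq> 0" using that by auto
        moreover have "q (1, x) * x ^ j = c2 * ?F (1, x)" using c2[of "(1, x)"] by simp
        ultimately show ?thesis using a1 by simp
      qed
      \<comment> \<open>Two parameters with different \<open>j\<close>-th powers, both off the zeros
        of \<open>q\<close>, ask for different ratios of \<open>c2\<close> to
        \<open>c1\<close>.\<close>
      have "monom 1 j - [:x1 ^ j:] \<noteq> 0"
      proof
        assume "monom 1 j - [:x1 ^ j:] = 0"
        then have "coeff (monom 1 j - [:x1 ^ j:]) j = 0" by simp
        then show False using j(1) by (cases j) auto
      qed
      then have "finite ({c. q (1, c) = 0} \<union> {c. poly (monom 1 j - [:x1 ^ j:]) c = 0})"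
        using \<open>finite {c. q (1, c) = 0}\<close> poly_roots_finite by blast
      then obtain x2 where "x2 \<notin> {c. q (1, c) = 0} \<union> {c. poly (monom 1 j - [:x1 ^ j:]) c = 0}"
        using ex_new_if_finite[OF infinite_UNIV_char_0] by blast
      then have x2: "q (1, x2) \<noteq> 0" "x2 ^ j \<noteq> x1 ^ j" by (auto simp: poly_monom)
      then show False using nz[OF x1] nz[OF x2(1)] by simp
    qed
  qed
  \<comment> \<open>Subtracting the right constant multiple of \<open>h\<close> moves a generator of
    degree \<open>b\<close> into the ideal of the curve; the others are already there.\<close>
  have gen_in: "fs ! i \<in> ideal_gen N (vanishing_ideal N line.C \<union> {h})" if i: "i < length a" for i
  proof (cases "a ! i = b")
    case False
    then have "fs ! i \<in> vanishing_ideal N line.C"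
      using form_in_ideal_C_iff[OF deg(2)[OF i]] e[OF i] by simp
    then show ?thesis by (intro ideal_gen_base) simp
  next
    case True
    define f where "f = fs ! i + pconst (- e i) * h"
    have "f \<in> forms N b" unfolding f_def
      using deg(2)[OF i] True forms_mult[OF forms_const h(1)] by (intro forms_add) auto
    then have "f \<in> vanishing_ideal N line.C"
      using form_in_ideal_C_iff e(1)[OF i] by (simp add: f_def)
    moreover have "fs ! i = f + pconst (e i) * h"
      by (simp add: f_def single_uminus)
    moreover have "f + pconst (e i) * h \<in> ideal_gen N (vanishing_ideal N line.C \<union> {h})"
      if "f \<in> vanishing_ideal N line.C"
      using that by (intro ideal_gen_add ideal_gen_mult poly_ring_const ideal_gen_base) auto
    ultimately show ?thesis by simp
  qed
  have idl: "vanishing_ideal N X = ideal_gen N (vanishing_ideal N line.C \<union> {h})"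
  proof
    have "set fs \<subseteq> ideal_gen N (vanishing_ideal N line.C \<union> {h})"
      using gen_in len by (auto simp: in_set_conv_nth)
    then show "vanishing_ideal N X \<subseteq> ideal_gen N (vanishing_ideal N line.C \<union> {h})"
      unfolding ideal by (rule ideal_gen_minimal)
    have "vanishing_ideal N line.C \<subseteq> vanishing_ideal N X"
      using X_subset_C by (auto simp: vanishing_ideal_def)
    then show "ideal_gen N (vanishing_ideal N line.C \<union> {h}) \<subseteq> vanishing_ideal N X"
      using h(2) by (intro ideal_gen_subset_vanishing) simp
  qed
  have hf: "{h} \<subseteq> (\<Union>a. forms N a)" using h(1) by blast
  have "X = line.C \<inter> zero_locus N {h}"
  proof (intro set_eqI iffI)
    fix p assume p: "p \<in> X"
    then have "p \<in> proj_space N" using zariski_closed_subset[OF closed] by blast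
    then have "p \<in> zero_locus N {h}" using p h(2) by (auto simp: zero_locus_def vanishing_ideal_def)
    then show "p \<in> line.C \<inter> zero_locus N {h}" using p X_subset_C by blast
  next
    fix p assume p: "p \<in> line.C \<inter> zero_locus N {h}"
    then obtain z where z: "z \<noteq> (0, 0)" "p = line.pt z" using line.C_iff by blast
    have "?F z = 0"
      using p cls_in_zero_locus[OF hf line.veronese_par_nonzero[OF z(1)]] unfolding z(2) line.pt_def by simp
    then have "peval (fs ! i) (nu (line.par z)) = 0" if "i < length a" for i using e(1)[OF that z(1)] by simp
    then show "p \<in> X"
      unfolding z(2) line.pt_def by (intro in_X_if_gens_vanish line.veronese_par_nonzero z(1))
  qed
  moreover have "h \<noteq> 0" using h(4) by auto
  ultimately show "hypersurface_section N b line.C X"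
    unfolding hypersurface_section_def using h(1) idl by blast
qed

text \<open>Here \<open>N = 9\<close>, and the bounds require at least 6 linear and 3 quadric
  generators. These are then all generators and \<open>hilb 2 = 7 = 2 * d + 1\<close>, so all of
  them vanish on the curve, which contradicts \<open>r = N\<close>.\<close>

lemma cubic_case:
  assumes "d = 3" "hilb 1 = 4" "hilb 2 \<le> 7"
  shows False
proof -
  have N9: "N = 9" using N assms(1) by (simp add: choose_two)
  have q: "20 \<le> 2 * card (gens 2) + 2 * hilb 2" using quadric_bound unfolding assms(2) by simp
  have l: "10 \<le> card (gens 1) + 4" using linear_bound N9 assms(2) by simp
  have "card (gens 1) + card (gens 2) = length a" "length a = 9" "7 \<le> hilb 2"
    using q l gens_bound length_le N9 assms(3) by linarith+
  then show False using low_degree_gens assms(1,2) N9 by simp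
qed

text \<open>Here \<open>N = 5\<close>, with at least three linear generators and one quadric. If
  nothing else generates and \<open>hilb 2\<close> has its maximal value 5, then \<open>X\<close> is
  the conic; otherwise all five generators occur and exactly one form is needed on the
  conic.\<close>

lemma conic_case:
  assumes d: "d = 2" and b: "hilb 1 = 3" "hilb 2 \<le> 5" and srt: "sorted a"
  shows "(length a = 4 \<and> a = [1, 1, 1, 2] \<and> X = line.C) \<or>
    (length a = 5 \<and> (\<exists>b>0. a = [1, 1, 1, 2, b] \<and> card X = 2 * b \<and> hypersurface_section N b line.C X))"
proof -
  have N5: "N = 5" using N d by (simp add: choose_two)
  have q: "12 \<le> 2 * card (gens 2) + 2 * hilb 2" using quadric_bound unfolding b by simp
  have l: "6 \<le> card (gens 1) + 3" using linear_bound N5 b by simp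
  note bd = q l gens_bound length_le N5 b(2)
  show ?thesis
  proof (cases "card (gens 1) + card (gens 2) = length a \<and> 5 \<le> hilb 2")
    case True
    then have X: "X = line.C" "length a \<le> 4" using low_degree_gens d b N5 by auto
    then have m: "card (gens 1) = 3" "card (gens 2) = 1" "length a = 4" using True bd by linarith+
    have "a = [1, 1, 1, 2]"
    proof (rule nth_equalityI)
      fix i assume i: "i < length a"
      then have "i = 0 \<or> i = 1 \<or> i = 2 \<or> i = 3" using m by linarith
      then show "a ! i = [1, 1, 1, 2] ! i"
        using sorted_gens[OF srt i] deg(1)[OF i] m by (elim disjE) auto
    qed (use m in simp)
    then show ?thesis using X m by simp
  next
    case False
    \<comment> \<open>Either the fifth generator has degree above 2 and all quadrics of the ideal
      vanish on the conic, or it is a quadric too and the quadrics of the ideal fill at most one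
      dimension there.\<close>
    have m: "card (gens 1) = 3" "length a = 5" "card (gens 2) = 1 \<and> 5 \<le> hilb 2 \<or> card (gens 2) = 2 \<and> 4 \<le> hilb 2"
    proof -
      have "card (gens 2) = 1 \<or> card (gens 2) = 2" using bd by linarith
      then show "card (gens 1) = 3" "length a = 5" "card (gens 2) = 1 \<and> 5 \<le> hilb 2 \<or> card (gens 2) = 2 \<and> 4 \<le> hilb 2"
        using False bd by linarith+
    qed
    have a012: "a ! i = 1" if "i < 3" for i using sorted_gens(1)[OF srt, of i] that m by simp
    have a3: "a ! 3 = 2" using sorted_gens[OF srt, of 3] deg(1)[of 3] m by auto
    have a4: "a ! 4 = 2 \<longleftrightarrow> card (gens 2) = 2" "a ! 4 \<ge> 2"
      using sorted_gens[OF srt, of 4] deg(1)[of 4] m by auto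
    have a_eq: "a = [1, 1, 1, 2, a ! 4]"
    proof (rule nth_equalityI)
      fix i assume i: "i < length a"
      then have "i = 0 \<or> i = 1 \<or> i = 2 \<or> i = 3 \<or> i = 4" using m by linarith
      then show "a ! i = [1, 1, 1, 2, a ! 4] ! i" using a012 a3 by (elim disjE) auto
    qed (use m in simp)
    let ?v = "\<lambda>i z. peval (fs ! i) (nu (line.par z))"
    have v012: "?v i z = 0" if "i < 3" "z \<noteq> (0, 0)" for i z
      using vanish_on_C[of 1 "fs ! i" z] deg(2)[of i] gen_in_ideal[of i] a012[OF that(1)] that m b d by simp
    have not_all: "\<exists>w. w \<noteq> (0, 0) \<and> (?v 3 w \<noteq> 0 \<or> ?v 4 w \<noteq> 0)"
    proof (rule ccontr)
      assume n: "\<nexists>w. w \<noteq> (0, 0) \<and> (?v 3 w \<noteq> 0 \<or> ?v 4 w \<noteq> 0)"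
      have "?v i z = 0" if "i < length a" "z \<noteq> (0, 0)" for i z
      proof -
        have "i < 3 \<or> i = 3 \<or> i = 4" using that(1) m by linarith
        then show ?thesis using v012 n that(2) by blast
      qed
      then show False using X_eq_C_if_gens_vanish N5 m by simp
    qed
    have f3: "fs ! 3 \<in> forms N 2" "fs ! 3 \<in> vanishing_ideal N X" using deg(2)[of 3] gen_in_ideal[of 3] a3 m by auto
    have f4: "fs ! 4 \<in> forms N (a ! 4)" "fs ! 4 \<in> vanishing_ideal N X" using deg(2)[of 4] gen_in_ideal[of 4] m by auto
    have "card X = d * (a ! 4) \<and> hypersurface_section N (a ! 4) line.C X"
    proof (cases "\<exists>w. w \<noteq> (0, 0) \<and> ?v 4 w \<noteq> 0")
      case True
      then obtain w where w: "w \<noteq> (0, 0)" "?v 4 w \<noteq> 0" by blast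
      have "\<exists>c. (\<forall>z. z \<noteq> (0, 0) \<longrightarrow> ?v 3 z = c * ?v 4 z) \<and> (a ! 3 \<noteq> a ! 4 \<longrightarrow> c = 0)"
      proof (cases "card (gens 2) = 1")
        case True
        then have "?v 3 z = 0" if "z \<noteq> (0, 0)" for z
          using vanish_on_C[of 2 "fs ! 3" z] f3 m d that by simp
        then show ?thesis by (intro exI[of _ 0]) simp
      next
        case False
        then have "card (gens 2) = 2" "4 \<le> hilb 2" using m by auto
        then have "fs ! 4 \<in> forms N 2" "a ! 3 = a ! 4" using f4 a4 a3 by auto
        then show ?thesis
          using proportional_on_C[of 2 "fs ! 3" "fs ! 4" w] f3 f4 w d \<open>4 \<le> hilb 2\<close> by simp
      qed
      then have "\<exists>c. (\<forall>z. z \<noteq> (0, 0) \<longrightarrow> ?v i z = c * ?v 4 z) \<and> (a ! i \<noteq> a ! 4 \<longrightarrow> c = 0)" if i: "i < length a" for i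
      proof -
        have "i < 3 \<or> i = 3 \<or> i = 4" using i m by linarith
        then show ?thesis
        proof (elim disjE)
          assume "i < 3"
          then show ?thesis using v012 by (intro exI[of _ 0]) simp
        next
          assume "i = 4"
          then show ?thesis by (intro exI[of _ 1]) simp
        qed (use \<open>\<exists>c. (\<forall>z. z \<noteq> (0, 0) \<longrightarrow> ?v 3 z = c * ?v 4 z) \<and> (a ! 3 \<noteq> a ! 4 \<longrightarrow> c = 0)\<close> in blast)
      qed
      then show ?thesis by (rule one_form_section[OF f4 w])
    next
      \<comment> \<open>The last generator vanishes on the conic, so \<open>fs ! 3\<close> does not.
        This is possible only if both are quadrics, and \<open>fs ! 3\<close> takes its
        place.\<close>
      case False
      then obtain w where w: "w \<noteq> (0, 0)" "?v 3 w \<noteq> 0" using not_all by blast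
      have "card (gens 2) \<noteq> 1"
      proof
        assume "card (gens 2) = 1"
        then have "?v 3 w = 0" using vanish_on_C[of 2 "fs ! 3" w] f3 m d w(1) by simp
        then show False using w by simp
      qed
      then have a42: "a ! 4 = 2" using m a4 by blast
      have "\<exists>c. (\<forall>z. z \<noteq> (0, 0) \<longrightarrow> ?v i z = c * ?v 3 z) \<and> (a ! i \<noteq> a ! 4 \<longrightarrow> c = 0)" if i: "i < length a" for i
      proof -
        have "i < 3 \<or> i = 3 \<or> i = 4" using i m by linarith
        then show ?thesis
        proof (elim disjE)
          assume "i < 3"
          then show ?thesis using v012 by (intro exI[of _ 0]) simp
        next
          assume "i = 3"
          then show ?thesis using a3 a42 by (intro exI[of _ 1]) simp
        next
          assume "i = 4"
          then show ?thesis using False by (intro exI[of _ 0]) auto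
        qed
      qed
      then show ?thesis using one_form_section[OF _ f3(2) w, of "a ! 4"] f3(1) a42 by simp
    qed
    then show ?thesis using a_eq m a4(2) d by (intro disjI2 conjI exI[of _ "a ! 4"]) auto
  qed
qed

end

theorem theorem4p5:
  fixes X :: "(nat \<Rightarrow> 'k::{alg_closed_field, field_char_0}) set set"
    and d N r :: nat and a :: "nat list"
  assumes "d \<ge> 2"
    and "N = (d + 2 choose 2) - 1"
    and "X \<subseteq> veronese_variety 2 d"
    and "length a = r"
    and "complete_intersection N a X"
    and "sorted a"
  shows
    "(d = 2 \<and> r = 4 \<and> a = [1, 1, 1, 2] \<and> conic N X \<and> X \<subseteq> veronese_variety 2 2) \<or>
     (d = 2 \<and> r = 5 \<and> (\<exists>b. b > 0 \<and> a = [1, 1, 1, 2, b] \<and> card X = 2 * b \<and>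
        (\<exists>C. conic N C \<and> C \<subseteq> veronese_variety 2 2 \<and> hypersurface_section N b C X))) \<or>
     (r = N \<and> a = replicate N 1 \<and> (\<exists>p. X = {p})) \<or>
     (r = N \<and> a = replicate (N - 1) 1 @ [2] \<and> card X = 2)"
proof -
  from assms(5) obtain fs where fs: "length fs = length a"
    "\<And>i. i < length a \<Longrightarrow> 1 \<le> a ! i \<and> fs ! i \<in> forms N (a ! i)"
    "vanishing_ideal N X = ideal_gen N (set fs)"
    unfolding complete_intersection_def by blast
  interpret veronese_ci d N X a fs
    using assms fs by unfold_locales (auto simp: complete_intersection_def proj_variety_def)
  from hilb_cases show ?thesis
  proof (elim disjE conjE)
    assume "hilb 1 = 1"
    then show ?thesis using point_case assms(4,6) by blast
  next
    assume "hilb 1 = 2" "hilb 2 \<le> hilb 1"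
    then show ?thesis using two_points_case assms(4,6) by simp
  next
    assume h: "d \<le> 3" "hilb 1 = d + 1" "hilb 2 \<le> 2 * d + 1" "fdim Y (homfun (coords 2) 1) = 2"
    have "fin_gen (homfun (coords 2 :: ((nat \<Rightarrow> 'k) \<Rightarrow> 'k) set) 1)" by (rule fin_gen_homfun) simp
    \<comment> \<open>Interpolation applied to the coordinates writes every point of
      \<open>Y\<close> as a combination of \<open>p 0\<close> and \<open>p 1\<close>, which span the
      line; \<open>g 0\<close> and \<open>g 1\<close> are its parameters.\<close>
    from dual_sys_exists[OF homfun_subspace this, of Y] obtain p g where
      pg: "dual_sys Y (homfun (coords 2) 1) 2 p g"
        "\<forall>f\<in>homfun (coords 2) 1. \<forall>y\<in>Y. f y = (\<Sum>i<2. f (p i) * g i y)"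
      unfolding h(4) by blast
    have pY: "p 0 \<in> Y" "p 1 \<in> Y" using pg(1) by (auto simp: dual_sys_def)
    interpret line: veronese_line d N "p 0" "p 1" "g 0" "g 1"
      using assms(1,2) pY Y_nonzero pg(1) by unfold_locales (auto simp: dual_sys_def)
    interpret veronese_ci_line d N X a fs "p 0" "p 1" "g 0" "g 1"
    proof unfold_locales
      fix y assume y: "y \<in> Y"
      show "y = line.par (g 0 y, g 1 y)"
      proof
        fix i
        show "y i = line.par (g 0 y, g 1 y) i"
        proof (cases "i \<le> 2")
          case True
          from pg(2)[rule_format, OF homfun_base[OF coordsI[OF this]] y]
          show ?thesis unfolding line.par_def by (simp add: numeral_2_eq_2 mult.commute)
        next
          case False
          have "w i = 0" if "w \<in> Y" for w
            using that False Y_nonzero by (auto simp: nonzero_vecs_def)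
          from this[OF y] this[OF pY(1)] this[OF pY(2)] show ?thesis unfolding line.par_def by simp
        qed
      qed
    qed
    consider "d = 2" | "d = 3" using h(1) assms(1) by linarith
    then show ?thesis
    proof cases
      case 1
      have C: "conic N line.C" "line.C \<subseteq> veronese_variety 2 2"
        using line.conic_C[OF 1] line.C_subset_veronese 1 by auto
      have "hilb 1 = 3" "hilb 2 \<le> 5" using h 1 by auto
      from conic_case[OF 1 this assms(6)] show ?thesis
      proof (elim disjE conjE exE)
        assume "length a = 4" "a = [1, 1, 1, 2]" "X = line.C"
        then show ?thesis using C 1 assms(4) by (intro disjI1) simp
      next
        fix b assume b: "length a = 5" "b > 0" "a = [1, 1, 1, 2, b]" "card X = 2 * b" "hypersurface_section N b line.C X"
        have "\<exists>C. conic N C \<and> C \<subseteq> veronese_variety 2 2 \<and> hypersurface_section N b C X"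
          by (intro exI[of _ line.C] conjI C b)
        with b 1 assms(4) show ?thesis by (intro disjI2[OF disjI1] conjI exI[of _ b]) simp_all
      qed
    next
      case 2
      then show ?thesis using cubic_case h by simp
    qed
  qed
qed

end
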